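(* Let $L$ be a language and $T$ a complete first-order $L$-theory. Assume $T$ has NIP. Let $M\models T$ and let $M\prec N$ and $(N,M)\prec (N',M')$ be sufficiently saturated elementary extensions, where $(N,M)$ and $(N',M')$ are $L\cup\{P\}$-structures and $P$ is a unary predicate, not in $L$, such that $P(N)=M$ and $P(N')=M'$. Let $A\subseteq M'$ be a small non-constant $L$-indiscernible sequence. Then there is a small $L$-indiscernible sequence $A'\subseteq M'$ which extends $A$ and has the following property: for every complete $L$-type $q(\bar x)$ over $A'$ with $\bar x=(x_1,\dots,x_n)$, if $q(\bar x)$ is finitely realised in $A'$, then $q(\bar x)\cup\{P(x_1),\dots,P(x_n)\}$ implies a complete $L$-type over $N$.
   Context: Structures may be many-sorted; in that case $P$ stands for a family $(P_s)$ of unary predicates, one for each sort $s$, with $P_s(N_s)=M_s$. "Sufficiently saturated" and "small" follow the usual convention: $N$ is a sufficiently saturated $L$-elementary extension of $M$ (relative to $|M|+|L|$), and $(N',M')$ is an $L\cup\{P\}$-elementary extension of $(N,M)$ that is saturated and strongly homogeneous up to a large (e.g. strong limit) cardinal $\kappa>|N|+|L|$; "small" means of cardinality less than $\kappa$. A non-constant indiscernible sequence $(a_i)_{i\in I}$ (indexed by a linear order $I$) is identified with the ordered set $\{a_i:i\in I\}$, where $a_i<a_j$ if and only if $i<j$. $A\subseteq M'$ means that $A$ is a subset of a finite cartesian power of sorts of $M'$, so the elements of the sequence may be finite tuples. $A'$ extends $A$ means $A\subseteq A'$ as ordered sets (the order of $A'$ restricts to that of $A$). Each variable $x_i$ is of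 the sort (cartesian power of sorts) of elements of $A$, and $P(x_i)$ says all coordinates of $x_i$ lie in $P$. $q(\bar x)$ is finitely realised in $A'$ if every formula in $q$ (equivalently every finite part of $q$) is satisfied by some $n$-tuple of elements of $A'$. The conclusion "$q(\bar x)\cup\{P(x_1),\dots,P(x_n)\}$ implies a complete $L$-type over $N$" means that any two $n$-tuples with entries in $M'$ realising $q$ have the same $L$-type over $N$ (computed in $N'$). *)

theory Defs
  imports Main
begin

unbundle cardinal_syntax

text \<open>
  The sorts are the elements of the type \<open>'s\<close>. The non-logical symbols of a language form
  arbitrary, possibly empty, subsets of the types \<open>'f\<close> and \<open>'r\<close>.
\<close>

record ('s, 'f, 'r) language =
  funs :: "'f set"
  rels :: "'r set"
  fun_dom :: "'f \<Rightarrow> 's list"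
  fun_cod :: "'f \<Rightarrow> 's"
  rel_dom :: "'r \<Rightarrow> 's list"

type_synonym 's var = "'s \<times> nat"

datatype ('s, 'f) trm = Var "'s var" | Fn 'f "('s, 'f) trm list"

datatype ('s, 'f, 'r) fm =
    Eq "('s, 'f) trm" "('s, 'f) trm"
  | Rel 'r "('s, 'f) trm list"
  | Neg "('s, 'f, 'r) fm"
  | Conj "('s, 'f, 'r) fm" "('s, 'f, 'r) fm"
  | Ex "'s var" "('s, 'f, 'r) fm"

inductive has_sort :: "('s, 'f, 'r) language \<Rightarrow> ('s, 'f) trm \<Rightarrow> 's \<Rightarrow> bool"
  for L :: "('s, 'f, 'r) language" where
  "has_sort L (Var v) (fst v)"
| "f \<in> funs L \<Longrightarrow> list_all2 (has_sort L) ts (fun_dom L f) \<Longrightarrow> has_sort L (Fn f ts) (fun_cod L f)"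

primrec wf_fm :: "('s, 'f, 'r) language \<Rightarrow> ('s, 'f, 'r) fm \<Rightarrow> bool" where
  "wf_fm L (Eq t u) \<longleftrightarrow> (\<exists>s. has_sort L t s \<and> has_sort L u s)"
| "wf_fm L (Rel r ts) \<longleftrightarrow> r \<in> rels L \<and> list_all2 (has_sort L) ts (rel_dom L r)"
| "wf_fm L (Neg \<phi>) \<longleftrightarrow> wf_fm L \<phi>"
| "wf_fm L (Conj \<phi> \<psi>) \<longleftrightarrow> wf_fm L \<phi> \<and> wf_fm L \<psi>"
| "wf_fm L (Ex v \<phi>) \<longleftrightarrow> wf_fm L \<phi>"

primrec fv_trm :: "('s, 'f) trm \<Rightarrow> 's var set" where
  "fv_trm (Var v) = {v}"
| "fv_trm (Fn f ts) = \<Union> (set (map fv_trm ts))"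

primrec fv :: "('s, 'f, 'r) fm \<Rightarrow> 's var set" where
  "fv (Eq t u) = fv_trm t \<union> fv_trm u"
| "fv (Rel r ts) = \<Union> (set (map fv_trm ts))"
| "fv (Neg \<phi>) = fv \<phi>"
| "fv (Conj \<phi> \<psi>) = fv \<phi> \<union> fv \<psi>"
| "fv (Ex v \<phi>) = fv \<phi> - {v}"

text \<open>
  A tuple of variables of sorts \<open>\<sigma> = [s\<^sub>0, \<dots>, s\<^sub>k]\<close> is, after renaming, the tuple of the variables
  \<open>(s\<^sub>0, 0), \<dots>, (s\<^sub>k, k)\<close>. The set \<open>formulas L \<sigma>\<close> consists of the \<open>L\<close>-formulas in these variables;
  \<open>formulas L []\<close> is the set of \<open>L\<close>-sentences.
\<close>

definition formulas :: "('s, 'f, 'r) language \<Rightarrow> 's list \<Rightarrow> ('s, 'f, 'r) fm set" where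
  "formulas L \<sigma> = {\<phi>. wf_fm L \<phi> \<and> fv \<phi> \<subseteq> {(\<sigma> ! j, j) | j. j < length \<sigma>}}"

record ('s, 'f, 'r, 'a) struct =
  univ :: "'s \<Rightarrow> 'a set"
  fun_int :: "'f \<Rightarrow> 'a list \<Rightarrow> 'a"
  rel_int :: "'r \<Rightarrow> 'a list \<Rightarrow> bool"

definition tuples :: "('s \<Rightarrow> 'a set) \<Rightarrow> 's list \<Rightarrow> 'a list set" where
  "tuples X \<sigma> = {a. list_all2 (\<lambda>x s. x \<in> X s) a \<sigma>}"

definition is_structure :: "('s, 'f, 'r) language \<Rightarrow> ('s, 'f, 'r, 'a) struct \<Rightarrow> bool" where
  "is_structure L K \<longleftrightarrow>
     (\<forall>s. univ K s \<noteq> {}) \<and>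
     (\<forall>f\<in>funs L. \<forall>a\<in>tuples (univ K) (fun_dom L f). fun_int K f a \<in> univ K (fun_cod L f))"

primrec eval_trm :: "('s, 'f, 'r, 'a) struct \<Rightarrow> ('s var \<Rightarrow> 'a) \<Rightarrow> ('s, 'f) trm \<Rightarrow> 'a" where
  "eval_trm K e (Var v) = e v"
| "eval_trm K e (Fn f ts) = fun_int K f (map (eval_trm K e) ts)"

primrec sat :: "('s, 'f, 'r, 'a) struct \<Rightarrow> ('s, 'f, 'r) fm \<Rightarrow> ('s var \<Rightarrow> 'a) \<Rightarrow> bool" where
  "sat K (Eq t u) e \<longleftrightarrow> eval_trm K e t = eval_trm K e u"
| "sat K (Rel r ts) e \<longleftrightarrow> rel_int K r (map (eval_trm K e) ts)"
| "sat K (Neg \<phi>) e \<longleftrightarrow> \<not> sat K \<phi> e"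
| "sat K (Conj \<phi> \<psi>) e \<longleftrightarrow> sat K \<phi> e \<and> sat K \<psi> e"
| "sat K (Ex v \<phi>) e \<longleftrightarrow> (\<exists>x\<in>univ K (fst v). sat K \<phi> (e(v := x)))"

text \<open>
  Satisfaction \<open>K \<Turnstile> \<phi>(a)\<close> for \<open>\<phi> \<in> formulas L \<sigma>\<close> and \<open>a\<close> of length \<open>length \<sigma>\<close>: the variable
  \<open>(\<sigma> ! j, j)\<close> is sent to \<open>a ! j\<close>. Out of range the value of \<open>nth\<close> is unspecified, but it is only
  assigned to variables that are not free in \<open>\<phi>\<close>.
\<close>

definition holds_at :: "('s, 'f, 'r, 'a) struct \<Rightarrow> ('s, 'f, 'r) fm \<Rightarrow> 'a list \<Rightarrow> bool" where
  "holds_at K \<phi> a \<longleftrightarrow> sat K \<phi> (\<lambda>(s, j). a ! j)"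

definition is_model ::
  "('s, 'f, 'r) language \<Rightarrow> ('s, 'f, 'r) fm set \<Rightarrow> ('s, 'f, 'r, 'a) struct \<Rightarrow> bool" where
  "is_model L T K \<longleftrightarrow> is_structure L K \<and> (\<forall>\<phi>\<in>T. holds_at K \<phi> [])"

text \<open>
  HOL cannot quantify over models in all types, so the next two notions refer to the models whose
  elements belong to a given type \<open>'a\<close>. Completeness and NIP in the usual sense, where all models
  are considered, imply the versions below (given that \<open>T\<close> has a model in \<open>'a\<close>), so using the latter
  as hypotheses is no restriction.
\<close>

definition complete_theory ::
  "'a itself \<Rightarrow> ('s, 'f, 'r) language \<Rightarrow> ('s, 'f, 'r) fm set \<Rightarrow> bool" where
  "complete_theory (_ :: 'a itself) L T \<longleftrightarrow>
     T \<subseteq> formulas L [] \<and>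
     (\<exists>K :: ('s, 'f, 'r, 'a) struct. is_model L T K) \<and>
     (\<forall>\<phi>\<in>formulas L [].
        (\<forall>K :: ('s, 'f, 'r, 'a) struct. is_model L T K \<longrightarrow> holds_at K \<phi> []) \<or>
        (\<forall>K :: ('s, 'f, 'r, 'a) struct. is_model L T K \<longrightarrow> holds_at K (Neg \<phi>) []))"

text \<open>
  The formula \<open>\<phi>(x;y)\<close>, with \<open>x\<close> of sorts \<open>\<sigma>\<close> and \<open>y\<close> of sorts \<open>\<tau>\<close>, has the independence property
  in \<open>K\<close> if for every \<open>n\<close> it shatters \<open>n\<close> tuples of \<open>K\<close>.
\<close>

definition has_IP ::
  "('s, 'f, 'r, 'a) struct \<Rightarrow> 's list \<Rightarrow> 's list \<Rightarrow> ('s, 'f, 'r) fm \<Rightarrow> bool" where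
  "has_IP K \<sigma> \<tau> \<phi> \<longleftrightarrow>
     (\<forall>n::nat. \<exists>(a :: nat \<Rightarrow> 'a list) (b :: nat set \<Rightarrow> 'a list).
        (\<forall>i<n. a i \<in> tuples (univ K) \<sigma>) \<and>
        (\<forall>S\<subseteq>{..<n}. b S \<in> tuples (univ K) \<tau>) \<and>
        (\<forall>i<n. \<forall>S\<subseteq>{..<n}. holds_at K \<phi> (a i @ b S) \<longleftrightarrow> i \<in> S))"

definition NIP :: "'a itself \<Rightarrow> ('s, 'f, 'r) language \<Rightarrow> ('s, 'f, 'r) fm set \<Rightarrow> bool" where
  "NIP (_ :: 'a itself) L T \<longleftrightarrow>
     (\<forall>\<sigma> \<tau>. \<forall>\<phi>\<in>formulas L (\<sigma> @ \<tau>).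
        \<not> (\<exists>K :: ('s, 'f, 'r, 'a) struct. is_model L T K \<and> has_IP K \<sigma> \<tau> \<phi>))"

definition substructure ::
  "('s, 'f, 'r) language \<Rightarrow> ('s, 'f, 'r, 'a) struct \<Rightarrow> ('s, 'f, 'r, 'a) struct \<Rightarrow> bool" where
  "substructure L M N \<longleftrightarrow>
     is_structure L M \<and> is_structure L N \<and> (\<forall>s. univ M s \<subseteq> univ N s) \<and>
     (\<forall>f\<in>funs L. \<forall>a\<in>tuples (univ M) (fun_dom L f). fun_int M f a = fun_int N f a) \<and>
     (\<forall>r\<in>rels L. \<forall>a\<in>tuples (univ M) (rel_dom L r). rel_int M r a \<longleftrightarrow> rel_int N r a)"

definition elementary_extension ::
  "('s, 'f, 'r) language \<Rightarrow> ('s, 'f, 'r, 'a) struct \<Rightarrow> ('s, 'f, 'r, 'a) struct \<Rightarrow> bool" where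
  "elementary_extension L M N \<longleftrightarrow>
     substructure L M N \<and>
     (\<forall>\<sigma>. \<forall>\<phi>\<in>formulas L \<sigma>. \<forall>a\<in>tuples (univ M) \<sigma>. holds_at M \<phi> a \<longleftrightarrow> holds_at N \<phi> a)"

text \<open>
  The language \<open>L \<union> {P}\<close>, where \<open>P\<close> is a family of unary predicates \<open>Inr s\<close>, one for each sort \<open>s\<close>,
  and the expansion of \<open>N\<close> in which \<open>P\<close> is interpreted as the family of sets \<open>X\<close>.
\<close>

definition pair_language :: "('s, 'f, 'r) language \<Rightarrow> ('s, 'f, 'r + 's) language" where
  "pair_language L =
     \<lparr>funs = funs L, rels = Inl ` rels L \<union> range Inr,
      fun_dom = fun_dom L, fun_cod = fun_cod L,
      rel_dom = case_sum (rel_dom L) (\<lambda>s. [s])\<rparr>"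

definition pair_struct ::
  "('s, 'f, 'r, 'a) struct \<Rightarrow> ('s \<Rightarrow> 'a set) \<Rightarrow> ('s, 'f, 'r + 's, 'a) struct" where
  "pair_struct N X =
     \<lparr>univ = univ N, fun_int = fun_int N,
      rel_int = case_sum (rel_int N) (\<lambda>s a. hd a \<in> X s)\<rparr>"

text \<open>
  \<open>L(B)\<close>: the language \<open>L\<close> with a constant \<open>Inr (s, b)\<close> for every element \<open>b \<in> B s\<close>.
\<close>

definition param_language ::
  "('s, 'f, 'r) language \<Rightarrow> ('s \<Rightarrow> 'a set) \<Rightarrow> ('s, 'f + 's \<times> 'a, 'r) language" where
  "param_language L B =
     \<lparr>funs = Inl ` funs L \<union> Inr ` Sigma UNIV B, rels = rels L,
      fun_dom = case_sum (fun_dom L) (\<lambda>_. []), fun_cod = case_sum (fun_cod L) fst,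
      rel_dom = rel_dom L\<rparr>"

definition param_struct ::
  "('s, 'f, 'r, 'a) struct \<Rightarrow> ('s, 'f + 's \<times> 'a, 'r, 'a) struct" where
  "param_struct K =
     \<lparr>univ = univ K, fun_int = case_sum (fun_int K) (\<lambda>(s, b) _. b), rel_int = rel_int K\<rparr>"

definition realises ::
  "('s, 'f, 'r, 'a) struct \<Rightarrow> 'a list \<Rightarrow> ('s, 'f + 's \<times> 'a, 'r) fm set \<Rightarrow> bool" where
  "realises K a q \<longleftrightarrow> (\<forall>\<phi>\<in>q. holds_at (param_struct K) \<phi> a)"

definition finitely_realised ::
  "('s, 'f, 'r, 'a) struct \<Rightarrow> 'a list set \<Rightarrow> ('s, 'f + 's \<times> 'a, 'r) fm set \<Rightarrow> bool" where
  "finitely_realised K X q \<longleftrightarrow> (\<forall>F\<subseteq>q. finite F \<longrightarrow> (\<exists>a\<in>X. realises K a F))"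

definition complete_type ::
  "('s, 'f, 'r) language \<Rightarrow> ('s, 'f, 'r, 'a) struct \<Rightarrow> ('s \<Rightarrow> 'a set) \<Rightarrow> 's list \<Rightarrow>
   ('s, 'f + 's \<times> 'a, 'r) fm set \<Rightarrow> bool" where
  "complete_type L K B \<sigma> q \<longleftrightarrow>
     q \<subseteq> formulas (param_language L B) \<sigma> \<and>
     finitely_realised K (tuples (univ K) \<sigma>) q \<and>
     (\<forall>\<phi>\<in>formulas (param_language L B) \<sigma>. \<phi> \<in> q \<or> Neg \<phi> \<in> q)"

definition tp ::
  "('s, 'f, 'r) language \<Rightarrow> ('s, 'f, 'r, 'a) struct \<Rightarrow> ('s \<Rightarrow> 'a set) \<Rightarrow> 's list \<Rightarrow> 'a list \<Rightarrow>
   ('s, 'f + 's \<times> 'a, 'r) fm set" where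
  "tp L K B \<sigma> a = {\<phi> \<in> formulas (param_language L B) \<sigma>. holds_at (param_struct K) \<phi> a}"

text \<open>
  The cardinality of a family of sets indexed by the sorts, and the cardinality of a language, which
  is by convention the (always infinite) number of its formulas.
\<close>

definition card_fam :: "('s \<Rightarrow> 'a set) \<Rightarrow> ('s \<times> 'a) rel" where
  "card_fam B = |Sigma UNIV B|"

definition card_lang :: "('s, 'f, 'r) language \<Rightarrow> ('s, 'f, 'r) fm rel" where
  "card_lang L = |{\<phi>. wf_fm L \<phi>}|"

definition saturated ::
  "'k rel \<Rightarrow> ('s, 'f, 'r) language \<Rightarrow> ('s, 'f, 'r, 'a) struct \<Rightarrow> bool" where
  "saturated \<kappa> L K \<longleftrightarrow>
     (\<forall>B \<sigma> q. (\<forall>s. B s \<subseteq> univ K s) \<and> card_fam B <o \<kappa> \<and> complete_type L K B \<sigma> q \<longrightarrow>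
        (\<exists>a\<in>tuples (univ K) \<sigma>. realises K a q))"

definition automorphism ::
  "('s, 'f, 'r) language \<Rightarrow> ('s, 'f, 'r, 'a) struct \<Rightarrow> ('s \<Rightarrow> 'a \<Rightarrow> 'a) \<Rightarrow> bool" where
  "automorphism L K g \<longleftrightarrow>
     (\<forall>s. bij_betw (g s) (univ K s) (univ K s)) \<and>
     (\<forall>f\<in>funs L. \<forall>a\<in>tuples (univ K) (fun_dom L f).
        g (fun_cod L f) (fun_int K f a) = fun_int K f (map2 g (fun_dom L f) a)) \<and>
     (\<forall>r\<in>rels L. \<forall>a\<in>tuples (univ K) (rel_dom L r).
        rel_int K r a \<longleftrightarrow> rel_int K r (map2 g (rel_dom L r) a))"

definition partial_elementary ::
  "('s, 'f, 'r) language \<Rightarrow> ('s, 'f, 'r, 'a) struct \<Rightarrow> ('s \<Rightarrow> 'a set) \<Rightarrow> ('s \<Rightarrow> 'a \<Rightarrow> 'a) \<Rightarrow> bool" where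
  "partial_elementary L K B h \<longleftrightarrow>
     (\<forall>s. B s \<subseteq> univ K s \<and> h s ` B s \<subseteq> univ K s) \<and>
     (\<forall>\<sigma>. \<forall>\<phi>\<in>formulas L \<sigma>. \<forall>a\<in>tuples B \<sigma>. holds_at K \<phi> a \<longleftrightarrow> holds_at K \<phi> (map2 h \<sigma> a))"

definition strongly_homogeneous ::
  "'k rel \<Rightarrow> ('s, 'f, 'r) language \<Rightarrow> ('s, 'f, 'r, 'a) struct \<Rightarrow> bool" where
  "strongly_homogeneous \<kappa> L K \<longleftrightarrow>
     (\<forall>B h. card_fam B <o \<kappa> \<and> partial_elementary L K B h \<longrightarrow>
        (\<exists>g. automorphism L K g \<and> (\<forall>s. \<forall>x\<in>B s. g s x = h s x)))"

text \<open>
  A non-constant indiscernible sequence has pairwise distinct terms and is identified with the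
  ordered set of its terms: a set \<open>A\<close> of tuples of sorts \<open>\<sigma>\<close> with a (reflexive) linear order \<open>r\<close> on it.
\<close>

definition indiscernible ::
  "('s, 'f, 'r) language \<Rightarrow> ('s, 'f, 'r, 'a) struct \<Rightarrow> 's list \<Rightarrow> 'a list set \<Rightarrow> 'a list rel \<Rightarrow> bool" where
  "indiscernible L K \<sigma> A r \<longleftrightarrow>
     A \<subseteq> tuples (univ K) \<sigma> \<and> linear_order_on A r \<and>
     (\<forall>n. \<forall>\<phi>\<in>formulas L (concat (replicate n \<sigma>)). \<forall>as bs.
        length as = n \<and> set as \<subseteq> A \<and> sorted_wrt (\<lambda>x y. (x, y) \<in> r - Id) as \<and>
        length bs = n \<and> set bs \<subseteq> A \<and> sorted_wrt (\<lambda>x y. (x, y) \<in> r - Id) bs \<longrightarrow>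
        (holds_at K \<phi> (concat as) \<longleftrightarrow> holds_at K \<phi> (concat bs)))"

definition nonconstant :: "'b set \<Rightarrow> bool" where
  "nonconstant A \<longleftrightarrow> (\<exists>a\<in>A. \<exists>b\<in>A. a \<noteq> b)"

definition extends_seq :: "'b set \<Rightarrow> 'b rel \<Rightarrow> 'b set \<Rightarrow> 'b rel \<Rightarrow> bool" where
  "extends_seq A' r' A r \<longleftrightarrow> A \<subseteq> A' \<and> Restr r' A = r"

definition coords :: "'s list \<Rightarrow> 'a list set \<Rightarrow> 's \<Rightarrow> 'a set" where
  "coords \<sigma> A s = {a ! i | a i. a \<in> A \<and> i < length \<sigma> \<and> \<sigma> ! i = s}"

definition ntuples :: "nat \<Rightarrow> 'a list set \<Rightarrow> 'a list set" where
  "ntuples n A = {concat as | as. length as = n \<and> set as \<subseteq> A}"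

end

theory Submission
  imports Defs
begin

text \<open>
  Extend \<open>A\<close>, by Zorn's lemma, to a sequence \<open>A'\<close> that is maximal among indiscernible sequences with a
  choice of witnesses: a witness for a formula \<open>\<psi>(x;c)\<close> with \<open>c\<close> in \<open>N\<close> consists of two tuples of the
  sequence on which \<open>\<psi>(x;c)\<close> differs although no element outside them separates their entries. Let an
  ultrafilter \<open>U\<close> on the \<open>n\<close>-tuples of \<open>A'\<close> extend \<open>q\<close>, and let \<open>b\<close> in \<open>M'\<close> realise \<open>q\<close>. If the truth value
  of \<open>\<psi>(b;c)\<close> is not the \<open>U\<close>-limit of the truth values of \<open>\<psi>(t;c)\<close>, take by saturation some \<open>s\<close> in \<open>M'\<close>
  realising the limit type along \<open>U\<close> over \<open>A'\<close>, \<open>b\<close> and \<open>N\<close>. Then \<open>A'\<close> together with \<open>b\<close> and \<open>s\<close> is again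
  indiscernible, and \<open>(b, s)\<close> is a witness for \<open>\<psi>(x;c)\<close>; by maximality there are already infinitely many
  essentially disjoint witnesses in \<open>A'\<close>. Choosing one of the two tuples in each of finitely many
  witnesses always gives the same order type, hence the same type by indiscernibility, and so
  \<open>\<psi>\<close> has the independence property. Therefore the type of \<open>b\<close> over \<open>N\<close> only depends on \<open>U\<close>.
\<close>

section \<open>Substitution and change of language\<close>

text \<open>Size is the first obstacle: a maximal indiscernible sequence in \<open>M'\<close> would
  contain all witnesses but need not be small. Hence the sequence is maximised together with a
  record of answered tasks; one answer per task and generation from \<open>A\<close> keep its size
  at most \<open>|A| + |N| + |L|\<close>. The second obstacle is that entries of \<open>b\<close>
  may repeat or lie in \<open>A'\<close> already, so witnesses cannot be fully disjoint. A task
  therefore names a finite set \<open>Fs\<close> to avoid and a set \<open>Gs\<close> of tolerated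
  entries; for \<open>b\<close>, \<open>Gs\<close> consists of its entries in \<open>A'\<close>. The
  order of an indiscernible sequence need not be definable, so the position of new elements cannot
  be read off their type. It is taken to be the limit along \<open>U\<close>, which is why an
  ultrafilter replaces \<open>q\<close>; since \<open>s\<close> is a limit over \<open>b\<close>
  too, \<open>b\<close> and \<open>s\<close> can be adjoined one after the other. The parameter
  \<open>c\<close> is the same in all witnesses. The independence property appears on quantifying it
  away: that some \<open>y\<close> gives \<open>\<psi>(x;y)\<close> a prescribed pattern on finitely
  many tuples is a formula without parameters, to which indiscernibility applies.\<close>

lemma eval_trm_cong:
  "(\<And>v. v \<in> fv_trm t \<Longrightarrow> e v = e' v) \<Longrightarrow> eval_trm K e t = eval_trm K e' t"
proof (induction t)
  case (Fn c ts)
  have "map (eval_trm K e) ts = map (eval_trm K e') ts"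
    by (rule map_cong) (use Fn in auto)
  then show ?case by (simp del: map_eq_conv)
qed auto

lemma sat_cong:
  "(\<And>v. v \<in> fv \<phi> \<Longrightarrow> e v = e' v) \<Longrightarrow> sat K \<phi> e \<longleftrightarrow> sat K \<phi> e'"
proof (induction \<phi> arbitrary: e e')
  case (Eq t u)
  have "eval_trm K e t = eval_trm K e' t" "eval_trm K e u = eval_trm K e' u"
    by (rule eval_trm_cong, use Eq in simp)+
  then show ?case by simp
next
  case (Rel c ts)
  have "map (eval_trm K e) ts = map (eval_trm K e') ts"
    by (rule map_cong) (use Rel in \<open>auto intro!: eval_trm_cong\<close>)
  then show ?case by (simp del: map_eq_conv)
next
  case (Neg \<phi>)
  have "sat K \<phi> e = sat K \<phi> e'"
    by (rule Neg.IH) (use Neg.prems in simp)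
  then show ?case by simp
next
  case (Conj \<phi> \<psi>)
  have "sat K \<phi> e = sat K \<phi> e'"
    by (rule Conj.IH(1)) (use Conj.prems in simp)
  moreover have "sat K \<psi> e = sat K \<psi> e'"
    by (rule Conj.IH(2)) (use Conj.prems in simp)
  ultimately show ?case by simp
next
  case (Ex v \<phi>)
  have "sat K \<phi> (e(v := x)) = sat K \<phi> (e'(v := x))" for x
    by (rule Ex.IH) (use Ex.prems in simp)
  then show ?case by simp
qed

primrec sub_trm ::
  "('f \<Rightarrow> ('s, 'g) trm list \<Rightarrow> ('s, 'g) trm) \<Rightarrow> ('s var \<Rightarrow> ('s, 'g) trm) \<Rightarrow>
   ('s, 'f) trm \<Rightarrow> ('s, 'g) trm" where
  "sub_trm g f (Var v) = f v"
| "sub_trm g f (Fn c ts) = g c (map (sub_trm g f) ts)"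

text \<open>
  The substituted terms \<open>f v\<close> only use variables of index less than \<open>d\<close>, so renaming each bound
  variable to one of index \<open>d\<close> avoids capture.
\<close>

primrec sub_fm ::
  "('f \<Rightarrow> ('s, 'g) trm list \<Rightarrow> ('s, 'g) trm) \<Rightarrow> ('r \<Rightarrow> 'q) \<Rightarrow> ('s, 'f, 'r) fm \<Rightarrow> nat \<Rightarrow>
   ('s var \<Rightarrow> ('s, 'g) trm) \<Rightarrow> ('s, 'g, 'q) fm" where
  "sub_fm g h (Eq t u) d f = Eq (sub_trm g f t) (sub_trm g f u)"
| "sub_fm g h (Rel c ts) d f = Rel (h c) (map (sub_trm g f) ts)"
| "sub_fm g h (Neg \<phi>) d f = Neg (sub_fm g h \<phi> d f)"
| "sub_fm g h (Conj \<phi> \<psi>) d f = Conj (sub_fm g h \<phi> d f) (sub_fm g h \<psi> d f)"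
| "sub_fm g h (Ex v \<phi>) d f = Ex (fst v, d) (sub_fm g h \<phi> (Suc d) (f(v := Var (fst v, d))))"

text \<open>
  An interpretation of the symbols of \<open>L\<close> by terms of \<open>L'\<close> that is correct in the environments
  belonging to \<open>E\<close>. The terms that interpret function symbols may contain the variables in \<open>V0\<close>, whose
  values are prescribed by \<open>E\<close>.
\<close>

locale translation =
  fixes L :: "('s, 'f, 'r) language" and L' :: "('s, 'g, 'q) language"
    and K :: "('s, 'f, 'r, 'a) struct" and K' :: "('s, 'g, 'q, 'a) struct"
    and g :: "'f \<Rightarrow> ('s, 'g) trm list \<Rightarrow> ('s, 'g) trm" and h :: "'r \<Rightarrow> 'q"
    and E :: "('s var \<Rightarrow> 'a) set" and V0 :: "'s var set" and d0 :: nat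
  assumes univ_eq: "univ K' = univ K"
    and rels: "p \<in> rels L \<Longrightarrow> h p \<in> rels L' \<and> rel_dom L' (h p) = rel_dom L p
                 \<and> rel_int K' (h p) = rel_int K p"
    and eval_g: "e \<in> E \<Longrightarrow> c \<in> funs L \<Longrightarrow> length ts = length (fun_dom L c) \<Longrightarrow>
                   eval_trm K' e (g c ts) = fun_int K c (map (eval_trm K' e) ts)"
    and sort_g: "c \<in> funs L \<Longrightarrow> list_all2 (has_sort L') ts (fun_dom L c) \<Longrightarrow>
                   has_sort L' (g c ts) (fun_cod L c)"
    and fv_g: "c \<in> funs L \<Longrightarrow> fv_trm (g c ts) \<subseteq> V0 \<union> \<Union> (fv_trm ` set ts)"
    and E_upd: "e \<in> E \<Longrightarrow> d0 \<le> d \<Longrightarrow> e((s, d) := x) \<in> E"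
begin

lemma sort_sub_trm:
  "has_sort L t s \<Longrightarrow> (\<And>w. w \<in> fv_trm t \<Longrightarrow> has_sort L' (f w) (fst w)) \<Longrightarrow>
   has_sort L' (sub_trm g f t) s"
proof (induction rule: has_sort.induct)
  case (2 c ts)
  have "list_all2 (has_sort L') (map (sub_trm g f) ts) (fun_dom L c)"
    unfolding list_all2_map1
  proof (rule list.rel_mono_strong, rule 2(2))
    fix t s assume "t \<in> set ts"
      and IH: "has_sort L t s \<and> ((\<forall>w. w \<in> fv_trm t \<longrightarrow> has_sort L' (f w) (fst w)) \<longrightarrow>
                 has_sort L' (sub_trm g f t) s)"
    have "\<forall>w. w \<in> fv_trm t \<longrightarrow> has_sort L' (f w) (fst w)"
      using 2(3) \<open>t \<in> set ts\<close> by fastforce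
    then show "has_sort L' (sub_trm g f t) s" using IH by blast
  qed
  then show ?case using 2(1) sort_g by simp
qed simp

lemma eval_sub_trm:
  "has_sort L t s \<Longrightarrow> e \<in> E \<Longrightarrow>
   eval_trm K' e (sub_trm g f t) = eval_trm K (\<lambda>w. eval_trm K' e (f w)) t"
proof (induction rule: has_sort.induct)
  case (2 c ts)
  have "map (\<lambda>t. eval_trm K' e (sub_trm g f t)) ts
      = map (eval_trm K (\<lambda>w. eval_trm K' e (f w))) ts"
    using 2(2,3) by (auto simp: list_all2_conv_all_nth in_set_conv_nth)
  then show ?case using 2 eval_g[of e c "map (sub_trm g f) ts"]
    by (simp add: list_all2_lengthD comp_def del: map_eq_conv)
qed auto

lemma fv_sub_trm:
  "has_sort L t s \<Longrightarrow> fv_trm (sub_trm g f t) \<subseteq> V0 \<union> (\<Union>w\<in>fv_trm t. fv_trm (f w))"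
proof (induction rule: has_sort.induct)
  case (2 c ts)
  have "fv_trm (sub_trm g f t) \<subseteq> V0 \<union> (\<Union>w\<in>fv_trm t. fv_trm (f w))" if "t \<in> set ts" for t
    using 2(2) that by (auto simp: list_all2_conv_all_nth in_set_conv_nth)
  then show ?case using fv_g[OF 2(1), of "map (sub_trm g f) ts"] by fastforce
qed auto

lemma wf_sub_fm:
  "wf_fm L \<phi> \<Longrightarrow> (\<And>w. w \<in> fv \<phi> \<Longrightarrow> has_sort L' (f w) (fst w)) \<Longrightarrow> wf_fm L' (sub_fm g h \<phi> d f)"
proof (induction \<phi> arbitrary: d f)
  case (Eq t u)
  then obtain s where "has_sort L t s" "has_sort L u s" by auto
  then have "has_sort L' (sub_trm g f t) s" "has_sort L' (sub_trm g f u) s"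
    using Eq.prems(2) by (simp_all add: sort_sub_trm)
  then show ?case by auto
next
  case (Rel c ts)
  have "has_sort L' (sub_trm g f (ts ! i)) (rel_dom L c ! i)" if "i < length ts" for i
  proof (rule sort_sub_trm)
    show "has_sort L (ts ! i) (rel_dom L c ! i)"
      using Rel.prems(1) that by (simp add: list_all2_conv_all_nth)
    show "has_sort L' (f w) (fst w)" if "w \<in> fv_trm (ts ! i)" for w
      using Rel.prems(2)[of w] that \<open>i < length ts\<close> nth_mem by fastforce
  qed
  then have "list_all2 (has_sort L') (map (sub_trm g f) ts) (rel_dom L c)"
    using Rel.prems(1) by (simp add: list_all2_conv_all_nth)
  then show ?case using Rel rels[of c] by simp
next
  case (Ex v \<phi>)
  have "has_sort L' ((f(v := Var (fst v, d))) w) (fst w)" if "w \<in> fv \<phi>" for w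
    using Ex.prems(2)[of w] that has_sort.intros(1)[of L' "(fst v, d)"] by auto
  then show ?case using Ex by simp
qed simp_all

lemma fv_sub_fm:
  "wf_fm L \<phi> \<Longrightarrow> fv (sub_fm g h \<phi> d f) \<subseteq> V0 \<union> (\<Union>w\<in>fv \<phi>. fv_trm (f w))"
proof (induction \<phi> arbitrary: d f)
  case (Eq t u)
  then obtain s where "has_sort L t s" "has_sort L u s" by auto
  from this[THEN fv_sub_trm[of _ _ f]] show ?case by auto
next
  case (Rel c ts)
  have *: "fv_trm (sub_trm g f t) \<subseteq> V0 \<union> (\<Union>w\<in>fv_trm t. fv_trm (f w))" if "t \<in> set ts" for t
  proof -
    obtain i where "i < length ts" "t = ts ! i" using \<open>t \<in> set ts\<close> by (auto simp: in_set_conv_nth)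
    then have "has_sort L t (rel_dom L c ! i)"
      using Rel by (simp add: list_all2_conv_all_nth)
    then show ?thesis by (rule fv_sub_trm)
  qed
  show ?case
  proof
    fix x assume "x \<in> fv (sub_fm g h (Rel c ts) d f)"
    then obtain t where "t \<in> set ts" "x \<in> fv_trm (sub_trm g f t)" by auto
    with * show "x \<in> V0 \<union> (\<Union>w\<in>fv (Rel c ts). fv_trm (f w))" by fastforce
  qed
next
  case (Neg \<phi>)
  then show ?case by simp
next
  case (Conj \<phi> \<psi>)
  have "fv (sub_fm g h \<phi> d f) \<subseteq> V0 \<union> (\<Union>w\<in>fv \<phi>. fv_trm (f w))"
    "fv (sub_fm g h \<psi> d f) \<subseteq> V0 \<union> (\<Union>w\<in>fv \<psi>. fv_trm (f w))"
    using Conj by simp_all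
  then show ?case by auto
next
  case (Ex v \<phi>)
  have *: "fv (sub_fm g h \<phi> (Suc d) (f(v := Var (fst v, d))))
      \<subseteq> V0 \<union> (\<Union>w\<in>fv \<phi>. fv_trm ((f(v := Var (fst v, d))) w))"
    using Ex.prems by (intro Ex.IH) simp
  show ?case
  proof
    fix x assume "x \<in> fv (sub_fm g h (Ex v \<phi>) d f)"
    then have x: "x \<noteq> (fst v, d)" "x \<in> fv (sub_fm g h \<phi> (Suc d) (f(v := Var (fst v, d))))"
      by simp_all
    with * consider "x \<in> V0" | w where "w \<in> fv \<phi>" "x \<in> fv_trm ((f(v := Var (fst v, d))) w)"
      by blast
    then show "x \<in> V0 \<union> (\<Union>w\<in>fv (Ex v \<phi>). fv_trm (f w))"
    proof cases
      case 2
      then show ?thesis using x(1) by (cases "w = v") auto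
    qed simp
  qed
qed

text \<open>The last premise is the freshness invariant. A bound variable receives the index
  \<open>d\<close>, after which terms may use indices up to \<open>d\<close>, so the recursion
  continues with \<open>Suc d\<close>.\<close>

lemma sat_sub_fm:
  "wf_fm L \<phi> \<Longrightarrow> e \<in> E \<Longrightarrow> d0 \<le> d \<Longrightarrow> \<forall>w\<in>fv \<phi>. \<forall>x\<in>fv_trm (f w). snd x < d \<Longrightarrow>
   sat K' (sub_fm g h \<phi> d f) e \<longleftrightarrow> sat K \<phi> (\<lambda>w. eval_trm K' e (f w))"
proof (induction \<phi> arbitrary: d f e)
  case (Eq t u)
  then obtain s where "has_sort L t s" "has_sort L u s" by auto
  then show ?case using Eq.prems(2) by (simp add: eval_sub_trm)
next
  case (Rel c ts)
  have "map (\<lambda>t. eval_trm K' e (sub_trm g f t)) ts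
      = map (eval_trm K (\<lambda>w. eval_trm K' e (f w))) ts"
  proof (rule map_cong)
    fix t assume "t \<in> set ts"
    then obtain i where "i < length ts" "t = ts ! i" by (auto simp: in_set_conv_nth)
    then have "has_sort L t (rel_dom L c ! i)"
      using Rel by (simp add: list_all2_conv_all_nth)
    then show "eval_trm K' e (sub_trm g f t) = eval_trm K (\<lambda>w. eval_trm K' e (f w)) t"
      using Rel.prems(2) by (rule eval_sub_trm)
  qed simp
  then show ?case using Rel rels[of c] by (simp add: comp_def del: map_eq_conv)
next
  case (Neg \<phi>)
  have "sat K' (sub_fm g h \<phi> d f) e \<longleftrightarrow> sat K \<phi> (\<lambda>w. eval_trm K' e (f w))"
    by (rule Neg.IH) (use Neg.prems in \<open>simp_all only: wf_fm.simps fv.simps\<close>)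
  then show ?case by simp
next
  case (Conj \<phi> \<psi>)
  have "sat K' (sub_fm g h \<phi> d f) e \<longleftrightarrow> sat K \<phi> (\<lambda>w. eval_trm K' e (f w))"
    by (rule Conj.IH(1)) (use Conj.prems in \<open>simp_all add: ball_Un\<close>)
  moreover have "sat K' (sub_fm g h \<psi> d f) e \<longleftrightarrow> sat K \<psi> (\<lambda>w. eval_trm K' e (f w))"
    by (rule Conj.IH(2)) (use Conj.prems in \<open>simp_all add: ball_Un\<close>)
  ultimately show ?case by simp
next
  case (Ex v \<phi>)
  let ?f = "f(v := Var (fst v, d))"
  have "sat K' (sub_fm g h \<phi> (Suc d) ?f) (e((fst v, d) := x))
      \<longleftrightarrow> sat K \<phi> ((\<lambda>w. eval_trm K' e (f w))(v := x))" for x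
  proof -
    have "sat K' (sub_fm g h \<phi> (Suc d) ?f) (e((fst v, d) := x))
        \<longleftrightarrow> sat K \<phi> (\<lambda>w. eval_trm K' (e((fst v, d) := x)) (?f w))"
    proof (rule Ex.IH)
      show "\<forall>w\<in>fv \<phi>. \<forall>y\<in>fv_trm (?f w). snd y < Suc d"
        using Ex.prems(4) by (simp add: less_SucI)
      \<comment> \<open>Values prescribed by \<open>E\<close> sit at indices below
        \<open>d0\<close>, so evaluating the renamed bound variable cannot disturb them.\<close>
      show "e((fst v, d) := x) \<in> E" using Ex.prems(2,3) by (rule E_upd)
    qed (use Ex.prems(1,3) in simp_all)
    also have "\<dots> \<longleftrightarrow> sat K \<phi> ((\<lambda>w. eval_trm K' e (f w))(v := x))"
    proof (rule sat_cong)
      fix w assume w: "w \<in> fv \<phi>"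
      show "eval_trm K' (e((fst v, d) := x)) (?f w) = ((\<lambda>w. eval_trm K' e (f w))(v := x)) w"
      proof (cases "w = v")
        case False
        have "eval_trm K' (e((fst v, d) := x)) (f w) = eval_trm K' e (f w)"
          by (rule eval_trm_cong) (use Ex.prems(4) w False in fastforce)
        then show ?thesis using False by simp
      qed simp
    qed
    finally show ?thesis .
  qed
  then show ?case by (simp add: univ_eq)
qed

text \<open>The common source of all later renamings of variables and exchanges of parameters for
  variables. The new formula does not depend on the tuple \<open>a\<close>. All its free variables
  have index below \<open>length \<rho>\<close>, so this length is a safe index for the first bound
  variable.\<close>

lemma translate:
  assumes \<phi>: "\<phi> \<in> formulas L \<tau>" and ts: "list_all2 (has_sort L') ts \<tau>"
    and V: "V0 \<union> \<Union> (fv_trm ` set ts) \<subseteq> {(\<rho> ! j, j) | j. j < length \<rho>}" and d0: "d0 \<le> length \<rho>"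
  shows "\<exists>\<phi>'\<in>formulas L' \<rho>. \<forall>a. (\<lambda>(s, j). a ! j) \<in> E \<longrightarrow>
           (holds_at K' \<phi>' a \<longleftrightarrow> holds_at K \<phi> (map (eval_trm K' (\<lambda>(s, j). a ! j)) ts))"
proof -
  define f where "f = (\<lambda>w :: 's var. ts ! snd w)"
  have len: "length ts = length \<tau>" using ts by (rule list_all2_lengthD)
  have fv: "w = (\<tau> ! snd w, snd w) \<and> snd w < length \<tau>" if "w \<in> fv \<phi>" for w
    using \<phi> that by (auto simp: formulas_def)
  have wf: "wf_fm L \<phi>" using \<phi> by (simp add: formulas_def)
  have mem: "f w \<in> set ts" if "w \<in> fv \<phi>" for w
    using fv[OF that] len by (simp add: f_def)
  have sort: "has_sort L' (f w) (fst w)" if "w \<in> fv \<phi>" for w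
    using fv[OF that] ts unfolding f_def list_all2_conv_all_nth by (metis fst_conv)
  have fvs: "(\<Union>w\<in>fv \<phi>. fv_trm (f w)) \<subseteq> \<Union> (fv_trm ` set ts)"
    using mem by (intro UN_least UN_upper)
  have "fv (sub_fm g h \<phi> (length \<rho>) f) \<subseteq> {(\<rho> ! j, j) | j. j < length \<rho>}"
    using fv_sub_fm[OF wf, of "length \<rho>" f] fvs V by blast
  then have "sub_fm g h \<phi> (length \<rho>) f \<in> formulas L' \<rho>"
    using wf_sub_fm[OF wf sort] by (simp add: formulas_def)
  moreover have "holds_at K' (sub_fm g h \<phi> (length \<rho>) f) a
      \<longleftrightarrow> holds_at K \<phi> (map (eval_trm K' (\<lambda>(s, j). a ! j)) ts)" if "(\<lambda>(s, j). a ! j) \<in> E" for a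
  proof -
    let ?e = "\<lambda>(s :: 's, j). a ! j"
    have "holds_at K' (sub_fm g h \<phi> (length \<rho>) f) a \<longleftrightarrow> sat K \<phi> (\<lambda>w. eval_trm K' ?e (f w))"
      unfolding holds_at_def
    proof (rule sat_sub_fm[OF wf that d0])
      show "\<forall>w\<in>fv \<phi>. \<forall>x\<in>fv_trm (f w). snd x < length \<rho>"
      proof (intro ballI)
        fix w x assume "w \<in> fv \<phi>" "x \<in> fv_trm (f w)"
        then have "x \<in> {(\<rho> ! j, j) | j. j < length \<rho>}" using fvs V by blast
        then show "snd x < length \<rho>" by auto
      qed
    qed
    also have "\<dots> \<longleftrightarrow> holds_at K \<phi> (map (eval_trm K' ?e) ts)"
      unfolding holds_at_def
    proof (rule sat_cong)
      fix w assume "w \<in> fv \<phi>"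
      then show "eval_trm K' ?e (f w) = (case w of (s, j) \<Rightarrow> map (eval_trm K' ?e) ts ! j)"
        using fv[of w] by (cases w) (simp add: f_def len)
    qed
    finally show ?thesis .
  qed
  ultimately show ?thesis by blast
qed

end

lemma translation_refl: "translation L L K K Fn id UNIV {} 0"
  by unfold_locales (simp_all add: has_sort.intros(2))

text \<open>Variables are substituted for variables. Since \<open>\<pi>\<close> may repeat or omit
  positions, this permutes and identifies variables and adds dummy ones.\<close>

lemma reindex_formula:
  assumes \<phi>: "\<phi> \<in> formulas L \<tau>" and len: "length \<pi> = length \<tau>"
    and \<pi>: "\<And>i. i < length \<tau> \<Longrightarrow> \<pi> ! i < length \<rho> \<and> \<rho> ! (\<pi> ! i) = \<tau> ! i"
  shows "\<exists>\<phi>'\<in>formulas L \<rho>. \<forall>a. holds_at K \<phi>' a \<longleftrightarrow> holds_at K \<phi> (map ((!) a) \<pi>)"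
proof -
  let ?ts = "map (\<lambda>j. Var (\<rho> ! j, j)) \<pi> :: ('a, 'b) trm list"
  have "list_all2 (has_sort L) ?ts \<tau>"
  proof (rule list_all2_all_nthI)
    fix i assume "i < length ?ts"
    then have "?ts ! i = Var (\<tau> ! i, \<pi> ! i)" using \<pi> len by simp
    then show "has_sort L (?ts ! i) (\<tau> ! i)"
      using has_sort.intros(1)[of L "(\<tau> ! i, \<pi> ! i)"] by simp
  qed (simp add: len)
  moreover have "{} \<union> \<Union> (fv_trm ` set ?ts) \<subseteq> {(\<rho> ! j, j) | j. j < length \<rho>}"
  proof
    fix x assume "x \<in> {} \<union> \<Union> (fv_trm ` set ?ts)"
    then obtain j where "j \<in> set \<pi>" "x = (\<rho> ! j, j)" by auto
    moreover have "j < length \<rho>" using \<open>j \<in> set \<pi>\<close> \<pi> len by (metis in_set_conv_nth)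
    ultimately show "x \<in> {(\<rho> ! j, j) | j. j < length \<rho>}" by blast
  qed
  ultimately show ?thesis
    using translation.translate[OF translation_refl \<phi>, of ?ts \<rho> K] by (simp add: comp_def)
qed

section \<open>Exchanging parameters and variables\<close>

lemma param_univ [simp]: "univ (param_struct K) = univ K"
  by (simp add: param_struct_def)

lemma pair_univ [simp]: "univ (pair_struct K X) = univ K"
  by (simp add: pair_struct_def)

lemma translation_param:
  "translation L (param_language L B) K (param_struct K) (Fn \<circ> Inl) id UNIV {} 0"
proof
  fix c ts assume "c \<in> funs L" "list_all2 (has_sort (param_language L B)) ts (fun_dom L c)"
  then show "has_sort (param_language L B) ((Fn \<circ> Inl) c ts) (fun_cod L c)"
    using has_sort.intros(2)[of "Inl c" "param_language L B" ts] by (simp add: param_language_def)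
qed (simp_all add: param_language_def param_struct_def)

lemma translation_pair_param:
  "translation L (param_language (pair_language L) B) K (param_struct (pair_struct K X))
     (Fn \<circ> Inl) Inl UNIV {} 0"
proof
  let ?L = "param_language (pair_language L) B"
  fix c ts assume "c \<in> funs L" "list_all2 (has_sort ?L) ts (fun_dom L c)"
  then show "has_sort ?L ((Fn \<circ> Inl) c ts) (fun_cod L c)"
    using has_sort.intros(2)[of "Inl c" ?L ts] by (simp add: param_language_def pair_language_def)
qed (simp_all add: param_language_def pair_language_def param_struct_def pair_struct_def)

text \<open>The constant listed at position \<open>i\<close> of \<open>cs\<close> becomes the
  variable of index \<open>k + i\<close>, and \<open>E\<close> forces that variable to have the
  value of the constant. If \<open>cs\<close> lists a constant twice, either position
  serves.\<close>

lemma translation_unparam: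
  "translation (param_language L (\<lambda>s. {b. (s, b) \<in> set cs})) L (param_struct K) K
     (case_sum Fn (\<lambda>c _. Var (fst c, k + (SOME i. i < length cs \<and> cs ! i = c)))) id
     {e. \<forall>i<length cs. e (fst (cs ! i), k + i) = snd (cs ! i)}
     {(fst (cs ! i), k + i) | i. i < length cs} (k + length cs)"
proof -
  define pos where "pos = (\<lambda>c. SOME i. i < length cs \<and> cs ! i = c)"
  have pos: "pos c < length cs \<and> cs ! pos c = c" if "c \<in> set cs" for c
    unfolding pos_def by (rule someI_ex) (use that in \<open>simp add: in_set_conv_nth\<close>)
  let ?g = "case_sum Fn (\<lambda>c _. Var (fst c, k + pos c))"
  let ?LP = "param_language L (\<lambda>s. {b. (s, b) \<in> set cs})"
  have "translation ?LP L (param_struct K) K ?g id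
     {e. \<forall>i<length cs. e (fst (cs ! i), k + i) = snd (cs ! i)}
     {(fst (cs ! i), k + i) | i. i < length cs} (k + length cs)"
  proof
    fix e c and ts :: "('a, 'b) trm list"
    assume e: "e \<in> {e. \<forall>i<length cs. e (fst (cs ! i), k + i) = snd (cs ! i)}"
      and c: "c \<in> funs ?LP"
    show "eval_trm K e (?g c ts) = fun_int (param_struct K) c (map (eval_trm K e) ts)"
    proof (cases c)
      case (Inr p)
      then have "p \<in> set cs" using c by (cases p) (auto simp: param_language_def)
      then have "e (fst p, k + pos p) = snd p" using e pos[of p] by auto
      then show ?thesis using Inr by (simp add: param_struct_def split: prod.split)
    qed (simp add: param_struct_def)
  next
    fix c ts assume c: "c \<in> funs ?LP" and ts: "list_all2 (has_sort L) ts (fun_dom ?LP c)"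
    show "has_sort L (?g c ts) (fun_cod ?LP c)"
    proof (cases c)
      case (Inl f)
      then show ?thesis using c ts has_sort.intros(2)[of f L ts] by (auto simp: param_language_def)
    next
      case (Inr p)
      then show ?thesis using has_sort.intros(1)[of L "(fst p, k + pos p)"]
        by (simp add: param_language_def)
    qed
  next
    fix c and ts :: "('a, 'b) trm list"
    assume c: "c \<in> funs ?LP"
    show "fv_trm (?g c ts) \<subseteq> {(fst (cs ! i), k + i) | i. i < length cs} \<union> \<Union> (fv_trm ` set ts)"
    proof (cases c)
      case (Inr p)
      then have "p \<in> set cs" using c by (cases p) (auto simp: param_language_def)
      with pos[of p] have "(fst p, k + pos p) \<in> {(fst (cs ! i), k + i) | i. i < length cs}"
        by (metis (mono_tags, lifting) mem_Collect_eq)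
      then show ?thesis using Inr by simp
    qed auto
  qed (auto simp: param_language_def param_struct_def)
  then show ?thesis unfolding pos_def .
qed

text \<open>\<open>set2_trm\<close> collects the function symbols of a term; over a language with
  parameters its \<open>Inr\<close> members are the parameters that occur.\<close>

lemma finite_set2_trm: "finite (set2_trm t)"
  by (induction t) auto

lemma finite_set2_fm: "finite (set2_fm \<phi>)"
  by (induction \<phi>) (auto simp: finite_set2_trm)

lemma has_sort_param_restrict:
  "has_sort (param_language L B) t s \<Longrightarrow> (\<forall>p. Inr p \<in> set2_trm t \<longrightarrow> p \<in> C) \<Longrightarrow>
   has_sort (param_language L (\<lambda>s. {b. (s, b) \<in> C})) t s"
proof (induction rule: has_sort.induct)
  case (1 v)
  show ?case by (rule has_sort.intros)
next
  case (2 c ts)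
  let ?LC = "param_language L (\<lambda>s. {b. (s, b) \<in> C})"
  have *: "fun_dom (param_language L B) = fun_dom ?LC" "fun_cod (param_language L B) = fun_cod ?LC"
    by (simp_all add: param_language_def)
  have "list_all2 (has_sort ?LC) ts (fun_dom ?LC c)"
    using 2(2) unfolding *
  proof (rule list.rel_mono_strong)
    fix t s assume "t \<in> set ts"
      and IH: "has_sort (param_language L B) t s \<and>
            ((\<forall>p. Inr p \<in> set2_trm t \<longrightarrow> p \<in> C) \<longrightarrow> has_sort ?LC t s)"
    then have "\<forall>p. Inr p \<in> set2_trm t \<longrightarrow> p \<in> C" using 2(3) by auto
    then show "has_sort ?LC t s" using IH by blast
  qed
  moreover have "c \<in> funs ?LC"
  proof (cases c)
    case (Inr p)
    then have "p \<in> C" using 2(3)[rule_format, of p] by simp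
    then show ?thesis using Inr by (cases p) (simp add: param_language_def image_iff)
  qed (use 2(1) in \<open>auto simp: param_language_def\<close>)
  ultimately show ?case unfolding * by (rule has_sort.intros(2)[rotated])
qed

lemma consts_param_trm:
  "has_sort (param_language L B) t s \<Longrightarrow> Inr p \<in> set2_trm t \<Longrightarrow> p \<in> Sigma UNIV B"
proof (induction rule: has_sort.induct)
  case (2 c ts)
  show ?case
  proof (cases "c = Inr p")
    case True
    then show ?thesis using 2(1) by (auto simp: param_language_def)
  next
    case False
    then obtain t where "t \<in> set ts" "Inr p \<in> set2_trm t" using 2(3) by auto
    then show ?thesis using 2(2) by (auto simp: list_all2_conv_all_nth in_set_conv_nth)
  qed
qed simp

lemma wf_fm_param_restrict:
  "wf_fm (param_language L B) \<phi> \<Longrightarrow> (\<forall>p. Inr p \<in> set2_fm \<phi> \<longrightarrow> p \<in> C) \<Longrightarrow>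
   wf_fm (param_language L (\<lambda>s. {b. (s, b) \<in> C})) \<phi>"
proof (induction \<phi>)
  case (Eq t u)
  then obtain s where "has_sort (param_language L B) t s" "has_sort (param_language L B) u s"
    by auto
  then have "has_sort (param_language L (\<lambda>s. {b. (s, b) \<in> C})) t s"
    "has_sort (param_language L (\<lambda>s. {b. (s, b) \<in> C})) u s"
    using Eq.prems(2) by (auto intro!: has_sort_param_restrict)
  then show ?case by auto
next
  case (Rel c ts)
  let ?LC = "param_language L (\<lambda>s. {b. (s, b) \<in> C})"
  have "list_all2 (has_sort (param_language L B)) ts (rel_dom L c)"
    using Rel.prems(1) by (simp add: param_language_def)
  then have "list_all2 (has_sort ?LC) ts (rel_dom L c)"
  proof (rule list.rel_mono_strong)
    fix t s assume "t \<in> set ts" "has_sort (param_language L B) t s"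
    moreover have "\<forall>p. Inr p \<in> set2_trm t \<longrightarrow> p \<in> C" using Rel.prems(2) \<open>t \<in> set ts\<close> by auto
    ultimately show "has_sort ?LC t s" by (simp add: has_sort_param_restrict)
  qed
  then show ?case using Rel.prems(1) by (simp add: param_language_def)
qed auto

lemma consts_param_fm:
  "wf_fm (param_language L B) \<phi> \<Longrightarrow> Inr p \<in> set2_fm \<phi> \<Longrightarrow> p \<in> Sigma UNIV B"
proof (induction \<phi>)
  case (Eq t u)
  then obtain s where "has_sort (param_language L B) t s" "has_sort (param_language L B) u s"
    by auto
  moreover from Eq.prems(2) have "Inr p \<in> set2_trm t \<or> Inr p \<in> set2_trm u" by simp
  ultimately show ?case using consts_param_trm[of L B _ s p] by blast
next
  case (Rel c ts)
  then obtain t where t: "t \<in> set ts" "Inr p \<in> set2_trm t" by auto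
  then obtain s where "has_sort (param_language L B) t s"
    using Rel.prems(1) by (auto simp: list_all2_conv_all_nth in_set_conv_nth)
  then show ?case using t(2) by (rule consts_param_trm)
qed auto

text \<open>Only finitely many parameters occur in \<phi>, so after cutting the language down to
  these, \<open>translation_unparam\<close> applies. This reduces the comparison of types over
  \<open>N\<close> to formulas \<open>\<psi>(x;c)\<close> of the language itself.\<close>

lemma unparam_formula:
  assumes \<phi>: "\<phi> \<in> formulas (param_language L B) \<tau>"
  shows "\<exists>cs \<psi>. set cs \<subseteq> Sigma UNIV B \<and> \<psi> \<in> formulas L (\<tau> @ map fst cs) \<and>
           (\<forall>a. length a = length \<tau> \<longrightarrow>
              (holds_at (param_struct K) \<phi> a \<longleftrightarrow> holds_at K \<psi> (a @ map snd cs)))"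
proof -
  define C where "C = {p. Inr p \<in> set2_fm \<phi>}"
  have wf: "wf_fm (param_language L B) \<phi>" and fv: "fv \<phi> \<subseteq> {(\<tau> ! j, j) | j. j < length \<tau>}"
    using \<phi> by (simp_all add: formulas_def)
  have "finite C" unfolding C_def
    using finite_set2_fm[of \<phi>] by (rule finite_vimageI[of _ Inr, unfolded vimage_def]) simp
  then obtain cs where cs: "set cs = C" using finite_list by blast
  let ?LC = "param_language L (\<lambda>s. {b. (s, b) \<in> set cs})"
  have "\<phi> \<in> formulas ?LC \<tau>"
    using wf_fm_param_restrict[OF wf, of "set cs"] fv by (simp add: formulas_def cs C_def)
  let ?k = "length \<tau>" and ?ts = "map (\<lambda>j. Var (\<tau> ! j, j)) [0..<length \<tau>] :: ('a, 'b) trm list"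
  let ?\<rho> = "\<tau> @ map fst cs"
  have "list_all2 (has_sort L) ?ts \<tau>"
  proof (rule list_all2_all_nthI)
    fix i assume "i < length ?ts"
    then show "has_sort L (?ts ! i) (\<tau> ! i)"
      using has_sort.intros(1)[of L "(\<tau> ! i, i)"] by simp
  qed simp
  moreover have "{(fst (cs ! i), ?k + i) | i. i < length cs} \<union> \<Union> (fv_trm ` set ?ts)
      \<subseteq> {(?\<rho> ! j, j) | j. j < length ?\<rho>}"
  proof
    fix x assume "x \<in> {(fst (cs ! i), ?k + i) | i. i < length cs} \<union> \<Union> (fv_trm ` set ?ts)"
    then consider i where "x = (fst (cs ! i), ?k + i)" "i < length cs"
      | j where "x = (\<tau> ! j, j)" "j < length \<tau>" by auto
    then show "x \<in> {(?\<rho> ! j, j) | j. j < length ?\<rho>}"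
    proof cases
      case 1
      then have "x = (?\<rho> ! (?k + i), ?k + i)" "?k + i < length ?\<rho>" by (simp_all add: nth_append)
      then show ?thesis by blast
    next
      case 2
      then have "x = (?\<rho> ! j, j)" "j < length ?\<rho>" by (simp_all add: nth_append)
      then show ?thesis by blast
    qed
  qed
  moreover have "?k + length cs \<le> length ?\<rho>" by simp
  ultimately obtain \<psi> where \<psi>: "\<psi> \<in> formulas L ?\<rho>"
    "\<And>a. (\<lambda>(s, j). a ! j) \<in> {e. \<forall>i<length cs. e (fst (cs ! i), ?k + i) = snd (cs ! i)} \<Longrightarrow>
       holds_at K \<psi> a \<longleftrightarrow> holds_at (param_struct K) \<phi> (map (eval_trm K (\<lambda>(s, j). a ! j)) ?ts)"
    using translation.translate[OF translation_unparam \<open>\<phi> \<in> formulas ?LC \<tau>\<close>, of ?ts ?k ?\<rho>] by blast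
  have "holds_at (param_struct K) \<phi> a \<longleftrightarrow> holds_at K \<psi> (a @ map snd cs)" if "length a = length \<tau>" for a
  proof -
    have "map (eval_trm K (\<lambda>(s, j). (a @ map snd cs) ! j)) ?ts = a"
      using that by (intro nth_equalityI) (simp_all add: nth_append)
    then show ?thesis
      using \<psi>(2)[of "a @ map snd cs"] that by (simp add: nth_append)
  qed
  moreover have "set cs \<subseteq> Sigma UNIV B"
    using consts_param_fm[OF wf] by (auto simp: cs C_def)
  ultimately show ?thesis using \<psi>(1) by blast
qed

text \<open>The opposite direction: closed terms \<open>us\<close> are plugged into the trailing
  variables, so only the variables of sorts \<rho> remain free.\<close>

lemma (in translation) translate_with_params:
  assumes \<phi>: "\<phi> \<in> formulas L (\<rho> @ \<tau>)" and E: "E = UNIV" and V: "V0 = {}" "d0 = 0"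
    and us: "list_all2 (has_sort L') us \<tau>" "\<And>u. u \<in> set us \<Longrightarrow> fv_trm u = {}"
    and c: "\<And>e. map (eval_trm K' e) us = c"
  shows "\<exists>\<phi>'\<in>formulas L' \<rho>. \<forall>a. length a = length \<rho> \<longrightarrow>
           (holds_at K' \<phi>' a \<longleftrightarrow> holds_at K \<phi> (a @ c))"
proof -
  let ?ts = "map (\<lambda>j. Var (\<rho> ! j, j)) [0..<length \<rho>] :: ('s, 'g) trm list"
  have "list_all2 (has_sort L') ?ts \<rho>"
  proof (rule list_all2_all_nthI)
    fix i assume "i < length ?ts"
    then show "has_sort L' (?ts ! i) (\<rho> ! i)"
      using has_sort.intros(1)[of L' "(\<rho> ! i, i)"] by simp
  qed simp
  then have "list_all2 (has_sort L') (?ts @ us) (\<rho> @ \<tau>)"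
    using us(1) by (rule list_all2_appendI)
  moreover have "V0 \<union> \<Union> (fv_trm ` set (?ts @ us)) \<subseteq> {(\<rho> ! j, j) | j. j < length \<rho>}"
    using us(2) V by auto
  moreover have ts: "map (eval_trm K' (\<lambda>(s, j). a ! j)) ?ts = a" if "length a = length \<rho>" for a
    using that by (intro nth_equalityI) simp_all
  ultimately obtain \<phi>' where \<phi>': "\<phi>' \<in> formulas L' \<rho>"
    "\<And>a. holds_at K' \<phi>' a \<longleftrightarrow> holds_at K \<phi> (map (eval_trm K' (\<lambda>(s, j). a ! j)) (?ts @ us))"
    using translate[OF \<phi>, of "?ts @ us" \<rho>] V(2) unfolding E by auto
  have eq: "map (eval_trm K' (\<lambda>(s, j). a ! j)) (?ts @ us) = a @ c" if "length a = length \<rho>" for a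
    unfolding map_append c using ts[OF that] by simp
  show ?thesis
  proof (intro bexI allI impI)
    show "holds_at K' \<phi>' a \<longleftrightarrow> holds_at K \<phi> (a @ c)" if "length a = length \<rho>" for a
      unfolding \<phi>'(2) eq[OF that] ..
  qed (rule \<phi>'(1))
qed

lemma param_consts:
  assumes c: "c \<in> tuples B \<tau>"
  defines "us \<equiv> map2 (\<lambda>s b. Fn (Inr (s, b)) []) \<tau> c"
  shows "list_all2 (has_sort (param_language L B)) us \<tau>"
    and "u \<in> set us \<Longrightarrow> fv_trm u = {}"
    and "map (eval_trm (param_struct K) e) us = c"
proof -
  have len: "length c = length \<tau>" using c by (auto simp: tuples_def list_all2_conv_all_nth)
  show "list_all2 (has_sort (param_language L B)) us \<tau>"
  proof (rule list_all2_all_nthI)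
    fix i assume i: "i < length us"
    then have "c ! i \<in> B (\<tau> ! i)" "us ! i = Fn (Inr (\<tau> ! i, c ! i)) []"
      using c len by (auto simp: tuples_def list_all2_conv_all_nth us_def)
    then show "has_sort (param_language L B) (us ! i) (\<tau> ! i)"
      using has_sort.intros(2)[of "Inr (\<tau> ! i, c ! i)" "param_language L B" "[]"]
      by (simp add: param_language_def)
  qed (simp add: us_def len)
  show "fv_trm u = {}" if "u \<in> set us" using that by (auto simp: us_def)
  show "map (eval_trm (param_struct K) e) us = c"
    using len by (intro nth_equalityI) (simp_all add: us_def param_struct_def)
qed

lemma param_formula:
  assumes "\<phi> \<in> formulas L (\<rho> @ \<tau>)" "c \<in> tuples B \<tau>"
  shows "\<exists>\<phi>'\<in>formulas (param_language L B) \<rho>. \<forall>a. length a = length \<rho> \<longrightarrow>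
           (holds_at (param_struct K) \<phi>' a \<longleftrightarrow> holds_at K \<phi> (a @ c))"
  using translation.translate_with_params[OF translation_param assms(1) refl refl refl
      param_consts[OF assms(2)]] .

text \<open>The saturation that is applied is that of the pair, so formulas of \<open>L\<close> with
  parameters have to be rewritten over the pair language.\<close>

lemma pair_param_formula:
  assumes "\<phi> \<in> formulas L (\<rho> @ \<tau>)" "c \<in> tuples B \<tau>"
  shows "\<exists>\<phi>'\<in>formulas (param_language (pair_language L) B) \<rho>. \<forall>a. length a = length \<rho> \<longrightarrow>
           (holds_at (param_struct (pair_struct K X)) \<phi>' a \<longleftrightarrow> holds_at K \<phi> (a @ c))"
  using translation.translate_with_params[OF translation_pair_param assms(1) refl refl refl
      param_consts[OF assms(2)]] .

section \<open>Predicates on sequences of tuples\<close>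

lemma tuples_iff: "a \<in> tuples X \<sigma> \<longleftrightarrow> length a = length \<sigma> \<and> (\<forall>i<length \<sigma>. a ! i \<in> X (\<sigma> ! i))"
  by (auto simp: tuples_def list_all2_conv_all_nth)

lemma tuples_append: "a \<in> tuples X \<sigma> \<Longrightarrow> b \<in> tuples X \<tau> \<Longrightarrow> a @ b \<in> tuples X (\<sigma> @ \<tau>)"
  by (auto simp: tuples_def intro: list_all2_appendI)

lemma tuples_append_cases:
  assumes "c \<in> tuples X (\<sigma> @ \<tau>)"
  obtains a b where "c = a @ b" "a \<in> tuples X \<sigma>" "b \<in> tuples X \<tau>"
  using assms by (auto simp: tuples_def list_all2_append2)

lemma concat_in_tuples:
  "set as \<subseteq> tuples X \<sigma> \<Longrightarrow> concat as \<in> tuples X (concat (replicate (length as) \<sigma>))"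
  by (induction as) (simp_all add: tuples_append, simp add: tuples_def)

lemma tuples_concat_cases:
  "a \<in> tuples X (concat (replicate n \<sigma>)) \<Longrightarrow>
   \<exists>as. length as = n \<and> set as \<subseteq> tuples X \<sigma> \<and> a = concat as"
proof (induction n arbitrary: a)
  case 0
  then show ?case by (auto simp: tuples_def)
next
  case (Suc n)
  then obtain b c where a: "a = b @ c" "b \<in> tuples X \<sigma>" "c \<in> tuples X (concat (replicate n \<sigma>))"
    by (auto elim: tuples_append_cases)
  obtain as where "length as = n" "set as \<subseteq> tuples X \<sigma>" "c = concat as"
    using Suc.IH[OF a(3)] by blast
  then show ?case using a by (intro exI[of _ "b # as"]) simp
qed

section \<open>Blocks of equal length in concatenated lists\<close>

lemma length_concat_uniform: "(\<forall>w\<in>set ws. length w = l) \<Longrightarrow> length (concat ws) = length ws * l"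
  by (induction ws) auto

lemma concat_take_drop:
  "(\<forall>w\<in>set ws. length w = l) \<Longrightarrow>
   concat (take i ws) = take (i * l) (concat ws) \<and> concat (drop i ws) = drop (i * l) (concat ws)"
proof (induction ws arbitrary: i)
  case (Cons w ws)
  then show ?case by (cases i) auto
qed simp

lemma concat_block:
  assumes ws: "\<forall>w\<in>set ws. length w = l"
  shows "concat (take n (drop i ws)) = take (n * l) (drop (i * l) (concat ws))"
proof -
  have "\<forall>w\<in>set (drop i ws). length w = l" using ws in_set_dropD by fast
  then show ?thesis using concat_take_drop[of "drop i ws" l n] concat_take_drop[OF ws, of i] by simp
qed

lemma map_nth_interval: "i + n \<le> length a \<Longrightarrow> map ((!) a) [i..<i + n] = take n (drop i a)"
  by (rule nth_equalityI) simp_all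

lemma nth_block:
  assumes ws: "\<forall>w\<in>set ws. length w = l" and j: "j < length ws"
  shows "map ((!) (concat ws)) [j * l..<j * l + l] = ws ! j"
proof -
  have "j * l + l \<le> length ws * l"
    using mult_le_mono1[of "Suc j" "length ws" l] j by simp
  then have "map ((!) (concat ws)) [j * l..<j * l + l] = take l (drop (j * l) (concat ws))"
    using length_concat_uniform[OF ws] by (intro map_nth_interval) simp
  also have "\<dots> = concat (take 1 (drop j ws))"
    using concat_block[OF ws, of 1 j] by simp
  also have "\<dots> = ws ! j"
    using j by (simp add: take_Suc_conv_app_nth)
  finally show ?thesis .
qed

lemma nth_blocks:
  assumes ws: "\<forall>w\<in>set ws. length w = l" and \<pi>: "\<forall>j\<in>set \<pi>. j < length ws"
  shows "map ((!) (concat ws)) (concat (map (\<lambda>j. [j * l..<j * l + l]) \<pi>)) = concat (map ((!) ws) \<pi>)"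
  using \<pi> by (induction \<pi>) (use nth_block[OF ws] in auto)

lemma formulas_Conj_upto:
  "(\<forall>k<m :: nat. \<chi> k \<in> formulas L \<rho>) \<Longrightarrow>
   \<exists>\<chi>'\<in>formulas L \<rho>. \<forall>a. holds_at K \<chi>' a \<longleftrightarrow> (\<forall>k<m. holds_at K (\<chi> k) a \<longleftrightarrow> k \<in> S)"
proof (induction m)
  case 0
  \<comment> \<open>The empty conjunction must be a sentence, as \<rho> may be empty; hence the
    quantifier around the trivial equation.\<close>
  let ?v = "(undefined, 0) :: 'a var"
  let ?true = "Neg (Ex ?v (Neg (Eq (Var ?v) (Var ?v)))) :: ('a, 'b, 'c) fm"
  have "?true \<in> formulas L \<rho>"
    using has_sort.intros(1)[of L ?v] by (auto simp: formulas_def)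
  then show ?case by (intro bexI[of _ ?true]) (auto simp: holds_at_def)
next
  case (Suc m)
  then obtain \<chi>' where \<chi>': "\<chi>' \<in> formulas L \<rho>"
    "\<And>a. holds_at K \<chi>' a \<longleftrightarrow> (\<forall>k<m. holds_at K (\<chi> k) a \<longleftrightarrow> k \<in> S)" by auto
  let ?c = "Conj \<chi>' (if m \<in> S then \<chi> m else Neg (\<chi> m))"
  have "?c \<in> formulas L \<rho>" using Suc.prems \<chi>'(1) by (auto simp: formulas_def)
  moreover have "holds_at K ?c a \<longleftrightarrow> (\<forall>k<Suc m. holds_at K (\<chi> k) a \<longleftrightarrow> k \<in> S)" for a
    using \<chi>'(2)[of a] by (auto simp: holds_at_def less_Suc_eq)
  ultimately show ?case by blast
qed

lemma formulas_Ex_tuple: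
  "\<phi> \<in> formulas L (\<rho> @ \<tau>) \<Longrightarrow>
   \<exists>\<phi>'\<in>formulas L \<rho>. \<forall>a. length a = length \<rho> \<longrightarrow>
     (holds_at K \<phi>' a \<longleftrightarrow> (\<exists>c\<in>tuples (univ K) \<tau>. holds_at K \<phi> (a @ c)))"
proof (induction \<tau> arbitrary: \<phi> rule: rev_induct)
  case Nil
  then show ?case by (auto simp: tuples_def)
next
  case (snoc s \<tau>)
  \<comment> \<open>Quantifying the last variable first leaves the remaining ones numbered by their
    positions, so nothing has to be renamed.\<close>
  let ?\<phi> = "Ex (s, length (\<rho> @ \<tau>)) \<phi>"
  have fv: "fv \<phi> \<subseteq> {((\<rho> @ \<tau> @ [s]) ! j, j) | j. j < length (\<rho> @ \<tau> @ [s])}"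
    using snoc.prems by (simp add: formulas_def)
  have fvE: "v = (s, length (\<rho> @ \<tau>)) \<or> (\<exists>j<length (\<rho> @ \<tau>). v = ((\<rho> @ \<tau>) ! j, j))"
    if "v \<in> fv \<phi>" for v
  proof -
    obtain j where j: "v = ((\<rho> @ \<tau> @ [s]) ! j, j)" "j < length (\<rho> @ \<tau> @ [s])"
      using fv \<open>v \<in> fv \<phi>\<close> by blast
    have "((\<rho> @ \<tau>) @ [s]) ! j = (if j < length (\<rho> @ \<tau>) then (\<rho> @ \<tau>) ! j else s)"
      using j(2) by (auto simp: nth_append less_Suc_eq)
    then show ?thesis using j by (auto simp: less_Suc_eq)
  qed
  have "?\<phi> \<in> formulas L (\<rho> @ \<tau>)"
    using snoc.prems fvE by (fastforce simp: formulas_def)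
  from snoc.IH[OF this] obtain \<phi>' where \<phi>': "\<phi>' \<in> formulas L \<rho>"
    "\<And>a. length a = length \<rho> \<Longrightarrow>
       holds_at K \<phi>' a \<longleftrightarrow> (\<exists>c\<in>tuples (univ K) \<tau>. holds_at K ?\<phi> (a @ c))" by blast
  have *: "holds_at K ?\<phi> b \<longleftrightarrow> (\<exists>x\<in>univ K s. holds_at K \<phi> (b @ [x]))"
    if b: "length b = length (\<rho> @ \<tau>)" for b
  proof -
    have "sat K \<phi> ((\<lambda>(s, j). b ! j)((s, length (\<rho> @ \<tau>)) := x)) \<longleftrightarrow> sat K \<phi> (\<lambda>(s, j). (b @ [x]) ! j)" for x
    proof (rule sat_cong)
      fix v assume "v \<in> fv \<phi>"
      from fvE[OF this] show "((\<lambda>(s, j). b ! j)((s, length (\<rho> @ \<tau>)) := x)) v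
          = (case v of (s, j) \<Rightarrow> (b @ [x]) ! j)"
        using b by (auto simp: nth_append)
    qed
    then show ?thesis by (simp add: holds_at_def)
  qed
  have "(\<exists>c\<in>tuples (univ K) \<tau>. holds_at K ?\<phi> (a @ c)) \<longleftrightarrow>
      (\<exists>c\<in>tuples (univ K) (\<tau> @ [s]). holds_at K \<phi> (a @ c))" if a: "length a = length \<rho>" for a
  proof -
    have "(\<exists>c\<in>tuples (univ K) (\<tau> @ [s]). holds_at K \<phi> (a @ c)) \<longleftrightarrow>
        (\<exists>c\<in>tuples (univ K) \<tau>. \<exists>x\<in>univ K s. holds_at K \<phi> ((a @ c) @ [x]))"
    proof
      assume "\<exists>c\<in>tuples (univ K) (\<tau> @ [s]). holds_at K \<phi> (a @ c)"
      then obtain c d where "c \<in> tuples (univ K) \<tau>" "d \<in> tuples (univ K) [s]" "holds_at K \<phi> (a @ c @ d)"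
        by (auto elim: tuples_append_cases)
      then show "\<exists>c\<in>tuples (univ K) \<tau>. \<exists>x\<in>univ K s. holds_at K \<phi> ((a @ c) @ [x])"
        by (auto simp: tuples_def list_all2_Cons2)
    next
      assume "\<exists>c\<in>tuples (univ K) \<tau>. \<exists>x\<in>univ K s. holds_at K \<phi> ((a @ c) @ [x])"
      then obtain c x where "c \<in> tuples (univ K) \<tau>" "x \<in> univ K s" "holds_at K \<phi> (a @ c @ [x])"
        by auto
      moreover have "c @ [x] \<in> tuples (univ K) (\<tau> @ [s])"
        using calculation by (intro tuples_append) (simp_all add: tuples_def)
      ultimately show "\<exists>c\<in>tuples (univ K) (\<tau> @ [s]). holds_at K \<phi> (a @ c)" by blast
    qed
    moreover have "holds_at K ?\<phi> (a @ c) \<longleftrightarrow> (\<exists>x\<in>univ K s. holds_at K \<phi> ((a @ c) @ [x]))"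
      if "c \<in> tuples (univ K) \<tau>" for c
      using * a that by (simp add: tuples_iff)
    ultimately show ?thesis by blast
  qed
  then show ?case using \<phi>' by blast
qed

text \<open>The combinatorics below treats each term of the sequence as a point, so formulas are
  seen as predicates on lists of whole \<sigma>-tuples. Lists of another shape are left
  unconstrained.\<close>

definition definable_pred ::
  "('s, 'f, 'r) language \<Rightarrow> ('s, 'f, 'r, 'a) struct \<Rightarrow> 's list \<Rightarrow> nat \<Rightarrow> ('a list list \<Rightarrow> bool) \<Rightarrow> bool" where
  "definable_pred L K \<sigma> m p \<longleftrightarrow>
     (\<exists>\<phi>\<in>formulas L (concat (replicate m \<sigma>)). \<forall>ws. length ws = m \<longrightarrow>
        (\<forall>w\<in>set ws. length w = length \<sigma>) \<longrightarrow> (p ws \<longleftrightarrow> holds_at K \<phi> (concat ws)))"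

lemma definable_pred_reindex:
  assumes "definable_pred L K \<sigma> m p" and len: "length \<pi> = m" and \<pi>: "\<forall>j\<in>set \<pi>. j < k"
  shows "definable_pred L K \<sigma> k (\<lambda>ws. p (map ((!) ws) \<pi>))"
proof -
  obtain \<phi> where \<phi>: "\<phi> \<in> formulas L (concat (replicate m \<sigma>))"
    "\<And>ws. length ws = m \<Longrightarrow> \<forall>w\<in>set ws. length w = length \<sigma> \<Longrightarrow> p ws \<longleftrightarrow> holds_at K \<phi> (concat ws)"
    using assms(1) unfolding definable_pred_def by blast
  let ?l = "length \<sigma>"
  \<comment> \<open>The index of a tuple is replaced by the block of indices of its
    coordinates.\<close>
  define \<pi>' where "\<pi>' = concat (map (\<lambda>j. [j * ?l..<j * ?l + ?l]) \<pi>)"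
  have blocks: "map ((!) (concat ws)) \<pi>' = concat (map ((!) ws) \<pi>)"
    if "length ws = k" "\<forall>w\<in>set ws. length w = length v" "length v = ?l"
    for ws and v :: "'x list"
    unfolding \<pi>'_def using nth_blocks[of ws ?l \<pi>] that \<pi> by simp
  \<comment> \<open>The reindexing is applied to the list of sorts itself, which shows that the
    renamed variables have the sorts that the formula expects.\<close>
  have "map ((!) (replicate k \<sigma>)) \<pi> = replicate m \<sigma>"
    using \<pi> len by (intro nth_equalityI) auto
  then have \<rho>: "map ((!) (concat (replicate k \<sigma>))) \<pi>' = concat (replicate m \<sigma>)"
    using blocks[of "replicate k \<sigma>" \<sigma>] by simp
  have len': "length \<pi>' = length (concat (replicate m \<sigma>))"
    using arg_cong[OF \<rho>, of length] by simp
  have bound: "\<pi>' ! i < k * ?l" if "i < length \<pi>'" for i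
  proof -
    have "\<pi>' ! i \<in> set \<pi>'" using that by simp
    then obtain j where "j \<in> set \<pi>" "\<pi>' ! i < j * ?l + ?l" unfolding \<pi>'_def by auto
    moreover have "Suc j * ?l \<le> k * ?l"
      using \<open>j \<in> set \<pi>\<close> \<pi> by (intro mult_le_mono1 Suc_leI) simp
    ultimately show ?thesis by simp
  qed
  have "\<pi>' ! i < length (concat (replicate k \<sigma>)) \<and>
      concat (replicate k \<sigma>) ! (\<pi>' ! i) = concat (replicate m \<sigma>) ! i"
    if "i < length (concat (replicate m \<sigma>))" for i
  proof
    show "\<pi>' ! i < length (concat (replicate k \<sigma>))"
      using bound[of i] that len' length_concat_uniform[of "replicate k \<sigma>" ?l] by simp
    show "concat (replicate k \<sigma>) ! (\<pi>' ! i) = concat (replicate m \<sigma>) ! i"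
      using arg_cong[OF \<rho>, of "\<lambda>x. x ! i"] that len' by simp
  qed
  from reindex_formula[OF \<phi>(1) len' this, of K] obtain \<phi>' where
    \<phi>': "\<phi>' \<in> formulas L (concat (replicate k \<sigma>))"
      "\<And>a. holds_at K \<phi>' a \<longleftrightarrow> holds_at K \<phi> (map ((!) a) \<pi>')" by blast
  have "p (map ((!) ws) \<pi>) \<longleftrightarrow> holds_at K \<phi>' (concat ws)"
    if ws: "length ws = k" "\<forall>w\<in>set ws. length w = ?l" for ws
  proof -
    have "\<forall>w\<in>set (map ((!) ws) \<pi>). length w = ?l" using ws \<pi> by auto
    then have "p (map ((!) ws) \<pi>) \<longleftrightarrow> holds_at K \<phi> (concat (map ((!) ws) \<pi>))"
      using \<phi>(2)[of "map ((!) ws) \<pi>"] len by simp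
    then show ?thesis unfolding \<phi>'(2) using nth_blocks[OF ws(2), of \<pi>] \<pi> ws(1) by (simp add: \<pi>'_def)
  qed
  then show ?thesis unfolding definable_pred_def using \<phi>'(1) by blast
qed

lemma definable_pred_eq: "definable_pred L K \<sigma> 2 (\<lambda>ws. ws ! 0 = ws ! 1)"
proof -
  let ?l = "length \<sigma>"
  let ?\<chi> = "\<lambda>i. Eq (Var (\<sigma> ! i, i)) (Var (\<sigma> ! i, ?l + i))"
  have \<rho>: "concat (replicate 2 \<sigma>) = \<sigma> @ \<sigma>" by (simp add: numeral_2_eq_2)
  have "?\<chi> i \<in> formulas L (\<sigma> @ \<sigma>)" if "i < ?l" for i
  proof -
    have "has_sort L (Var (\<sigma> ! i, i)) (\<sigma> ! i)" "has_sort L (Var (\<sigma> ! i, ?l + i)) (\<sigma> ! i)"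
      using has_sort.intros(1)[of L "(\<sigma> ! i, i)"] has_sort.intros(1)[of L "(\<sigma> ! i, ?l + i)"] by simp_all
    moreover have "(\<sigma> ! i, i) = ((\<sigma> @ \<sigma>) ! i, i)" "(\<sigma> ! i, ?l + i) = ((\<sigma> @ \<sigma>) ! (?l + i), ?l + i)"
      "i < length (\<sigma> @ \<sigma>)" "?l + i < length (\<sigma> @ \<sigma>)"
      using that by (simp_all add: nth_append)
    ultimately have "wf_fm L (?\<chi> i)" "fv (?\<chi> i) \<subseteq> {((\<sigma> @ \<sigma>) ! j, j) | j. j < length (\<sigma> @ \<sigma>)}"
      unfolding wf_fm.simps fv.simps fv_trm.simps Un_subset_iff by blast+
    then show ?thesis by (simp add: formulas_def)
  qed
  then obtain \<chi> where \<chi>: "\<chi> \<in> formulas L (\<sigma> @ \<sigma>)"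
    "\<And>a. holds_at K \<chi> a \<longleftrightarrow> (\<forall>i<?l. holds_at K (?\<chi> i) a \<longleftrightarrow> i \<in> UNIV)"
    using formulas_Conj_upto[of ?l ?\<chi> L "\<sigma> @ \<sigma>" K UNIV] by blast
  have "ws ! 0 = ws ! 1 \<longleftrightarrow> holds_at K \<chi> (concat ws)"
    if ws: "length ws = 2" "\<forall>w\<in>set ws. length w = ?l" for ws
  proof -
    obtain u v where uv: "ws = [u, v]" using ws(1) by (auto simp: numeral_2_eq_2 length_Suc_conv)
    then have "length u = ?l" "length v = ?l" using ws(2) by auto
    then have "holds_at K \<chi> (concat ws) \<longleftrightarrow> (\<forall>i<?l. u ! i = v ! i)"
      unfolding \<chi>(2) uv by (auto simp: holds_at_def nth_append)
    also have "\<dots> \<longleftrightarrow> u = v"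
      using \<open>length u = ?l\<close> \<open>length v = ?l\<close> by (auto simp: list_eq_iff_nth_eq)
    finally show ?thesis unfolding uv by simp
  qed
  then show ?thesis unfolding definable_pred_def \<rho> using \<chi>(1) by blast
qed

text \<open>The list is read as \<open>m\<close> blocks of \<open>n\<close> tuples, and the
  predicate says that some \<open>c\<close> cuts out exactly the blocks with number in
  \<open>S\<close>. As \<open>c\<close> is quantified, the defining formula has no parameters; this
  is the formula from which the independence property will be derived.\<close>

lemma definable_pred_pattern:
  assumes \<psi>: "\<psi> \<in> formulas L (concat (replicate n \<sigma>) @ \<tau>)"
  shows "definable_pred L K \<sigma> (m * n) (\<lambda>ws. \<exists>c\<in>tuples (univ K) \<tau>. \<forall>k<m.
           holds_at K \<psi> (concat (take n (drop (k * n) ws)) @ c) \<longleftrightarrow> k \<in> S)"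
proof -
  let ?l = "length \<sigma>" and ?\<rho> = "concat (replicate (m * n) \<sigma>)"
  have len\<rho>: "length ?\<rho> = m * n * ?l" "length (concat (replicate n \<sigma>)) = n * ?l"
    using length_concat_uniform[of "replicate (m * n) \<sigma>" ?l]
      length_concat_uniform[of "replicate n \<sigma>" ?l] by simp_all
  \<comment> \<open>The variables of the \<open>k\<close>-th block, followed by those of
    \<open>c\<close>, which come after all the blocks.\<close>
  define \<pi> where "\<pi> = (\<lambda>k. [k * n * ?l..<k * n * ?l + n * ?l] @ [m * n * ?l..<m * n * ?l + length \<tau>])"
  have bound: "k * n * ?l + n * ?l \<le> m * n * ?l" if "k < m" for k
    using mult_le_mono1[of "Suc k" m "n * ?l"] that by (simp add: algebra_simps)
  have \<pi>: "map ((!) (a @ c)) (\<pi> k) = take (n * ?l) (drop (k * n * ?l) a) @ c"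
    if "k < m" "length a = m * n * ?l" "length c = length \<tau>" for a c k
  proof -
    have "map ((!) (a @ c)) [k * n * ?l..<k * n * ?l + n * ?l] = take (n * ?l) (drop (k * n * ?l) a)"
      using map_nth_interval[of "k * n * ?l" "n * ?l" "a @ c"] bound[OF that(1)] that(2) by simp
    moreover have "map ((!) (a @ c)) [m * n * ?l..<m * n * ?l + length \<tau>] = c"
      using map_nth_interval[of "m * n * ?l" "length \<tau>" "a @ c"] that(2,3) by simp
    ultimately show ?thesis by (simp add: \<pi>_def)
  qed
  have "\<exists>\<chi>\<in>formulas L (?\<rho> @ \<tau>). \<forall>a. holds_at K \<chi> a \<longleftrightarrow> holds_at K \<psi> (map ((!) a) (\<pi> k))"
    if "k < m" for k
  proof (rule reindex_formula[OF \<psi>])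
    have "k * n + n \<le> m * n" using mult_le_mono1[of "Suc k" m n] that by simp
    then have "take n (drop (k * n) (replicate (m * n) \<sigma>)) = replicate n \<sigma>" by simp
    then have "take (n * ?l) (drop (k * n * ?l) ?\<rho>) = concat (replicate n \<sigma>)"
      using concat_block[of "replicate (m * n) \<sigma>" ?l n "k * n"] by simp
    moreover have "map ((!) (?\<rho> @ \<tau>)) (\<pi> k) = take (n * ?l) (drop (k * n * ?l) ?\<rho>) @ \<tau>"
    proof -
      have "map ((!) (?\<rho> @ \<tau>)) [k * n * ?l..<k * n * ?l + n * ?l] = take (n * ?l) (drop (k * n * ?l) ?\<rho>)"
        using map_nth_interval[of "k * n * ?l" "n * ?l" "?\<rho> @ \<tau>"] bound[OF that] len\<rho> by simp
      moreover have "map ((!) (?\<rho> @ \<tau>)) [m * n * ?l..<m * n * ?l + length \<tau>] = \<tau>"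
        using map_nth_interval[of "m * n * ?l" "length \<tau>" "?\<rho> @ \<tau>"] len\<rho> by simp
      ultimately show ?thesis by (simp add: \<pi>_def)
    qed
    ultimately have eq: "map ((!) (?\<rho> @ \<tau>)) (\<pi> k) = concat (replicate n \<sigma>) @ \<tau>" by simp
    then show len: "length (\<pi> k) = length (concat (replicate n \<sigma>) @ \<tau>)"
      by (metis length_map)
    fix i assume i: "i < length (concat (replicate n \<sigma>) @ \<tau>)"
    then have "\<pi> k ! i \<in> set (\<pi> k)" using len by simp
    then have "\<pi> k ! i < length (?\<rho> @ \<tau>)" unfolding \<pi>_def using bound[OF that] len\<rho> by auto
    moreover have "(?\<rho> @ \<tau>) ! (\<pi> k ! i) = (concat (replicate n \<sigma>) @ \<tau>) ! i"
      using arg_cong[OF eq, of "\<lambda>x. x ! i"] i len by simp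
    ultimately show "\<pi> k ! i < length (?\<rho> @ \<tau>) \<and>
        (?\<rho> @ \<tau>) ! (\<pi> k ! i) = (concat (replicate n \<sigma>) @ \<tau>) ! i" by simp
  qed
  then obtain \<chi> where \<chi>: "\<And>k. k < m \<Longrightarrow> \<chi> k \<in> formulas L (?\<rho> @ \<tau>)"
    "\<And>k a. k < m \<Longrightarrow> holds_at K (\<chi> k) a \<longleftrightarrow> holds_at K \<psi> (map ((!) a) (\<pi> k))" by metis
  obtain \<chi>' where \<chi>': "\<chi>' \<in> formulas L (?\<rho> @ \<tau>)"
    "\<And>a. holds_at K \<chi>' a \<longleftrightarrow> (\<forall>k<m. holds_at K (\<chi> k) a \<longleftrightarrow> k \<in> S)"
    using formulas_Conj_upto[of m \<chi> L "?\<rho> @ \<tau>" K S] \<chi>(1) by blast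
  obtain \<theta> where \<theta>: "\<theta> \<in> formulas L ?\<rho>"
    "\<And>a. length a = length ?\<rho> \<Longrightarrow>
       holds_at K \<theta> a \<longleftrightarrow> (\<exists>c\<in>tuples (univ K) \<tau>. holds_at K \<chi>' (a @ c))"
    using formulas_Ex_tuple[OF \<chi>'(1), of K] by blast
  have "holds_at K \<theta> (concat ws) \<longleftrightarrow> (\<exists>c\<in>tuples (univ K) \<tau>. \<forall>k<m.
      holds_at K \<psi> (concat (take n (drop (k * n) ws)) @ c) \<longleftrightarrow> k \<in> S)"
    if ws: "length ws = m * n" "\<forall>w\<in>set ws. length w = ?l" for ws
  proof -
    have len: "length (concat ws) = m * n * ?l" using length_concat_uniform[OF ws(2)] ws(1) by simp
    have "holds_at K (\<chi> k) (concat ws @ c) \<longleftrightarrow> holds_at K \<psi> (concat (take n (drop (k * n) ws)) @ c)"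
      if "c \<in> tuples (univ K) \<tau>" "k < m" for c k
      using \<chi>(2)[OF that(2)] \<pi>[OF that(2) len, of c] that(1) concat_block[OF ws(2), of n "k * n"]
      by (simp add: tuples_iff)
    then show ?thesis using \<theta>(2)[of "concat ws"] len len\<rho>(1) by (simp add: \<chi>'(2))
  qed
  then show ?thesis unfolding definable_pred_def using \<theta>(1) by blast
qed

section \<open>Extending indiscernible sequences by limits along ultrafilters\<close>

definition ultrafilter :: "'b filter \<Rightarrow> bool" where
  "ultrafilter U \<longleftrightarrow> U \<noteq> bot \<and> (\<forall>P. eventually P U \<or> eventually (\<lambda>x. \<not> P x) U)"

lemma ultrafilter_not:
  assumes "ultrafilter U"
  shows "eventually (\<lambda>x. \<not> P x) U \<longleftrightarrow> \<not> eventually P U"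
proof
  assume *: "eventually (\<lambda>x. \<not> P x) U"
  show "\<not> eventually P U"
  proof
    assume "eventually P U"
    with * have "eventually (\<lambda>x. False) U" by eventually_elim simp
    then show False using assms by (simp add: ultrafilter_def)
  qed
qed (use assms in \<open>auto simp: ultrafilter_def\<close>)

lemma ultrafilter_iff:
  assumes "ultrafilter U"
  shows "eventually (\<lambda>x. P x \<longleftrightarrow> Q x) U \<longleftrightarrow> (eventually P U \<longleftrightarrow> eventually Q U)"
proof
  assume *: "eventually (\<lambda>x. P x \<longleftrightarrow> Q x) U"
  show "eventually P U \<longleftrightarrow> eventually Q U"
  proof
    assume "eventually P U"
    with * show "eventually Q U" by eventually_elim simp
  next
    assume "eventually Q U"
    with * show "eventually P U" by eventually_elim simp
  qed
next
  assume *: "eventually P U \<longleftrightarrow> eventually Q U"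
  show "eventually (\<lambda>x. P x \<longleftrightarrow> Q x) U"
  proof (cases "eventually P U")
    case True
    then have "eventually P U" "eventually Q U" using * by simp_all
    then show ?thesis by eventually_elim simp
  next
    case False
    then have "eventually (\<lambda>x. \<not> P x) U" "eventually (\<lambda>x. \<not> Q x) U"
      using * by (simp_all add: ultrafilter_not[OF assms])
    then show ?thesis by eventually_elim simp
  qed
qed

lemma ultrafilter_finite:
  assumes U: "ultrafilter U" and "finite A" and ev: "eventually (\<lambda>x. \<exists>a\<in>A. P a x) U"
  shows "\<exists>a\<in>A. eventually (P a) U"
proof (rule ccontr)
  assume "\<not> ?thesis"
  then have "\<forall>a\<in>A. eventually (\<lambda>x. \<not> P a x) U"
    using U by (simp add: ultrafilter_not)
  then have "eventually (\<lambda>x. \<forall>a\<in>A. \<not> P a x) U"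
    using \<open>finite A\<close> by (simp add: eventually_ball_finite)
  then have "eventually (\<lambda>x. \<not> (\<exists>a\<in>A. P a x)) U" by simp
  then show False using ev U unfolding ultrafilter_not[OF U] by blast
qed

lemma linear_orderI:
  assumes "r \<subseteq> X \<times> X" "\<And>x. x \<in> X \<Longrightarrow> (x, x) \<in> r"
    "\<And>x y z. (x, y) \<in> r \<Longrightarrow> (y, z) \<in> r \<Longrightarrow> (x, z) \<in> r"
    "\<And>x y. (x, y) \<in> r \<Longrightarrow> (y, x) \<in> r \<Longrightarrow> x = y"
    "\<And>x y. x \<in> X \<Longrightarrow> y \<in> X \<Longrightarrow> (x, y) \<in> r \<or> (y, x) \<in> r"
  shows "linear_order_on X r"
  unfolding order_on_defs
proof (intro conjI)
  show "total_on X r" using assms(5) by (simp add: total_on_def)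
  show "antisym r" using assms(4) by (rule antisymI)
  show "trans r" using assms(3) by (rule transI)
  show "refl_on X r" using assms(2) by (rule refl_onI)
qed (rule assms(1))

lemma linear_orderD:
  assumes "linear_order_on X r"
  shows "(x, y) \<in> r \<Longrightarrow> x \<in> X \<and> y \<in> X" and "x \<in> X \<Longrightarrow> (x, x) \<in> r"
    and "(x, y) \<in> r \<Longrightarrow> (y, z) \<in> r \<Longrightarrow> (x, z) \<in> r"
    and "(x, y) \<in> r \<Longrightarrow> (y, x) \<in> r \<Longrightarrow> x = y"
    and "x \<in> X \<Longrightarrow> y \<in> X \<Longrightarrow> (x, y) \<in> r \<or> (y, x) \<in> r"
  using assms unfolding order_on_defs
  by (auto dest: refl_onD transD antisymD simp: total_on_def) (metis refl_onD)+

lemma Field_linear_order: "linear_order_on X r \<Longrightarrow> Field r = X"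
  using linear_orderD(1,2)[of X r] by (fastforce simp: Field_def)

text \<open>\<open>Fm m p\<close> is to be read as: \<open>p\<close> is definable by a formula in \<open>m\<close> variables.\<close>

locale predicate_system =
  fixes Fm :: "nat \<Rightarrow> ('b list \<Rightarrow> bool) \<Rightarrow> bool"
  assumes reindex: "Fm m p \<Longrightarrow> length \<pi> = m \<Longrightarrow> \<forall>j\<in>set \<pi>. j < k \<Longrightarrow> Fm k (\<lambda>ws. p (map ((!) ws) \<pi>))"
    and equality: "Fm 2 (\<lambda>ws. ws ! 0 = ws ! 1)"
begin

definition indisc :: "'b set \<Rightarrow> 'b rel \<Rightarrow> bool" where
  "indisc X r \<longleftrightarrow> (\<forall>m p as bs. Fm m p \<longrightarrow> length as = m \<longrightarrow> length bs = m \<longrightarrow>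
     set as \<subseteq> X \<longrightarrow> set bs \<subseteq> X \<longrightarrow> sorted_wrt (\<lambda>x y. (x, y) \<in> r - Id) as \<longrightarrow>
     sorted_wrt (\<lambda>x y. (x, y) \<in> r - Id) bs \<longrightarrow> p as = p bs)"

lemma equality_at: "i < k \<Longrightarrow> j < k \<Longrightarrow> Fm k (\<lambda>ws. ws ! i = ws ! j)"
  using reindex[OF equality, of "[i, j]" k] by simp

end

text \<open>Both directions are compared so that, in a reflexive linear order, an element equal to
  just one of \<open>y\<close> and \<open>y'\<close> separates them. Thus if \<open>y\<close> does
  not separate \<open>y\<close> from \<open>y'\<close>, then \<open>y = y'\<close>.\<close>

definition separates :: "'b rel \<Rightarrow> 'b \<Rightarrow> 'b \<Rightarrow> 'b \<Rightarrow> bool" where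
  "separates r x y y' \<longleftrightarrow> \<not> (((x, y) \<in> r \<longleftrightarrow> (x, y') \<in> r) \<and> ((y, x) \<in> r \<longleftrightarrow> (y', x) \<in> r))"

text \<open>\<open>ss\<close> realises the limit along \<open>U\<close> of the types over \<open>X\<close> of \<open>n\<close>-tuples of elements of \<open>X\<close>.\<close>

locale limit_tuple = predicate_system Fm for Fm :: "nat \<Rightarrow> ('b list \<Rightarrow> bool) \<Rightarrow> bool" +
  fixes X :: "'b set" and r :: "'b rel" and n :: nat and U :: "'b list filter" and ss :: "'b list"
  assumes lin: "linear_order_on X r" and ind: "indisc X r" and ultra: "ultrafilter U"
    and ev: "eventually (\<lambda>t. length t = n \<and> set t \<subseteq> X) U" and len: "length ss = n"
    and lim: "Fm (n + k) p \<Longrightarrow> length xs = k \<Longrightarrow> set xs \<subseteq> X \<Longrightarrow>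
                p (ss @ xs) \<longleftrightarrow> eventually (\<lambda>t. p (t @ xs)) U"
begin

definition idx :: "'b \<Rightarrow> nat" where "idx u = (SOME i. i < n \<and> ss ! i = u)"

text \<open>The stand-in for \<open>u\<close> when \<open>ss\<close> is replaced by a tuple
  \<open>t\<close> of elements of \<open>X\<close>. An element may occur several times in
  \<open>ss\<close>, or both in \<open>ss\<close> and in \<open>X\<close>; which occurrence is used
  makes no difference for almost every \<open>t\<close>, by \<open>nth_lk\<close>.\<close>

definition lk :: "'b list \<Rightarrow> 'b \<Rightarrow> 'b" where "lk t u = (if u \<in> X then u else t ! idx u)"

definition X' :: "'b set" where "X' = X \<union> set ss"

definition r' :: "'b rel" where
  "r' = {(u, v). u \<in> X' \<and> v \<in> X' \<and> eventually (\<lambda>t. (lk t u, lk t v) \<in> r) U}"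

lemma not_bot: "U \<noteq> bot"
  using ultra by (simp add: ultrafilter_def)

lemma idx: "u \<in> X' \<Longrightarrow> u \<notin> X \<Longrightarrow> idx u < n \<and> ss ! idx u = u"
  unfolding idx_def by (rule someI_ex) (auto simp: X'_def len in_set_conv_nth)

lemma lk_in: "length t = n \<Longrightarrow> set t \<subseteq> X \<Longrightarrow> u \<in> X' \<Longrightarrow> lk t u \<in> X"
  using idx[of u] by (auto simp: lk_def)

lemma ev_lk_in: "set us \<subseteq> X' \<Longrightarrow> eventually (\<lambda>t. set (map (lk t) us) \<subseteq> X) U"
  using ev by eventually_elim (use lk_in in auto)

text \<open>An analogue of the theorem of Los for the extended set. A list from \<open>X'\<close> is
  a selection from \<open>ss\<close> followed by elements of \<open>X\<close>, so the hypothesis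
  \<open>lim\<close> applies after reindexing.\<close>

lemma lim_lk:
  assumes "Fm m p" "length us = m" "set us \<subseteq> X'"
  shows "p us \<longleftrightarrow> eventually (\<lambda>t. p (map (lk t) us)) U"
proof -
  obtain t0 where t0: "length t0 = n" "set t0 \<subseteq> X"
    using eventually_happens'[OF not_bot ev] by blast
  \<comment> \<open>Entries of \<open>us\<close> in \<open>X\<close> are kept. For the others
    \<open>t0\<close> provides dummies in \<open>X\<close>, so that entry \<open>j\<close> of
    \<open>xs\<close> always has position \<open>n + j\<close>; \<pi> never selects the
    dummies.\<close>
  define xs where "xs = map (lk t0) us"
  define \<pi> where "\<pi> = map (\<lambda>j. if us ! j \<in> X then n + j else idx (us ! j)) [0..<m]"
  have us: "us ! j \<in> X'" if "j < m" for j using assms(2,3) that by auto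
  have eq: "map ((!) (t @ xs)) \<pi> = map (lk t) us" if "length t = n" for t
    using that assms(2) idx[OF us]
    by (intro nth_equalityI) (auto simp: \<pi>_def xs_def nth_append lk_def)
  have "Fm (n + m) (\<lambda>ws. p (map ((!) ws) \<pi>))"
    by (rule reindex[OF assms(1)]) (use idx[OF us] in \<open>auto simp: \<pi>_def trans_less_add1\<close>)
  then have "p (map ((!) (ss @ xs)) \<pi>) \<longleftrightarrow> eventually (\<lambda>t. p (map ((!) (t @ xs)) \<pi>)) U"
    by (rule lim) (use assms(2,3) lk_in[OF t0] in \<open>auto simp: xs_def\<close>)
  moreover have "map ((!) (ss @ xs)) \<pi> = us"
    unfolding eq[OF len] using idx us assms(2)
    by (intro nth_equalityI) (simp_all add: lk_def)
  moreover have "eventually (\<lambda>t. p (map ((!) (t @ xs)) \<pi>) \<longleftrightarrow> p (map (lk t) us)) U"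
    using ev by eventually_elim (simp add: eq)
  ultimately show ?thesis unfolding ultrafilter_iff[OF ultra] by simp
qed

lemma eq_lk: "u \<in> X' \<Longrightarrow> v \<in> X' \<Longrightarrow> u = v \<longleftrightarrow> eventually (\<lambda>t. lk t u = lk t v) U"
  using lim_lk[OF equality, of "[u, v]"] by simp

text \<open>A coincidence of \<open>ss ! i\<close> with an element of \<open>X\<close>, or with
  another entry of \<open>ss\<close>, is an equality; equality is definable, so the same coincidence
  occurs in almost every \<open>t\<close>.\<close>

lemma nth_lk:
  assumes "i < n"
  shows "eventually (\<lambda>t. t ! i = lk t (ss ! i)) U"
proof (cases "ss ! i \<in> X")
  case True
  have "eventually (\<lambda>t. (t @ [ss ! i]) ! i = (t @ [ss ! i]) ! n) U"
    using lim[OF equality_at[of i "n + 1" n], of "[ss ! i]"] assms True len by (simp add: nth_append)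
  with ev show ?thesis by eventually_elim (use assms True in \<open>simp add: nth_append lk_def\<close>)
next
  case False
  moreover have "ss ! i \<in> X'" using assms len by (simp add: X'_def)
  ultimately have "idx (ss ! i) < n \<and> ss ! idx (ss ! i) = ss ! i" using idx by blast
  then have "eventually (\<lambda>t. (t @ []) ! i = (t @ []) ! idx (ss ! i)) U"
    using lim[OF equality_at[of i "n + 0" "idx (ss ! i)"], of "[]"] assms len by simp
  then show ?thesis using False by (simp add: lk_def)
qed

lemma r'_iff: "u \<in> X' \<Longrightarrow> v \<in> X' \<Longrightarrow> (u, v) \<in> r' \<longleftrightarrow> eventually (\<lambda>t. (lk t u, lk t v) \<in> r) U"
  by (simp add: r'_def)

text \<open>Every axiom is inherited from the stand-ins of almost all \<open>t\<close>. Antisymmetry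
  needs in addition that equality is definable (\<open>eq_lk\<close>), and totality that
  \<open>U\<close> decides every property.\<close>

lemma lin': "linear_order_on X' r'"
proof (rule linear_orderI)
  show "(x, x) \<in> r'" if "x \<in> X'" for x
    unfolding r'_iff[OF that that]
    using ev by eventually_elim (use lk_in that linear_orderD(2)[OF lin] in blast)
  show "(x, z) \<in> r'" if "(x, y) \<in> r'" "(y, z) \<in> r'" for x y z
  proof -
    have "eventually (\<lambda>t. (lk t x, lk t y) \<in> r) U" "eventually (\<lambda>t. (lk t y, lk t z) \<in> r) U"
      using that by (simp_all add: r'_def)
    then have "eventually (\<lambda>t. (lk t x, lk t z) \<in> r) U"
      by eventually_elim (rule linear_orderD(3)[OF lin])
    then show ?thesis using that by (simp add: r'_def)
  qed
  show "x = y" if "(x, y) \<in> r'" "(y, x) \<in> r'" for x y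
  proof -
    have "eventually (\<lambda>t. (lk t x, lk t y) \<in> r) U" "eventually (\<lambda>t. (lk t y, lk t x) \<in> r) U"
      using that by (simp_all add: r'_def)
    then have "eventually (\<lambda>t. lk t x = lk t y) U"
      by eventually_elim (rule linear_orderD(4)[OF lin])
    then show ?thesis using that eq_lk by (simp add: r'_def)
  qed
  show "(x, y) \<in> r' \<or> (y, x) \<in> r'" if "x \<in> X'" "y \<in> X'" for x y
  proof (rule disjCI)
    assume "(y, x) \<notin> r'"
    then have "eventually (\<lambda>t. (lk t y, lk t x) \<notin> r) U"
      unfolding ultrafilter_not[OF ultra] using that by (simp add: r'_iff)
    with ev have "eventually (\<lambda>t. (lk t x, lk t y) \<in> r) U"
      by eventually_elim (use lk_in that linear_orderD(5)[OF lin] in blast)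
    then show "(x, y) \<in> r'" using that by (simp add: r'_iff)
  qed
qed (auto simp: r'_def)

lemma r'_restrict: "x \<in> X \<Longrightarrow> y \<in> X \<Longrightarrow> (x, y) \<in> r' \<longleftrightarrow> (x, y) \<in> r"
  by (simp add: r'_def X'_def lk_def not_bot)

lemma r_subset: "r \<subseteq> r'"
  using linear_orderD(1)[OF lin] r'_restrict by auto

text \<open>Increasing lists in \<open>X'\<close> have increasing stand-ins in \<open>X\<close> for
  almost every \<open>t\<close>. There the old sequence is indiscernible, and \<open>lim_lk\<close>
  carries the equivalence back.\<close>

lemma ind': "indisc X' r'"
  unfolding indisc_def
proof (intro allI impI)
  fix m p as bs
  assume p: "Fm m p" and len: "length as = m" "length bs = m" and sub: "set as \<subseteq> X'" "set bs \<subseteq> X'"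
    and srt: "sorted_wrt (\<lambda>x y. (x, y) \<in> r' - Id) as" "sorted_wrt (\<lambda>x y. (x, y) \<in> r' - Id) bs"
  have *: "eventually (\<lambda>t. sorted_wrt (\<lambda>x y. (x, y) \<in> r - Id) (map (lk t) us)) U"
    if "set us \<subseteq> X'" "sorted_wrt (\<lambda>x y. (x, y) \<in> r' - Id) us" for us
    using that
  proof (induction us)
    case (Cons u us)
    have "eventually (\<lambda>t. (lk t u, lk t v) \<in> r - Id) U" if "v \<in> set us" for v
    proof -
      have uv: "u \<in> X'" "v \<in> X'" "(u, v) \<in> r'" "u \<noteq> v" using Cons.prems that by auto
      then have "eventually (\<lambda>t. (lk t u, lk t v) \<in> r) U" "eventually (\<lambda>t. lk t u \<noteq> lk t v) U"
        using eq_lk by (simp_all add: r'_iff ultrafilter_not[OF ultra])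
      then show ?thesis by eventually_elim simp
    qed
    then have "eventually (\<lambda>t. \<forall>v\<in>set us. (lk t u, lk t v) \<in> r - Id) U"
      by (intro eventually_ball_finite ballI) simp_all
    moreover have "eventually (\<lambda>t. sorted_wrt (\<lambda>x y. (x, y) \<in> r - Id) (map (lk t) us)) U"
      using Cons by simp
    ultimately show ?case by eventually_elim simp
  qed simp
  have "eventually (\<lambda>t. p (map (lk t) as) \<longleftrightarrow> p (map (lk t) bs)) U"
    using ev_lk_in[OF sub(1)] ev_lk_in[OF sub(2)] *[OF sub(1) srt(1)] *[OF sub(2) srt(2)]
  proof eventually_elim
    case (elim t)
    then show ?case
      using ind[unfolded indisc_def, rule_format, of m p "map (lk t) as" "map (lk t) bs"] p len by simp
  qed
  then show "p as = p bs"
    using lim_lk[OF p len(1) sub(1)] lim_lk[OF p len(2) sub(2)] by (simp add: ultrafilter_iff[OF ultra])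
qed

lemma nth_in_X': "i < n \<Longrightarrow> ss ! i \<in> X'"
  using len by (simp add: X'_def)

text \<open>The right-hand side mentions \<open>U\<close> but not \<open>ss\<close>. Hence two
  realisations of limits along the same ultrafilter occupy the same place relative to
  \<open>X\<close>.\<close>

lemma order_left:
  assumes "x \<in> X" "i < n"
  shows "(x, ss ! i) \<in> r' \<longleftrightarrow> eventually (\<lambda>t. (x, t ! i) \<in> r) U"
proof -
  have "eventually (\<lambda>t. (x, t ! i) \<in> r \<longleftrightarrow> (lk t x, lk t (ss ! i)) \<in> r) U"
    using nth_lk[OF assms(2)] by eventually_elim (use assms(1) in \<open>simp add: lk_def\<close>)
  then show ?thesis
    using assms nth_in_X' by (simp add: ultrafilter_iff[OF ultra] r'_iff X'_def)
qed

lemma order_right: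
  assumes "x \<in> X" "i < n"
  shows "(ss ! i, x) \<in> r' \<longleftrightarrow> eventually (\<lambda>t. (t ! i, x) \<in> r) U"
proof -
  have "eventually (\<lambda>t. (t ! i, x) \<in> r \<longleftrightarrow> (lk t (ss ! i), lk t x) \<in> r) U"
    using nth_lk[OF assms(2)] by eventually_elim (use assms(1) in \<open>simp add: lk_def\<close>)
  then show ?thesis
    using assms nth_in_X' by (simp add: ultrafilter_iff[OF ultra] r'_iff X'_def)
qed

lemma order_within:
  assumes "i < n" "j < n"
  shows "(ss ! i, ss ! j) \<in> r' \<longleftrightarrow> eventually (\<lambda>t. (t ! i, t ! j) \<in> r) U"
proof -
  have "eventually (\<lambda>t. (t ! i, t ! j) \<in> r \<longleftrightarrow> (lk t (ss ! i), lk t (ss ! j)) \<in> r) U"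
    using nth_lk[OF assms(1)] nth_lk[OF assms(2)] by eventually_elim simp
  then show ?thesis
    using nth_in_X'[OF assms(1)] nth_in_X'[OF assms(2)]
    by (simp add: ultrafilter_iff[OF ultra] r'_iff)
qed

text \<open>Ensures that witnesses survive an extension of the sequence. The stand-in of a new
  element \<open>x\<close> outside \<open>Z\<close> avoids the finite set \<open>Z\<close> for
  almost all \<open>t\<close>: otherwise it would almost always be one fixed \<open>z\<close> in
  \<open>Z\<close>, and then \<open>x = z\<close>.\<close>

lemma separates_extend:
  assumes yy: "y \<in> X" "y' \<in> X" and Z: "finite Z" and sep: "\<forall>x\<in>X - Z. \<not> separates r x y y'"
  shows "\<forall>x\<in>X' - Z. \<not> separates r' x y y'"
proof
  fix x assume x: "x \<in> X' - Z"
  show "\<not> separates r' x y y'"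
  proof (cases "x \<in> X")
    case True
    then show ?thesis using sep x yy by (auto simp: separates_def r'_restrict)
  next
    case False
    have "\<not> eventually (\<lambda>t. lk t x \<in> Z) U"
    proof
      assume "eventually (\<lambda>t. lk t x \<in> Z) U"
      then have "eventually (\<lambda>t. \<exists>z\<in>Z. lk t x = z) U" by eventually_elim simp
      from ultrafilter_finite[OF ultra Z this] obtain z where z: "z \<in> Z" "eventually (\<lambda>t. lk t x = z) U"
        by blast
      have "z \<in> X"
      proof -
        have "eventually (\<lambda>t. z \<in> X) U"
          using z(2) ev by eventually_elim (use lk_in x in blast)
        then show ?thesis using not_bot by simp
      qed
      then have "x = z" using z(2) x eq_lk[of x z] by (simp add: lk_def X'_def)
      then show False using z(1) x by simp
    qed
    then have "eventually (\<lambda>t. lk t x \<notin> Z) U" by (simp add: ultrafilter_not[OF ultra])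
    with ev have "eventually (\<lambda>t. \<not> separates r (lk t x) y y') U"
      by eventually_elim (use sep x lk_in in blast)
    then have "eventually (\<lambda>t. (lk t x, lk t y) \<in> r \<longleftrightarrow> (lk t x, lk t y') \<in> r) U"
      "eventually (\<lambda>t. (lk t y, lk t x) \<in> r \<longleftrightarrow> (lk t y', lk t x) \<in> r) U"
      using yy by (auto simp: separates_def lk_def elim: eventually_mono)
    then show ?thesis
      using x yy by (simp add: separates_def ultrafilter_iff[OF ultra] r'_iff X'_def)
  qed
qed

end

section \<open>Sequences closed under witnesses\<close>

text \<open>By totality of the smaller order, inclusion of linear orders already means that the
  smaller one is the restriction. Therefore sequences can be compared by plain inclusion of their
  orders.\<close>

lemma linear_order_subset_iff:
  assumes "linear_order_on X r" "linear_order_on X' r'" "r \<subseteq> r'" "x \<in> X" "y \<in> X"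
  shows "(x, y) \<in> r' \<longleftrightarrow> (x, y) \<in> r"
proof
  assume *: "(x, y) \<in> r'"
  show "(x, y) \<in> r"
  proof (rule ccontr)
    assume "(x, y) \<notin> r"
    then have "(y, x) \<in> r" using linear_orderD(5)[OF assms(1,4,5)] by blast
    then have "x = y" using * assms(3) linear_orderD(4)[OF assms(2)] by blast
    then show False using \<open>(y, x) \<in> r\<close> \<open>(x, y) \<notin> r\<close> by simp
  qed
qed (use assms(3) in blast)

section \<open>Cardinal bounds for products and finite lists\<close>

lemma card_of_Times_bounded: "infinite B \<Longrightarrow> |X| \<le>o |B| \<Longrightarrow> |Y| \<le>o |B| \<Longrightarrow> |X \<times> Y| \<le>o |B|"
  using card_of_Times_ordLeq_infinite_Field[of "|B|" X Y] card_of_Card_order[of B]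
  by (simp only: Field_card_of simp_thms)

lemma card_of_nlists:
  assumes "infinite B" "|Y| \<le>o |B|"
  shows "|{xs. length xs = n \<and> set xs \<subseteq> Y}| \<le>o |B|"
proof (induction n)
  case 0
  have "{xs. length xs = 0 \<and> set xs \<subseteq> Y} = {[]}" by auto
  then show ?case using assms(1) by (simp only:) (intro card_of_singl_ordLeq, auto)
next
  case (Suc n)
  let ?S = "{xs. length xs = n \<and> set xs \<subseteq> Y}"
  have "{xs. length xs = Suc n \<and> set xs \<subseteq> Y} = (\<lambda>(x, xs). x # xs) ` (Y \<times> ?S)"
    by (auto simp: length_Suc_conv image_iff)
  then have "|{xs. length xs = Suc n \<and> set xs \<subseteq> Y}| \<le>o |Y \<times> ?S|"
    by (simp add: card_of_image)
  also have "|Y \<times> ?S| \<le>o |B|"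
    using assms Suc by (intro card_of_Times_bounded)
  finally show ?case .
qed

lemma card_of_lists:
  assumes "infinite B" "|Y| \<le>o |B|"
  shows "|lists Y| \<le>o |B|"
proof -
  have "lists Y = (\<Union>n. {xs. length xs = n \<and> set xs \<subseteq> Y})" by auto
  moreover have "|\<Union>n\<in>(UNIV :: nat set). {xs. length xs = n \<and> set xs \<subseteq> Y}| \<le>o |B|"
    using assms card_of_nlists infinite_iff_card_of_nat
    by (intro card_of_UNION_ordLeq_infinite) auto
  ultimately show ?thesis by simp
qed

text \<open>
  A witness for \<open>d\<close> consists of two tuples on which the predicate \<open>Q d\<close> differs, although they occupy the
  same position relative to the elements of the sequence other than their own entries. The clauses
  about \<open>Fs\<close> and \<open>Gs\<close> ensure that witnesses found for increasing \<open>Fs\<close> only share elements of \<open>Gs\<close>.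
\<close>

type_synonym ('b, 'd) task = "'b list \<times> 'b list \<times> 'd"

locale witness_system = predicate_system Fm for Fm :: "nat \<Rightarrow> ('b list \<Rightarrow> bool) \<Rightarrow> bool" +
  fixes A :: "'b set" and r0 :: "'b rel" and C :: "'b set"
    and D :: "'d set" and ar :: "'d \<Rightarrow> nat" and Q :: "'d \<Rightarrow> 'b list \<Rightarrow> bool"
  assumes lin0: "linear_order_on A r0" and ind0: "indisc A r0" and AC: "A \<subseteq> C"
begin

text \<open>Entries of the pair have to be exempt from the ban on separation, since distinct
  \<open>y\<close> and \<open>y'\<close> are separated by \<open>y\<close>. Entries in
  \<open>Fs\<close> are not exempt: in a linear order such an entry must therefore be the same in
  both tuples at its position.\<close>

definition wit :: "'b rel \<Rightarrow> 'b list \<Rightarrow> 'b list \<Rightarrow> 'd \<Rightarrow> 'b list \<Rightarrow> 'b list \<Rightarrow> bool" where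
  "wit r Fs Gs d zs zs' \<longleftrightarrow>
     d \<in> D \<and> set Fs \<union> set Gs \<union> set zs \<union> set zs' \<subseteq> Field r \<and> length zs = ar d \<and> length zs' = ar d \<and>
     (\<forall>i<ar d. \<forall>x\<in>Field r - (set zs \<union> set zs' - set Fs). \<not> separates r x (zs ! i) (zs' ! i)) \<and>
     (\<forall>i<ar d. \<forall>j<ar d. (zs ! i, zs ! j) \<in> r \<longleftrightarrow> (zs' ! i, zs' ! j) \<in> r) \<and>
     (set zs \<union> set zs') \<inter> set Fs \<subseteq> set Gs \<and> (Q d zs \<longleftrightarrow> \<not> Q d zs')"

definition closed_under :: "(('b, 'd) task \<times> ('b list \<times> 'b list)) set \<Rightarrow> 'b set \<Rightarrow> bool" where
  "closed_under G Y \<longleftrightarrow> (\<forall>Fs Gs d zs zs'. ((Fs, Gs, d), (zs, zs')) \<in> G \<longrightarrow>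
     set Fs \<subseteq> Y \<longrightarrow> set Gs \<subseteq> Y \<longrightarrow> set zs \<union> set zs' \<subseteq> Y)"

lemma closed_under_subset: "closed_under G Y \<Longrightarrow> H \<subseteq> G \<Longrightarrow> closed_under H Y"
  unfolding closed_under_def by (meson subsetD)

text \<open>
  A state consists of an indiscernible sequence (given by its order) and a partial choice of
  witnesses; the last clause, that the sequence is generated from \<open>A\<close> by these witnesses, bounds its
  cardinality.
\<close>

type_synonym ('x, 'y) state = "('x \<times> 'x + ('x, 'y) task \<times> ('x list \<times> 'x list)) set"

text \<open>Order and choice of witnesses are the two summands of one set, so that inclusion of
  states extends both and Zorn's lemma for inclusion applies.\<close>

definition ord :: "('b, 'd) state \<Rightarrow> 'b rel" where "ord s = Inl -` s"

definition wits :: "('b, 'd) state \<Rightarrow> (('b, 'd) task \<times> ('b list \<times> 'b list)) set" where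
  "wits s = Inr -` s"

definition good :: "('b, 'd) state \<Rightarrow> bool" where
  "good s \<longleftrightarrow> linear_order_on (Field (ord s)) (ord s) \<and> indisc (Field (ord s)) (ord s) \<and>
     r0 \<subseteq> ord s \<and> Field (ord s) \<subseteq> C \<and> single_valued (wits s) \<and>
     (\<forall>Fs Gs d zs zs'. ((Fs, Gs, d), (zs, zs')) \<in> wits s \<longrightarrow> wit (ord s) Fs Gs d zs zs') \<and>
     (\<forall>Y. A \<subseteq> Y \<longrightarrow> closed_under (wits s) Y \<longrightarrow> Field (ord s) \<subseteq> Y)"

lemma goodD:
  assumes "good s"
  shows "linear_order_on (Field (ord s)) (ord s)" "indisc (Field (ord s)) (ord s)"
    "r0 \<subseteq> ord s" "Field (ord s) \<subseteq> C" "single_valued (wits s)"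
    "((Fs, Gs, d), (zs, zs')) \<in> wits s \<Longrightarrow> wit (ord s) Fs Gs d zs zs'"
    "A \<subseteq> Y \<Longrightarrow> closed_under (wits s) Y \<Longrightarrow> Field (ord s) \<subseteq> Y"
  using assms unfolding good_def by simp_all

lemma witD:
  assumes "wit r Fs Gs d zs zs'"
  shows "d \<in> D" "set Fs \<subseteq> Field r" "set Gs \<subseteq> Field r" "set zs \<subseteq> Field r" "set zs' \<subseteq> Field r"
    "length zs = ar d" "length zs' = ar d"
    "i < ar d \<Longrightarrow> x \<in> Field r \<Longrightarrow> x \<notin> set zs \<union> set zs' - set Fs \<Longrightarrow>
       \<not> separates r x (zs ! i) (zs' ! i)"
    "i < ar d \<Longrightarrow> j < ar d \<Longrightarrow> (zs ! i, zs ! j) \<in> r \<longleftrightarrow> (zs' ! i, zs' ! j) \<in> r"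
    "(set zs \<union> set zs') \<inter> set Fs \<subseteq> set Gs" "Q d zs \<longleftrightarrow> \<not> Q d zs'"
    "i < ar d \<Longrightarrow> zs ! i \<in> Field r" "i < ar d \<Longrightarrow> zs' ! i \<in> Field r"
proof -
  show z: "set zs \<subseteq> Field r" "set zs' \<subseteq> Field r" "length zs = ar d" "length zs' = ar d"
    using assms unfolding wit_def by simp_all
  show "i < ar d \<Longrightarrow> zs ! i \<in> Field r" "i < ar d \<Longrightarrow> zs' ! i \<in> Field r"
    using z nth_mem[of i zs] nth_mem[of i zs'] by auto
qed (use assms in \<open>simp_all add: wit_def\<close>)

lemma good_initial: "good (Inl ` r0)"
proof -
  have "ord (Inl ` r0) = r0" "wits (Inl ` r0) = {}" by (auto simp: ord_def wits_def)
  then show ?thesis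
    using lin0 ind0 AC Field_linear_order[OF lin0] by (simp add: good_def)
qed

lemma ord_mono: "s \<subseteq> t \<Longrightarrow> ord s \<subseteq> ord t"
  by (auto simp: ord_def)

lemma good_restrict:
  assumes "good s" "linear_order_on (Field r) r" "ord s \<subseteq> r" "x \<in> Field (ord s)" "y \<in> Field (ord s)"
  shows "(x, y) \<in> r \<longleftrightarrow> (x, y) \<in> ord s"
  using goodD(1)[OF assms(1)] assms(2-) by (rule linear_order_subset_iff)

text \<open>Each clause of \<open>good\<close> involves finitely many elements at a time, or is
  tested on one element \<open>x\<close> at a time, or is a closure condition, and so can be checked
  in a member of the chain.\<close>

lemma good_Union:
  assumes ne: "\<C> \<noteq> {}" and chain: "subset.chain {s. good s} \<C>"
  shows "good (\<Union>\<C>)"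
proof -
  let ?R = "ord (\<Union>\<C>)"
  have good: "good s" if "s \<in> \<C>" for s using chain that by (auto simp: subset.chain_def)
  have comp: "s \<subseteq> t \<or> t \<subseteq> s" if "s \<in> \<C>" "t \<in> \<C>" for s t
    using subset.chain_total[OF chain that] by auto
  have R: "?R = (\<Union>s\<in>\<C>. ord s)" and W: "wits (\<Union>\<C>) = (\<Union>s\<in>\<C>. wits s)"
    by (auto simp: ord_def wits_def)
  have sub: "ord s \<subseteq> ?R" if "s \<in> \<C>" for s using that R by blast
  have FR: "Field ?R = (\<Union>s\<in>\<C>. Field (ord s))" unfolding R Field_def by blast
  have pair: "\<exists>s\<in>\<C>. e \<in> ord s \<and> f \<in> ord s" if "e \<in> ?R" "f \<in> ?R" for e f
  proof -
    obtain s t where "s \<in> \<C>" "e \<in> ord s" "t \<in> \<C>" "f \<in> ord t" using \<open>e \<in> ?R\<close> \<open>f \<in> ?R\<close> R by blast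
    then show ?thesis using comp[of s t] ord_mono[of s t] ord_mono[of t s] by blast
  qed
  have fin: "\<exists>s\<in>\<C>. V \<subseteq> Field (ord s)" if "finite V" "V \<subseteq> Field ?R" for V
    using that
  proof (induction V)
    case empty
    then show ?case using ne by blast
  next
    case (insert x V)
    then obtain s t where "s \<in> \<C>" "V \<subseteq> Field (ord s)" "t \<in> \<C>" "x \<in> Field (ord t)"
      using FR by blast
    then show ?case
      using comp[of s t] mono_Field[OF ord_mono[of s t]] mono_Field[OF ord_mono[of t s]] by blast
  qed
  have lin: "linear_order_on (Field (ord s)) (ord s)" if "s \<in> \<C>" for s
    using good[OF that] by (rule goodD)
  have linR: "linear_order_on (Field ?R) ?R"
  proof (rule linear_orderI)
    show "?R \<subseteq> Field ?R \<times> Field ?R" by (auto simp: Field_def)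
    show "(x, x) \<in> ?R" if "x \<in> Field ?R" for x
      using that linear_orderD(2)[OF lin] unfolding FR unfolding R by blast
    show "(x, z) \<in> ?R" if "(x, y) \<in> ?R" "(y, z) \<in> ?R" for x y z
      using pair[OF that] linear_orderD(3)[OF lin] unfolding R by blast
    show "x = y" if "(x, y) \<in> ?R" "(y, x) \<in> ?R" for x y
      using pair[OF that] linear_orderD(4)[OF lin] by blast
    show "(x, y) \<in> ?R \<or> (y, x) \<in> ?R" if "x \<in> Field ?R" "y \<in> Field ?R" for x y
    proof -
      have "\<exists>s\<in>\<C>. {x, y} \<subseteq> Field (ord s)" by (rule fin) (use that in auto)
      then obtain s where "s \<in> \<C>" "x \<in> Field (ord s)" "y \<in> Field (ord s)" by blast
      then show ?thesis using linear_orderD(5)[OF lin] sub by blast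
    qed
  qed
  have restr: "(x, y) \<in> ?R \<longleftrightarrow> (x, y) \<in> ord s" if "s \<in> \<C>" "x \<in> Field (ord s)" "y \<in> Field (ord s)" for s x y
    using good_restrict[OF good linR sub] that by blast
  have "indisc (Field ?R) ?R"
    unfolding indisc_def
  proof (intro allI impI)
    fix m p as bs
    assume p: "Fm m p" and len: "length as = m" "length bs = m"
      and as: "set as \<subseteq> Field ?R" and bs: "set bs \<subseteq> Field ?R"
      and srt: "sorted_wrt (\<lambda>x y. (x, y) \<in> ?R - Id) as" "sorted_wrt (\<lambda>x y. (x, y) \<in> ?R - Id) bs"
    obtain s where s: "s \<in> \<C>" "set as \<union> set bs \<subseteq> Field (ord s)"
      using fin[of "set as \<union> set bs"] as bs by auto
    have "sorted_wrt (\<lambda>x y. (x, y) \<in> ord s - Id) us"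
      if "sorted_wrt (\<lambda>x y. (x, y) \<in> ?R - Id) us" "set us \<subseteq> Field (ord s)" for us
      using _ that(1) by (rule sorted_wrt_mono_rel) (use that(2) restr[OF s(1)] in blast)
    then have "sorted_wrt (\<lambda>x y. (x, y) \<in> ord s - Id) as" "sorted_wrt (\<lambda>x y. (x, y) \<in> ord s - Id) bs"
      using srt s(2) by simp_all
    then show "p as = p bs"
      using goodD(2)[OF good[OF s(1)], unfolded indisc_def, rule_format, OF p len] s(2) by simp
  qed
  moreover have "r0 \<subseteq> ?R" using ne goodD(3)[OF good] unfolding R by blast
  moreover have "Field ?R \<subseteq> C" using goodD(4)[OF good] unfolding FR by blast
  moreover have "single_valued (wits (\<Union>\<C>))"
  proof (rule single_valuedI)
    fix t w w' assume "(t, w) \<in> wits (\<Union>\<C>)" "(t, w') \<in> wits (\<Union>\<C>)"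
    then obtain s s' where "s \<in> \<C>" "s' \<in> \<C>" "(t, w) \<in> wits s" "(t, w') \<in> wits s'" using W by blast
    then have "\<exists>s\<in>\<C>. (t, w) \<in> wits s \<and> (t, w') \<in> wits s"
      using comp[of s s'] by (auto simp: wits_def)
    then show "w = w'" using goodD(5)[OF good] by (auto dest: single_valuedD)
  qed
  moreover have "wit ?R Fs Gs d zs zs'" if "((Fs, Gs, d), (zs, zs')) \<in> wits (\<Union>\<C>)" for Fs Gs d zs zs'
  proof -
    have "\<exists>s\<in>\<C>. ((Fs, Gs, d), (zs, zs')) \<in> wits s" using that W by blast
    then obtain s where s: "s \<in> \<C>" "((Fs, Gs, d), (zs, zs')) \<in> wits s" by blast
    have w: "wit (ord s) Fs Gs d zs zs'" using good[OF s(1)] s(2) by (rule goodD)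
    have fld: "Field (ord s) \<subseteq> Field ?R" using sub[OF s(1)] by (rule mono_Field)
    note z = witD(12,13)[OF w]
    have "\<not> separates ?R x (zs ! i) (zs' ! i)"
      if i: "i < ar d" and x: "x \<in> Field ?R - (set zs \<union> set zs' - set Fs)" for i x
    proof -
      obtain t where t: "t \<in> \<C>" "x \<in> Field (ord t)" using x FR by blast
      \<comment> \<open>The element \<open>x\<close> may appear later than the witness; a common
        larger state contains both, and there nonseparation is a clause of
        \<open>good\<close>.\<close>
      have "\<exists>u\<in>\<C>. s \<subseteq> u \<and> x \<in> Field (ord u)"
        using comp[OF s(1) t(1)] s(1) t mono_Field[OF ord_mono[of t s]] by blast
      then obtain u where u: "u \<in> \<C>" "s \<subseteq> u" "x \<in> Field (ord u)" by blast
      have "((Fs, Gs, d), (zs, zs')) \<in> wits u" using s(2) u(2) by (auto simp: wits_def)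
      with good[OF u(1)] have "wit (ord u) Fs Gs d zs zs'" by (rule goodD)
      then have "\<not> separates (ord u) x (zs ! i) (zs' ! i)" using i x u(3) by (intro witD(8)) auto
      moreover have "zs ! i \<in> Field (ord u)" "zs' ! i \<in> Field (ord u)"
        using z[OF i] mono_Field[OF ord_mono[OF u(2)]] by blast+
      ultimately show ?thesis using restr[OF u(1)] u(3) by (simp add: separates_def)
    qed
    moreover have "(zs ! i, zs ! j) \<in> ?R \<longleftrightarrow> (zs' ! i, zs' ! j) \<in> ?R" if "i < ar d" "j < ar d" for i j
      using witD(9)[OF w that] z[OF that(1)] z[OF that(2)] restr[OF s(1)] by simp
    moreover have "set Fs \<union> set Gs \<union> set zs \<union> set zs' \<subseteq> Field ?R"
      using witD(2-5)[OF w] fld by blast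
    ultimately show ?thesis using witD(1,6,7,10,11)[OF w] by (simp add: wit_def)
  qed
  moreover have "Field ?R \<subseteq> Y" if "A \<subseteq> Y" "closed_under (wits (\<Union>\<C>)) Y" for Y
  proof -
    \<comment> \<open>A set closed under all recorded witnesses is closed under those of each single
      state, so generation from \<open>A\<close> passes to the union.\<close>
    have "closed_under (wits s) Y" if "s \<in> \<C>" for s
      using \<open>closed_under (wits (\<Union>\<C>)) Y\<close> by (rule closed_under_subset) (use that W in blast)
    then show ?thesis using goodD(7)[OF good \<open>A \<subseteq> Y\<close>] unfolding FR by blast
  qed
  ultimately show ?thesis using linR by (simp add: good_def)
qed

lemma maximal_good_state: "\<exists>s. good s \<and> (\<forall>t. good t \<longrightarrow> s \<subseteq> t \<longrightarrow> t = s)"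
proof -
  have "\<exists>s\<in>{s. good s}. \<forall>t\<in>{s. good s}. s \<subseteq> t \<longrightarrow> t = s"
    by (rule subset_Zorn_nonempty) (use good_initial good_Union in auto)
  then show ?thesis by auto
qed

text \<open>The closure of \<open>A\<close> under the recorded witnesses is reached in countably
  many steps. One step adds finitely many elements for each task over the current set, and there are
  at most \<open>|B|\<close> tasks, as they consist of two finite lists and an element of
  \<open>D\<close>.\<close>

lemma good_card:
  assumes s: "good s" and B: "infinite B" "|A| \<le>o |B|" "|D| \<le>o |B|"
  shows "|Field (ord s)| \<le>o |B|"
proof -
  define step where "step = (\<lambda>Y. Y \<union> \<Union> {set zs \<union> set zs' | Fs Gs d zs zs'.
     ((Fs, Gs, d), (zs, zs')) \<in> wits s \<and> set Fs \<subseteq> Y \<and> set Gs \<subseteq> Y})"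
  define Y where "Y = (\<lambda>n. (step ^^ n) A)"
  have Y_Suc: "Y (Suc n) = step (Y n)" for n by (simp add: Y_def)
  have mono: "m \<le> n \<Longrightarrow> Y m \<subseteq> Y n" for m n
    by (rule lift_Suc_mono_le) (auto simp: Y_Suc step_def)
  have "|Y n| \<le>o |B|" for n
  proof (induction n)
    case 0
    then show ?case using B by (simp add: Y_def)
  next
    case (Suc n)
    let ?T = "lists (Y n) \<times> lists (Y n) \<times> D"
    let ?f = "\<lambda>t. \<Union> {set zs \<union> set zs' | zs zs'. (t, (zs, zs')) \<in> wits s}"
    have T: "|?T| \<le>o |B|"
      using card_of_lists[OF B(1) Suc] B by (intro card_of_Times_bounded)
    \<comment> \<open>A task has at most one answer, because the choice of witnesses is
      single-valued.\<close>
    have f: "|?f t| \<le>o |B|" for t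
    proof -
      have "finite (?f t)"
      proof (cases "\<exists>zs zs'. (t, (zs, zs')) \<in> wits s")
        case True
        then obtain zs zs' where w: "(t, (zs, zs')) \<in> wits s" by blast
        have "?f t \<subseteq> set zs \<union> set zs'"
        proof
          fix x assume "x \<in> ?f t"
          then obtain us us' where "(t, (us, us')) \<in> wits s" "x \<in> set us \<union> set us'" by blast
          moreover have "(us, us') = (zs, zs')"
            using goodD(5)[OF s] \<open>(t, (us, us')) \<in> wits s\<close> w by (rule single_valuedD)
          ultimately show "x \<in> set zs \<union> set zs'" by simp
        qed
        then show ?thesis by (rule finite_subset) simp
      qed simp
      then show ?thesis using B(1)
        by (intro ordLess_imp_ordLeq finite_ordLess_infinite card_of_Well_order) (simp_all add: Field_card_of)
    qed
    have U: "|\<Union>t\<in>?T. ?f t| \<le>o |B|"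
      by (rule card_of_UNION_ordLeq_infinite) (use B(1) T f in auto)
    have "step (Y n) \<subseteq> Y n \<union> (\<Union>t\<in>?T. ?f t)"
    proof
      fix x assume "x \<in> step (Y n)"
      then consider "x \<in> Y n"
        | Fs Gs d zs zs' where "((Fs, Gs, d), (zs, zs')) \<in> wits s" "set Fs \<subseteq> Y n" "set Gs \<subseteq> Y n"
            "x \<in> set zs \<union> set zs'"
        unfolding step_def by blast
      then show "x \<in> Y n \<union> (\<Union>t\<in>?T. ?f t)"
      proof cases
        case 2
        have "d \<in> D" using goodD(6)[OF s 2(1)] by (rule witD)
        then have "(Fs, Gs, d) \<in> ?T" using 2 by auto
        moreover have "x \<in> ?f (Fs, Gs, d)" using 2 by blast
        ultimately show ?thesis by blast
      qed simp
    qed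
    then have "|Y (Suc n)| \<le>o |Y n \<union> (\<Union>t\<in>?T. ?f t)|" unfolding Y_Suc by (rule card_of_mono1)
    also have "|Y n \<union> (\<Union>t\<in>?T. ?f t)| \<le>o |B|"
      using B(1) Suc U
      by (intro card_of_Un_ordLeq_infinite_Field card_of_Card_order) (simp_all only: Field_card_of simp_thms)
    finally show ?case .
  qed
  then have card: "|\<Union>n. Y n| \<le>o |B|"
    using B(1) infinite_iff_card_of_nat by (intro card_of_UNION_ordLeq_infinite) auto
  have "A \<subseteq> (\<Union>n. Y n)" using UN_upper[of 0 UNIV Y] by (simp add: Y_def)
  moreover have "closed_under (wits s) (\<Union>n. Y n)"
    unfolding closed_under_def
  proof (intro allI impI)
    fix Fs Gs d zs zs'
    assume w: "((Fs, Gs, d), (zs, zs')) \<in> wits s" "set Fs \<subseteq> (\<Union>n. Y n)" "set Gs \<subseteq> (\<Union>n. Y n)"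
    have "\<exists>n. V \<subseteq> Y n" if "finite V" "V \<subseteq> (\<Union>n. Y n)" for V
      using that
    proof (induction V)
      case (insert x V)
      then obtain m n where "V \<subseteq> Y m" "x \<in> Y n" by blast
      then have "insert x V \<subseteq> Y (max m n)" using mono[of m "max m n"] mono[of n "max m n"] by auto
      then show ?case ..
    qed simp
    from this[of "set Fs \<union> set Gs"] obtain n where "set Fs \<subseteq> Y n" "set Gs \<subseteq> Y n"
      using w(2,3) by auto
    then have "set zs \<union> set zs' \<subseteq> Y (Suc n)" unfolding Y_Suc step_def using w(1) by blast
    then show "set zs \<union> set zs' \<subseteq> (\<Union>n. Y n)" by blast
  qed
  ultimately have "Field (ord s) \<subseteq> (\<Union>n. Y n)" using goodD(7)[OF s] by blast
  then show ?thesis using card card_of_mono1 ordLeq_transitive by blast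
qed

text \<open>A task answered in \<open>s\<close> has its witness there. An unanswered one could be
  answered by the given pair, with \<open>r\<close> as the new order; this would be a strictly
  larger good state. The premise \<open>sep\<close> keeps the earlier witnesses valid in
  \<open>r\<close>.\<close>

lemma maximal_state_witness:
  assumes s: "good s" and max: "\<And>t. good t \<Longrightarrow> s \<subseteq> t \<Longrightarrow> t = s"
    and FG: "set Fs \<union> set Gs \<subseteq> Field (ord s)"
    and r: "linear_order_on (Field r) r" "indisc (Field r) r" "ord s \<subseteq> r" "Field r \<subseteq> C"
      "Field r = Field (ord s) \<union> set zs \<union> set zs'"
    and sep: "\<And>y y' Z. y \<in> Field (ord s) \<Longrightarrow> y' \<in> Field (ord s) \<Longrightarrow> finite Z \<Longrightarrow>
                \<forall>x\<in>Field (ord s) - Z. \<not> separates (ord s) x y y' \<Longrightarrow>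
                \<forall>x\<in>Field r - Z. \<not> separates r x y y'"
    and w: "wit r Fs Gs d zs zs'"
  shows "\<exists>zs zs'. wit (ord s) Fs Gs d zs zs'"
proof (cases "(Fs, Gs, d) \<in> Domain (wits s)")
  case True
  then obtain zs zs' where "((Fs, Gs, d), (zs, zs')) \<in> wits s" by auto
  then show ?thesis using goodD(6)[OF s] by blast
next
  case False
  define t where "t = Inl ` r \<union> Inr ` insert ((Fs, Gs, d), (zs, zs')) (wits s)"
  have t: "ord t = r" "wits t = insert ((Fs, Gs, d), (zs, zs')) (wits s)"
    by (auto simp: t_def ord_def wits_def)
  have "wit r Fs' Gs' d' us us'" if "((Fs', Gs', d'), (us, us')) \<in> wits s" for Fs' Gs' d' us us'
  proof -
    have wu: "wit (ord s) Fs' Gs' d' us us'" using s that by (rule goodD)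
    note u = witD(12,13)[OF wu]
    have "\<forall>x\<in>Field r - (set us \<union> set us' - set Fs'). \<not> separates r x (us ! i) (us' ! i)"
      if "i < ar d'" for i
          proof (rule sep[OF u[OF that]])
      show "\<forall>x\<in>Field (ord s) - (set us \<union> set us' - set Fs'). \<not> separates (ord s) x (us ! i) (us' ! i)"
        using witD(8)[OF wu that] by blast
    qed simp
    moreover have "(us ! i, us ! j) \<in> r \<longleftrightarrow> (us' ! i, us' ! j) \<in> r" if "i < ar d'" "j < ar d'" for i j
      using witD(9)[OF wu that] u[OF that(1)] u[OF that(2)] good_restrict[OF s r(1,3)] by simp
    moreover have "set Fs' \<union> set Gs' \<union> set us \<union> set us' \<subseteq> Field r"
      using witD(2-5)[OF wu] r(5) by blast
    ultimately show ?thesis using witD(1,6,7,10,11)[OF wu] by (simp add: wit_def)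
  qed
  moreover have "single_valued (wits t)"
    using goodD(5)[OF s] False unfolding t single_valued_def by blast
  moreover have "Field r \<subseteq> Y" if "A \<subseteq> Y" "closed_under (wits t) Y" for Y
  proof -
    have "closed_under (wits s) Y" using that(2) by (rule closed_under_subset) (auto simp: t)
    then have Y: "Field (ord s) \<subseteq> Y" using goodD(7)[OF s that(1)] by blast
    \<comment> \<open>The data of the new task lie in the old sequence, hence in \<open>Y\<close>,
      so closure of \<open>Y\<close> applies to its answer and the extended sequence is still
      generated from \<open>A\<close>.\<close>
    have "set Fs \<subseteq> Y" "set Gs \<subseteq> Y" using FG Y by auto
    moreover have "((Fs, Gs, d), (zs, zs')) \<in> wits t" by (simp add: t)
    ultimately have "set zs \<union> set zs' \<subseteq> Y" using that(2) unfolding closed_under_def by meson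
    then show ?thesis using r(5) Y by blast
  qed
  moreover have "r0 \<subseteq> r" using goodD(3)[OF s] r(3) by blast
  ultimately have "good t"
    unfolding good_def t(1) using r w t(2) by auto
  moreover have "s \<subseteq> t"
  proof
    fix e assume "e \<in> s"
    then show "e \<in> t" using r(3) by (cases e) (auto simp: t_def ord_def wits_def)
  qed
  ultimately have "t = s" by (rule max)
  then show ?thesis using False t(2) by auto
qed

end

section \<open>Alternating witnesses\<close>

lemma sorted_list_exists:
  assumes lin: "linear_order_on X r" and "finite V" "V \<subseteq> X"
  shows "\<exists>as. set as = V \<and> sorted_wrt (\<lambda>x y. (x, y) \<in> r - Id) as"
  using assms(2,3)
proof (induction V)
  case (insert x V)
  have "V \<subseteq> X" using insert.prems by simp
  from insert.IH[OF this] obtain as where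
    as: "set as = V" "sorted_wrt (\<lambda>x y. (x, y) \<in> r - Id) as" by blast
  let ?l = "filter (\<lambda>y. (y, x) \<in> r) as" and ?u = "filter (\<lambda>y. (y, x) \<notin> r) as"
  have u: "\<forall>y\<in>set ?u. (x, y) \<in> r - Id"
  proof
    fix y assume "y \<in> set ?u"
    then have y: "y \<in> V" "(y, x) \<notin> r" using as(1) by simp_all
    then have "x \<noteq> y" using insert.hyps by blast
    moreover have "x \<in> X" "y \<in> X" using insert.prems y(1) by blast+
    ultimately show "(x, y) \<in> r - Id" using linear_orderD(5)[OF lin, of x y] y(2) by simp
  qed
  have l: "\<forall>y\<in>set ?l. (y, x) \<in> r - Id"
  proof
    fix y assume "y \<in> set ?l"
    then have "y \<in> V" "(y, x) \<in> r" using as(1) by simp_all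
    moreover have "y \<noteq> x" using insert.hyps calculation(1) by blast
    ultimately show "(y, x) \<in> r - Id" by simp
  qed
  have lu: "\<forall>y\<in>set ?l. \<forall>z\<in>set ?u. (y, z) \<in> r - Id"
  proof (intro ballI)
    fix y z assume yz: "y \<in> set ?l" "z \<in> set ?u"
    have "(y, x) \<in> r" "(x, z) \<in> r" using l u yz by blast+
    then have "(y, z) \<in> r" by (rule linear_orderD(3)[OF lin])
    moreover have "y \<noteq> z" using yz by auto
    ultimately show "(y, z) \<in> r - Id" by simp
  qed
  have "sorted_wrt (\<lambda>x y. (x, y) \<in> r - Id) ?l" "sorted_wrt (\<lambda>x y. (x, y) \<in> r - Id) ?u"
    using sorted_wrt_filter[OF as(2)] by blast+
  then have "sorted_wrt (\<lambda>x y. (x, y) \<in> r - Id) (?l @ x # ?u)"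
    unfolding sorted_wrt_append sorted_wrt.simps list.set(2) using u l lu by blast
  moreover have "set (?l @ x # ?u) = insert x V" unfolding as(1)[symmetric] by auto
  ultimately show ?case by blast
qed simp

text \<open>Indiscernibility, stated for strictly increasing lists, carries over to arbitrary lists
  of equal order type: both lists arise from increasing ones, \<open>as\<close> and
  \<open>bs\<close>, by one and the same selection \<pi> of positions.\<close>

lemma (in predicate_system) indisc_same_order:
  assumes lin: "linear_order_on X r" and ind: "indisc X r" and p: "Fm m p"
    and len: "length us = m" "length vs = m" and X: "set us \<subseteq> X" "set vs \<subseteq> X"
    and ord: "\<And>i j. i < m \<Longrightarrow> j < m \<Longrightarrow> (us ! i, us ! j) \<in> r \<longleftrightarrow> (vs ! i, vs ! j) \<in> r"
  shows "p us \<longleftrightarrow> p vs"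
proof -
  obtain as where as: "set as = set us" "sorted_wrt (\<lambda>x y. (x, y) \<in> r - Id) as"
    using sorted_list_exists[OF lin, of "set us"] X(1) by auto
  define k where "k = length as"
  have "\<forall>i<m. \<exists>j<k. as ! j = us ! i"
  proof (intro allI impI)
    fix i assume "i < m"
    then have "us ! i \<in> set as" using as(1) len(1) by simp
    then show "\<exists>j<k. as ! j = us ! i" unfolding k_def in_set_conv_nth .
  qed
  then obtain pos where pos: "\<And>i. i < m \<Longrightarrow> pos i < k \<and> as ! pos i = us ! i" by metis
  have "\<forall>j<k. \<exists>i<m. us ! i = as ! j"
  proof (intro allI impI)
    fix j assume "j < k"
    then have "as ! j \<in> set us" unfolding as(1)[symmetric] k_def by simp
    then show "\<exists>i<m. us ! i = as ! j" unfolding in_set_conv_nth len(1) .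
  qed
  then obtain idx where idx: "\<And>j. j < k \<Longrightarrow> idx j < m \<and> us ! idx j = as ! j" by metis
  \<comment> \<open>For every term of \<open>as\<close> one position is chosen where it occurs in
    \<open>us\<close>, and \<open>bs\<close> takes the entry of \<open>vs\<close> there.\<close>
  define bs where "bs = map (\<lambda>j. vs ! idx j) [0..<k]"
  define \<pi> where "\<pi> = map pos [0..<m]"
  have vsX: "vs ! i \<in> X" if "i < m" for i using that len(2) X(2) nth_mem[of i vs] by blast
  \<comment> \<open>Repetitions in \<open>us\<close> are visible in the reflexive order, so they
    recur in \<open>vs\<close>; this makes the chosen positions immaterial.\<close>
  have eq: "vs ! i = vs ! j" if "i < m" "j < m" "us ! i = us ! j" for i j
  proof -
    have "(us ! i, us ! i) \<in> r" using linear_orderD(2)[OF lin] that(1) len(1) X(1) nth_mem[of i us] by blast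
    then have "(us ! i, us ! j) \<in> r" "(us ! j, us ! i) \<in> r" using that(3) by simp_all
    then have "(vs ! i, vs ! j) \<in> r" "(vs ! j, vs ! i) \<in> r" using ord that(1,2) by simp_all
    then show ?thesis by (rule linear_orderD(4)[OF lin])
  qed
  have "sorted_wrt (\<lambda>x y. (x, y) \<in> r - Id) bs"
    unfolding sorted_wrt_iff_nth_less
  proof (intro allI impI)
    fix i j assume ij: "i < j" "j < length bs"
    then have k: "i < k" "j < k" by (simp_all add: bs_def)
    have less: "(as ! i, as ! j) \<in> r - Id"
      using as(2) ij(1) k(2) unfolding sorted_wrt_iff_nth_less k_def by blast
    then have "(as ! j, as ! i) \<notin> r" using linear_orderD(4)[OF lin, of "as ! i" "as ! j"] by auto
    then have "(vs ! idx j, vs ! idx i) \<notin> r" "(vs ! idx i, vs ! idx j) \<in> r"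
      using less idx[OF k(1)] idx[OF k(2)] ord[of "idx j" "idx i"] ord[of "idx i" "idx j"] by simp_all
    then show "(bs ! i, bs ! j) \<in> r - Id" using k by (auto simp: bs_def)
  qed
  moreover have "set bs \<subseteq> X"
  proof
    fix x assume "x \<in> set bs"
    then obtain j where "j < k" "x = vs ! idx j" by (auto simp: bs_def)
    then show "x \<in> X" using idx vsX by blast
  qed
  moreover have "Fm k (\<lambda>ws. p (map ((!) ws) \<pi>))"
    using p by (rule reindex) (use pos in \<open>simp_all add: \<pi>_def\<close>)
  ultimately have "p (map ((!) as) \<pi>) = p (map ((!) bs) \<pi>)"
    using as X(1)
    by (intro ind[unfolded indisc_def, rule_format])
      (simp_all only: k_def bs_def length_map length_upt minus_nat.diff_0)
  moreover have "map ((!) as) \<pi> = us"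
    using pos len(1) by (intro nth_equalityI) (simp_all add: \<pi>_def)
  moreover have "map ((!) bs) \<pi> = vs"
  proof (rule nth_equalityI)
    fix i assume "i < length (map ((!) bs) \<pi>)"
    then have i: "i < m" by (simp add: \<pi>_def)
    have "vs ! idx (pos i) = vs ! i"
      using pos[OF i] idx[of "pos i"] i by (intro eq) simp_all
    then show "map ((!) bs) \<pi> ! i = vs ! i" using i pos[OF i] by (simp add: \<pi>_def bs_def)
  qed (simp add: \<pi>_def len)
  ultimately show ?thesis by simp
qed

lemma nth_concat_uniform:
  assumes "\<forall>w\<in>set ws. length w = l" "j < length ws" "i < l"
  shows "concat ws ! (j * l + i) = ws ! j ! i"
  using arg_cong[OF nth_block[OF assms(1,2)], of "\<lambda>x. x ! i"] assms(3) by simp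

context witness_system
begin

lemma wit_swap: "wit r Fs Gs d zs zs' \<Longrightarrow> wit r Fs Gs d zs' zs"
  unfolding wit_def separates_def by (auto simp: Un_commute)

text \<open>Each witness is requested relative to a finite set containing all entries of the
  previous ones. Exchanging the two tuples of one witness then changes no order relation with the
  others, so all choices \<open>f\<close> give the same order type.\<close>

lemma alternating_witnesses:
  assumes lin: "linear_order_on (Field r) r" and ind: "indisc (Field r) r"
    and Gs: "set Gs \<subseteq> Field r"
    and wits: "\<And>Fs. set Fs \<subseteq> Field r \<Longrightarrow> set Gs \<subseteq> set Fs \<Longrightarrow> \<exists>zs zs'. wit r Fs Gs d zs zs'"
  shows "\<exists>w :: nat \<Rightarrow> bool \<Rightarrow> 'b list.
     (\<forall>k b. length (w k b) = ar d \<and> set (w k b) \<subseteq> Field r \<and> (Q d (w k b) \<longleftrightarrow> b)) \<and>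
     (\<forall>m p f g. Fm (m * ar d) p \<longrightarrow>
        p (concat (map (\<lambda>k. w k (f k)) [0..<m])) = p (concat (map (\<lambda>k. w k (g k)) [0..<m])))"
proof -
  let ?n = "ar d"
  have "\<exists>v. wit r Fs Gs d (v True) (v False) \<and> Q d (v True)"
    if Fs: "set Fs \<subseteq> Field r" "set Gs \<subseteq> set Fs" for Fs
  proof -
    obtain zs zs' where w: "wit r Fs Gs d zs zs'" using wits[OF Fs] by blast
    show ?thesis
    proof (cases "Q d zs")
      case True
      then show ?thesis using w by (intro exI[of _ "\<lambda>b. if b then zs else zs'"]) simp
    next
      case False
      then have "Q d zs'" using witD(11)[OF w] by simp
      then show ?thesis using wit_swap[OF w] by (intro exI[of _ "\<lambda>b. if b then zs' else zs"]) simp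
    qed
  qed
  then obtain v where v: "\<And>Fs. set Fs \<subseteq> Field r \<Longrightarrow> set Gs \<subseteq> set Fs \<Longrightarrow>
      wit r Fs Gs d (v Fs True) (v Fs False) \<and> Q d (v Fs True)" by metis
  \<comment> \<open>The recursion starts at \<open>Gs\<close>, so that tolerated entries always
    belong to the set to be avoided and are never exempt from the ban on separation.\<close>
  define F where "F = rec_nat Gs (\<lambda>_ Fs. Fs @ v Fs True @ v Fs False)"
  have F_Suc: "F (Suc k) = F k @ v (F k) True @ v (F k) False" for k by (simp add: F_def)
  have F: "set (F k) \<subseteq> Field r \<and> set Gs \<subseteq> set (F k)" for k
  proof (induction k)
    case 0
    then show ?case using Gs by (simp add: F_def)
  next
    case (Suc k)
    then have "wit r (F k) Gs d (v (F k) True) (v (F k) False)" using v by blast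
    from witD(4,5)[OF this] show ?case using Suc unfolding F_Suc by auto
  qed
  define w where "w = (\<lambda>k. v (F k))"
  have wit: "wit r (F k) Gs d (w k True) (w k False)" "Q d (w k True)" for k
    using v F unfolding w_def by blast+
  define W where "W = (\<lambda>k. set (w k True) \<union> set (w k False))"
  have W: "set (w k b) \<subseteq> W k" for k b by (cases b) (auto simp: W_def)
  have F_mono: "j \<le> k \<Longrightarrow> set (F j) \<subseteq> set (F k)" for j k
    by (rule lift_Suc_mono_le[of "\<lambda>k. set (F k)"]) (auto simp: F_Suc)
  have W_F: "W j \<subseteq> set (F k)" if "j < k" for j k
    using F_mono[of "Suc j" k] that by (auto simp: F_Suc W_def w_def)
  have W_new: "W k \<inter> set (F k) \<subseteq> set Gs" for k
    using witD(10)[OF wit(1)] by (simp add: W_def)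
  \<comment> \<open>Entries of an earlier witness lie in \<open>F k\<close> by construction. An
    entry shared with a later witness \<open>j\<close> lies in \<open>W k\<close>, hence in
    \<open>F j\<close>, hence in \<open>Gs\<close>, which is contained in
    \<open>F k\<close>.\<close>
  have outside: "x \<notin> W k - set (F k)" if "x \<in> W j" "j \<noteq> k" for x j k
  proof (cases "j < k")
    case True
    then show ?thesis using W_F that(1) by blast
  next
    case False
    then have "k < j" using that(2) by simp
    show ?thesis
    proof
      assume x: "x \<in> W k - set (F k)"
      then have "x \<in> set (F j)" using W_F[OF \<open>k < j\<close>] by blast
      then have "x \<in> set Gs" using W_new that(1) by blast
      then show False using x F by blast
    qed
  qed
  have len: "length (w k b) = ?n" for k b
    using witD(6,7)[OF wit(1)[of k]] by (cases b) simp_all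
  have fld: "set (w k b) \<subseteq> Field r" for k b
    using witD(4,5)[OF wit(1)[of k]] by (cases b) simp_all
  have move: "((x, w k b ! i) \<in> r \<longleftrightarrow> (x, w k c ! i) \<in> r) \<and> ((w k b ! i, x) \<in> r \<longleftrightarrow> (w k c ! i, x) \<in> r)"
    if "x \<in> W j" "j \<noteq> k" "i < ?n" for x j k i b c
  proof -
    have "x \<in> Field r" using that(1) fld by (auto simp: W_def)
    then have "\<not> separates r x (w k True ! i) (w k False ! i)"
      using witD(8)[OF wit(1)[of k] that(3)] outside[OF that(1,2)] unfolding W_def by blast
    then show ?thesis unfolding separates_def by (cases b; cases c) simp_all
  qed
  have order: "(w j (f j) ! i, w k (f k) ! l) \<in> r \<longleftrightarrow> (w j (g j) ! i, w k (g k) ! l) \<in> r"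
    if "i < ?n" "l < ?n" for f g j k i l
  proof (cases "j = k")
    case True
    then show ?thesis using witD(9)[OF wit(1)[of k] that] by (cases "f k"; cases "g k") simp_all
  next
    case False
    have W_nth: "w k b ! i \<in> W k" if "i < ?n" for k b i
      using W[of k b] nth_mem[of i "w k b"] len that by auto
    have "w j (f j) ! i \<in> W j" "w k (g k) ! l \<in> W k"
      using W_nth that by simp_all
    \<comment> \<open>For different witnesses the choice is changed in two moves: in witness
      \<open>k\<close> with \<open>f j\<close> fixed, then in witness \<open>j\<close> with
      \<open>g k\<close> fixed.\<close>
    then show ?thesis
      using move[of "w j (f j) ! i" j k l "f k" "g k"] move[of "w k (g k) ! l" k j i "f j" "g j"] False that
      by simp
  qed
  have "p (concat (map (\<lambda>k. w k (f k)) [0..<m])) = p (concat (map (\<lambda>k. w k (g k)) [0..<m]))"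
    if p: "Fm (m * ?n) p" for m p f g
  proof (rule indisc_same_order[OF lin ind p])
    have lens: "\<forall>x\<in>set (map (\<lambda>k. w k (f k)) [0..<m]). length x = ?n" for f using len by auto
    have len_concat: "length (concat (map (\<lambda>k. w k (f k)) [0..<m])) = m * ?n" for f
      using length_concat_uniform[OF lens] by simp
    show "length (concat (map (\<lambda>k. w k (f k)) [0..<m])) = m * ?n"
      "length (concat (map (\<lambda>k. w k (g k)) [0..<m])) = m * ?n"
      by (rule len_concat)+
    show "set (concat (map (\<lambda>k. w k (f k)) [0..<m])) \<subseteq> Field r"
      "set (concat (map (\<lambda>k. w k (g k)) [0..<m])) \<subseteq> Field r"
      using fld by auto
    fix s t assume "s < m * ?n" "t < m * ?n"
    then have n: "0 < ?n" by (cases "?n") auto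
    have s: "s div ?n < m" "s mod ?n < ?n" "s div ?n * ?n + s mod ?n = s"
      using \<open>s < m * ?n\<close> n by (simp_all add: less_mult_imp_div_less)
    have t: "t div ?n < m" "t mod ?n < ?n" "t div ?n * ?n + t mod ?n = t"
      using \<open>t < m * ?n\<close> n by (simp_all add: less_mult_imp_div_less)
    have "concat (map (\<lambda>k. w k (f k)) [0..<m]) ! s = w (s div ?n) (f (s div ?n)) ! (s mod ?n)"
      "concat (map (\<lambda>k. w k (f k)) [0..<m]) ! t = w (t div ?n) (f (t div ?n)) ! (t mod ?n)" for f
      using nth_concat_uniform[OF lens[of f], where j = "s div ?n" and i = "s mod ?n"]
        nth_concat_uniform[OF lens[of f], where j = "t div ?n" and i = "t mod ?n"] s t by simp_all
    then show "(concat (map (\<lambda>k. w k (f k)) [0..<m]) ! s, concat (map (\<lambda>k. w k (f k)) [0..<m]) ! t) \<in> r \<longleftrightarrow>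
        (concat (map (\<lambda>k. w k (g k)) [0..<m]) ! s, concat (map (\<lambda>k. w k (g k)) [0..<m]) ! t) \<in> r"
      using order[OF s(2) t(2)] by simp
  qed
  moreover have "Q d (w k b) \<longleftrightarrow> b" for k b
    using wit(2)[of k] witD(11)[OF wit(1)[of k]] by (cases b) simp_all
  ultimately show ?thesis using len fld by (intro exI[of _ w]) simp
qed

end

section \<open>Limits of tuples in a saturated pair\<close>

text \<open>A finer filter has more eventual properties, so Zorn's lemma is applied to the sets
  \<open>E U\<close>, and a chain is bounded by the infimum of its filters. If a maximal
  \<open>U\<close> does not contain \<open>P\<close>, adjoining the complement of \<open>P\<close>
  gives a proper filter, which must be \<open>U\<close>.\<close>

lemma ultrafilter_exists:
  assumes "F \<noteq> bot"
  shows "\<exists>U. ultrafilter U \<and> U \<le> F"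
proof -
  define E where "E = (\<lambda>U :: 'a filter. {P. eventually P U})"
  have E_le: "E V \<subseteq> E U \<longleftrightarrow> U \<le> V" for U V by (auto simp: E_def le_filter_def)
  define \<A> where "\<A> = {U. U \<noteq> bot \<and> U \<le> F}"
  have "\<exists>m\<in>E ` \<A>. \<forall>x\<in>E ` \<A>. m \<subseteq> x \<longrightarrow> x = m"
  proof (rule subset_Zorn_nonempty)
    show "E ` \<A> \<noteq> {}" using assms by (auto simp: \<A>_def)
    fix \<C> assume ne: "\<C> \<noteq> {}" and chain: "subset.chain (E ` \<A>) \<C>"
    define B where "B = {U \<in> \<A>. E U \<in> \<C>}"
    have C: "\<C> = E ` B"
    proof
      show "\<C> \<subseteq> E ` B"
      proof
        fix x assume x: "x \<in> \<C>"
        then have "x \<in> E ` \<A>" using chain unfolding subset.chain_def by blast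
        then show "x \<in> E ` B" using x unfolding B_def by blast
      qed
    qed (unfold B_def, blast)
    have B_ne: "B \<noteq> {}" using ne unfolding C by simp
    have ev: "eventually P (Inf B) \<longleftrightarrow> (\<exists>U\<in>B. eventually P U)" for P
    proof (rule eventually_Inf_base[OF B_ne])
      fix U V assume "U \<in> B" "V \<in> B"
      then have "E U \<subseteq> E V \<or> E V \<subseteq> E U"
        using subset.chain_total[OF chain, of "E U" "E V"] unfolding B_def by blast
      then have "V \<le> U \<or> U \<le> V" unfolding E_le .
      then show "\<exists>x\<in>B. x \<le> inf U V"
      proof
        assume "V \<le> U" then show ?thesis using \<open>V \<in> B\<close> by (intro bexI[of _ V]) simp_all
      next
        assume "U \<le> V" then show ?thesis using \<open>U \<in> B\<close> by (intro bexI[of _ U]) simp_all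
      qed
    qed
    have "\<Union>\<C> = E (Inf B)" unfolding C by (simp add: E_def ev set_eq_iff)
    moreover have "Inf B \<noteq> bot"
    proof
      assume "Inf B = bot"
      then have "eventually (\<lambda>_. False) (Inf B)" by simp
      then obtain U where "U \<in> B" "eventually (\<lambda>_. False) U" using ev by blast
      then show False by (simp add: B_def \<A>_def eventually_False)
    qed
    moreover have "Inf B \<le> F"
    proof -
      obtain U where "U \<in> B" using B_ne by blast
      then have "Inf B \<le> U" by (rule Inf_lower)
      also have "U \<le> F" using \<open>U \<in> B\<close> by (simp add: B_def \<A>_def)
      finally show ?thesis .
    qed
    ultimately show "\<Union>\<C> \<in> E ` \<A>" by (simp add: \<A>_def)
  qed
  then obtain U where "U \<in> \<A>" and max: "\<forall>x\<in>E ` \<A>. E U \<subseteq> x \<longrightarrow> x = E U" by blast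
  have U: "U \<noteq> bot" "U \<le> F" using \<open>U \<in> \<A>\<close> by (simp_all add: \<A>_def)
  have "eventually (\<lambda>x. \<not> P x) U" if "\<not> eventually P U" for P
  proof -
    let ?V = "inf U (principal {x. \<not> P x})"
    have "?V \<noteq> bot"
    proof
      assume "?V = bot"
      then have "eventually (\<lambda>_. False) ?V" by simp
      then show False using that by (simp add: eventually_inf_principal)
    qed
    moreover have "?V \<le> F" using U(2) by (rule le_infI1)
    ultimately have "E ?V \<in> E ` \<A>" by (simp add: \<A>_def)
    moreover have "E U \<subseteq> E ?V" unfolding E_le by (rule inf_le1)
    ultimately have "E ?V = E U" using max by blast
    moreover have "(\<lambda>x. \<not> P x) \<in> E ?V" by (simp add: E_def eventually_inf_principal)
    ultimately show ?thesis by (simp add: E_def)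
  qed
  then show ?thesis using U unfolding ultrafilter_def by blast
qed

lemma tuples_mono: "(\<And>s. X s \<subseteq> Y s) \<Longrightarrow> tuples X \<sigma> \<subseteq> tuples Y \<sigma>"
  unfolding tuples_iff subset_iff by blast

lemma length_tuples: "a \<in> tuples X \<sigma> \<Longrightarrow> length a = length \<sigma>"
  by (simp add: tuples_iff)

text \<open>The formulas over \<open>B\<close> that hold along \<open>U\<close> form a type,
  complete because \<open>U\<close> is an ultrafilter and finitely realised by the tuples
  themselves. Working over the pair language puts the realisation into \<open>M'\<close>.\<close>

lemma saturated_limit:
  assumes sat: "saturated \<kappa> (pair_language L) (pair_struct K M')"
    and M': "\<And>s. M' s \<subseteq> univ K s" and B: "\<And>s. B s \<subseteq> univ K s" "card_fam B <o \<kappa>"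
    and U: "ultrafilter U" and ev: "eventually (\<lambda>ts. length ts = n \<and> set ts \<subseteq> tuples M' \<sigma>) U"
  shows "\<exists>ss. length ss = n \<and> set ss \<subseteq> tuples M' \<sigma> \<and>
           (\<forall>\<tau> \<phi> c. \<phi> \<in> formulas L (concat (replicate n \<sigma>) @ \<tau>) \<longrightarrow> c \<in> tuples B \<tau> \<longrightarrow>
              (holds_at K \<phi> (concat ss @ c) \<longleftrightarrow> eventually (\<lambda>ts. holds_at K \<phi> (concat ts @ c)) U))"
proof -
  define \<rho> where "\<rho> = concat (replicate n \<sigma>)"
  let ?L = "param_language (pair_language L) B" and ?K = "param_struct (pair_struct K M')"
  define q where "q = {\<phi> \<in> formulas ?L \<rho>. eventually (\<lambda>ts. holds_at ?K \<phi> (concat ts)) U}"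
  have in_M': "concat ts \<in> tuples M' \<rho>" if "length ts = n \<and> set ts \<subseteq> tuples M' \<sigma>" for ts
    using that concat_in_tuples[of ts M' \<sigma>] by (simp add: \<rho>_def)
  have not_bot: "U \<noteq> bot" using U by (simp add: ultrafilter_def)
  have q_Neg: "Neg \<phi> \<in> q \<longleftrightarrow> \<phi> \<notin> q" if "\<phi> \<in> formulas ?L \<rho>" for \<phi>
    using that ultrafilter_not[OF U, of "\<lambda>ts. holds_at ?K \<phi> (concat ts)"]
    by (simp add: q_def formulas_def holds_at_def)
  have "finitely_realised (pair_struct K M') (tuples (univ (pair_struct K M')) \<rho>) q"
    unfolding finitely_realised_def
  proof (intro allI impI)
    fix F assume F: "F \<subseteq> q" "finite F"
    have "eventually (\<lambda>ts. \<forall>\<phi>\<in>F. holds_at ?K \<phi> (concat ts)) U"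
      using F unfolding q_def by (intro eventually_ball_finite) blast+
    then have "eventually (\<lambda>ts. (\<forall>\<phi>\<in>F. holds_at ?K \<phi> (concat ts)) \<and> concat ts \<in> tuples M' \<rho>) U"
      using ev by eventually_elim (use in_M' in blast)
    then obtain ts where "\<forall>\<phi>\<in>F. holds_at ?K \<phi> (concat ts)" "concat ts \<in> tuples M' \<rho>"
      using eventually_happens'[OF not_bot] by blast
    then show "\<exists>a\<in>tuples (univ (pair_struct K M')) \<rho>. realises (pair_struct K M') a F"
      using subsetD[OF tuples_mono[of M' "univ K"]] M' unfolding realises_def pair_univ by blast
  qed
  then have "complete_type (pair_language L) (pair_struct K M') B \<rho> q"
    using q_Neg unfolding complete_type_def by (simp add: q_def)
  then obtain a where a: "a \<in> tuples (univ K) \<rho>" "realises (pair_struct K M') a q"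
    using sat B unfolding saturated_def pair_univ by blast
  have holds: "holds_at ?K \<phi> a \<longleftrightarrow> \<phi> \<in> q" if "\<phi> \<in> formulas ?L \<rho>" for \<phi>
  proof
    assume *: "holds_at ?K \<phi> a"
    show "\<phi> \<in> q"
    proof (rule ccontr)
      assume "\<phi> \<notin> q"
      then have "Neg \<phi> \<in> q" using q_Neg that by simp
      then have "holds_at ?K (Neg \<phi>) a" using a(2) by (simp add: realises_def)
      then show False using * by (simp add: holds_at_def)
    qed
  qed (use a(2) in \<open>simp add: realises_def\<close>)
  have "a ! j \<in> M' (\<rho> ! j)" if j: "j < length \<rho>" for j
  proof -
    \<comment> \<open>The predicate \<open>P\<close> holds of each coordinate along
      \<open>U\<close>, so it belongs to \<open>q\<close> and hence holds of the
      realisation.\<close>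
    let ?P = "Rel (Inr (\<rho> ! j)) [Var (\<rho> ! j, j)]"
    have P: "holds_at ?K ?P b \<longleftrightarrow> b ! j \<in> M' (\<rho> ! j)" for b
      by (simp add: holds_at_def param_struct_def pair_struct_def)
    have form: "?P \<in> formulas ?L \<rho>"
      using j has_sort.intros(1)[of ?L "(\<rho> ! j, j)"]
      by (auto simp: formulas_def param_language_def pair_language_def)
    moreover have "eventually (\<lambda>ts. holds_at ?K ?P (concat ts)) U"
      unfolding P using ev by eventually_elim (use in_M' j in \<open>auto simp: tuples_iff\<close>)
    ultimately have "?P \<in> q" unfolding q_def by blast
    then show ?thesis using holds[OF form] unfolding P by blast
  qed
  then have "a \<in> tuples M' \<rho>" using a(1) by (simp add: tuples_iff)
  then obtain ss where ss: "length ss = n" "set ss \<subseteq> tuples M' \<sigma>" "a = concat ss"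
    unfolding \<rho>_def using tuples_concat_cases by blast
  have "holds_at K \<phi> (concat ss @ c) \<longleftrightarrow> eventually (\<lambda>ts. holds_at K \<phi> (concat ts @ c)) U"
    if \<phi>: "\<phi> \<in> formulas L (\<rho> @ \<tau>)" "c \<in> tuples B \<tau>" for \<tau> \<phi> c
  proof -
    obtain \<phi>' where \<phi>': "\<phi>' \<in> formulas ?L \<rho>"
      "\<And>b. length b = length \<rho> \<Longrightarrow> holds_at ?K \<phi>' b \<longleftrightarrow> holds_at K \<phi> (b @ c)"
      using pair_param_formula[OF \<phi>, of K M'] by blast
    have "holds_at K \<phi> (concat ss @ c) \<longleftrightarrow> holds_at ?K \<phi>' a"
      using \<phi>'(2)[of a] a(1) by (simp add: ss(3) length_tuples)
    also have "\<dots> \<longleftrightarrow> eventually (\<lambda>ts. holds_at ?K \<phi>' (concat ts)) U"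
      using holds[OF \<phi>'(1)] \<phi>'(1) by (simp add: q_def)
    also have "\<dots> \<longleftrightarrow> eventually (\<lambda>ts. holds_at K \<phi> (concat ts @ c)) U"
    proof -
      have "eventually (\<lambda>ts. holds_at ?K \<phi>' (concat ts) \<longleftrightarrow> holds_at K \<phi> (concat ts @ c)) U"
        using ev by eventually_elim (rule \<phi>'(2)[OF length_tuples[OF in_M']])
      then show ?thesis unfolding ultrafilter_iff[OF U] .
    qed
    finally show ?thesis .
  qed
  then show ?thesis using ss unfolding \<rho>_def by blast
qed

lemma predicate_system_definable: "predicate_system (definable_pred L K \<sigma>)"
  by unfold_locales (rule definable_pred_reindex definable_pred_eq; assumption?)+

lemma indiscernible_iff:
  "indiscernible L K \<sigma> X r \<longleftrightarrow> X \<subseteq> tuples (univ K) \<sigma> \<and> linear_order_on X r \<and>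
     predicate_system.indisc (definable_pred L K \<sigma>) X r"
proof -
  have "predicate_system.indisc (definable_pred L K \<sigma>) X r \<longleftrightarrow>
     (\<forall>n. \<forall>\<phi>\<in>formulas L (concat (replicate n \<sigma>)). \<forall>as bs.
        length as = n \<and> set as \<subseteq> X \<and> sorted_wrt (\<lambda>x y. (x, y) \<in> r - Id) as \<and>
        length bs = n \<and> set bs \<subseteq> X \<and> sorted_wrt (\<lambda>x y. (x, y) \<in> r - Id) bs \<longrightarrow>
        (holds_at K \<phi> (concat as) \<longleftrightarrow> holds_at K \<phi> (concat bs)))" (is "?l \<longleftrightarrow> ?r")
    if X: "X \<subseteq> tuples (univ K) \<sigma>"
  proof
    assume l: ?l
    show ?r
    proof (intro allI ballI impI)
      fix n \<phi> as bs
      assume \<phi>: "\<phi> \<in> formulas L (concat (replicate n \<sigma>))"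
        and *: "length as = n \<and> set as \<subseteq> X \<and> sorted_wrt (\<lambda>x y. (x, y) \<in> r - Id) as \<and>
          length bs = n \<and> set bs \<subseteq> X \<and> sorted_wrt (\<lambda>x y. (x, y) \<in> r - Id) bs"
      have "definable_pred L K \<sigma> n (\<lambda>ws. holds_at K \<phi> (concat ws))"
        using \<phi> unfolding definable_pred_def by blast
      then show "holds_at K \<phi> (concat as) \<longleftrightarrow> holds_at K \<phi> (concat bs)"
        using l * unfolding predicate_system.indisc_def[OF predicate_system_definable] by blast
    qed
  next
    assume r: ?r
    show ?l
      unfolding predicate_system.indisc_def[OF predicate_system_definable]
    proof (intro allI impI)
      fix m p as bs
      assume p: "definable_pred L K \<sigma> m p" and len: "length as = m" "length bs = m"
        and sub: "set as \<subseteq> X" "set bs \<subseteq> X"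
        and srt: "sorted_wrt (\<lambda>x y. (x, y) \<in> r - Id) as" "sorted_wrt (\<lambda>x y. (x, y) \<in> r - Id) bs"
      obtain \<phi> where \<phi>: "\<phi> \<in> formulas L (concat (replicate m \<sigma>))"
        "\<And>ws. length ws = m \<Longrightarrow> \<forall>w\<in>set ws. length w = length \<sigma> \<Longrightarrow> p ws \<longleftrightarrow> holds_at K \<phi> (concat ws)"
        using p unfolding definable_pred_def by blast
      have "\<forall>w\<in>set ws. length w = length \<sigma>" if "set ws \<subseteq> X" for ws
        using that X length_tuples by blast
      then have "p as \<longleftrightarrow> holds_at K \<phi> (concat as)" "p bs \<longleftrightarrow> holds_at K \<phi> (concat bs)"
        using \<phi>(2) len sub by simp_all
      moreover have "holds_at K \<phi> (concat as) \<longleftrightarrow> holds_at K \<phi> (concat bs)"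
        using r \<phi>(1) len sub srt by blast
      ultimately show "p as = p bs" by simp
    qed
  qed
  then show ?thesis unfolding indiscernible_def by blast
qed

section \<open>Indiscernible sequences in a pair\<close>

text \<open>Keeps the cardinal bounds below infinite even for an empty language and a finite
  structure.\<close>

lemma infinite_formulas: "infinite {\<phi>. wf_fm (L :: ('s, 'f, 'r) language) \<phi>}"
proof
  assume fin: "finite {\<phi>. wf_fm L \<phi>}"
  let ?v = "(undefined, 0) :: 's var"
  let ?f = "\<lambda>n. (Neg ^^ n) (Eq (Var ?v) (Var ?v)) :: ('s, 'f, 'r) fm"
  have "wf_fm L (?f n)" for n
    using has_sort.intros(1)[of L ?v] by (induction n) auto
  then have "range ?f \<subseteq> {\<phi>. wf_fm L \<phi>}" by auto
  moreover have "inj ?f"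
  proof (rule injI)
    fix m n assume "?f m = ?f n"
    then have "size (?f m) = size (?f n)" by simp
    moreover have "size (?f k) = k + size (?f 0)" for k by (induction k) simp_all
    ultimately show "m = n" by simp
  qed
  ultimately show False using fin by (meson finite_imageD finite_subset infinite_UNIV_nat)
qed

lemma subset_tuples_coords: "X \<subseteq> tuples Y \<sigma> \<Longrightarrow> X \<subseteq> tuples (coords \<sigma> X) \<sigma>"
  unfolding tuples_iff coords_def subset_iff by blast

text \<open>The elements \<open>xs\<close> of the abstract limit condition turn into parameters from
  \<open>coords \<sigma> X\<close>, so a limit of types over these coordinates suffices.\<close>

lemma limit_tuple_definable:
  assumes X: "X \<subseteq> tuples Y \<sigma>" and lin: "linear_order_on X r"
    and ind: "predicate_system.indisc (definable_pred L K \<sigma>) X r" and U: "ultrafilter U"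
    and ev: "eventually (\<lambda>ts. length ts = n \<and> set ts \<subseteq> X) U"
    and ss: "length ss = n" "set ss \<subseteq> tuples Y \<sigma>"
    and lim: "\<And>\<tau> \<phi> c. \<phi> \<in> formulas L (concat (replicate n \<sigma>) @ \<tau>) \<Longrightarrow> c \<in> tuples (coords \<sigma> X) \<tau> \<Longrightarrow>
      holds_at K \<phi> (concat ss @ c) \<longleftrightarrow> eventually (\<lambda>ts. holds_at K \<phi> (concat ts @ c)) U"
  shows "limit_tuple (definable_pred L K \<sigma>) X r n U ss"
proof (intro limit_tuple.intro predicate_system_definable limit_tuple_axioms.intro lin ind U ev ss(1))
  fix k p xs assume p: "definable_pred L K \<sigma> (n + k) p" and xs: "length xs = k" "set xs \<subseteq> X"
  obtain \<phi> where \<phi>: "\<phi> \<in> formulas L (concat (replicate (n + k) \<sigma>))"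
    "\<And>ws. length ws = n + k \<Longrightarrow> \<forall>w\<in>set ws. length w = length \<sigma> \<Longrightarrow> p ws \<longleftrightarrow> holds_at K \<phi> (concat ws)"
    using p unfolding definable_pred_def by blast
  have len: "\<forall>w\<in>set ws. length w = length \<sigma>" if "set ws \<subseteq> tuples Y \<sigma>" for ws
    using that length_tuples by blast
  have "concat xs \<in> tuples (coords \<sigma> X) (concat (replicate k \<sigma>))"
    using concat_in_tuples[of xs "coords \<sigma> X" \<sigma>] xs subset_tuples_coords[OF X] by auto
  then have lim': "holds_at K \<phi> (concat ss @ concat xs) \<longleftrightarrow>
      eventually (\<lambda>ts. holds_at K \<phi> (concat ts @ concat xs)) U"
    using \<phi>(1) by (intro lim[of \<phi> "concat (replicate k \<sigma>)"]) (simp_all add: replicate_add)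
  have "p (ss @ xs) \<longleftrightarrow> holds_at K \<phi> (concat ss @ concat xs)"
    using \<phi>(2)[of "ss @ xs"] len[of "ss @ xs"] ss xs X by (simp add: subset_trans[OF xs(2) X])
  also have "\<dots> \<longleftrightarrow> eventually (\<lambda>ts. p (ts @ xs)) U"
  proof -
    have "eventually (\<lambda>ts. holds_at K \<phi> (concat ts @ concat xs) \<longleftrightarrow> p (ts @ xs)) U"
      using ev
    proof eventually_elim
      case (elim ts)
      then have "set (ts @ xs) \<subseteq> tuples Y \<sigma>" using xs(2) X by auto
      then show ?case using \<phi>(2)[of "ts @ xs"] len[of "ts @ xs"] elim xs(1) by simp
    qed
    then show ?thesis unfolding lim' ultrafilter_iff[OF U] .
  qed
  finally show "p (ss @ xs) \<longleftrightarrow> eventually (\<lambda>ts. p (ts @ xs)) U" .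
qed

locale saturated_pair =
  fixes L :: "('s, 'f, 'r) language" and K :: "('s, 'f, 'r, 'a) struct"
    and N M' :: "'s \<Rightarrow> 'a set" and \<kappa> :: "'k rel" and \<sigma> :: "'s list"
    and A :: "'a list set" and r0 :: "'a list rel"
  assumes sat: "saturated \<kappa> (pair_language L) (pair_struct K M')"
    and M'_sub: "\<And>s. M' s \<subseteq> univ K s" and N_sub: "\<And>s. N s \<subseteq> univ K s"
    and no_IP: "\<And>\<rho> \<tau> \<psi>. \<psi> \<in> formulas L (\<rho> @ \<tau>) \<Longrightarrow> \<not> has_IP K \<rho> \<tau> \<psi>"
    and card_order: "Card_order \<kappa>"
    and small_base: "|Sigma UNIV N <+> {\<phi>. wf_fm L \<phi>}| <o \<kappa>"
    and A_sub: "A \<subseteq> tuples M' \<sigma>" and A_small: "|A| <o \<kappa>"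
    and A_ind: "indiscernible L K \<sigma> A r0"
begin

text \<open>\<open>(n, \<psi>, cs)\<close> encodes the formula \<open>\<psi>(x;c)\<close>, where \<open>cs\<close> lists the parameters \<open>c\<close> with their sorts.\<close>

definition inst :: "(nat \<times> ('s, 'f, 'r) fm \<times> ('s \<times> 'a) list) set" where
  "inst = {(n, \<psi>, cs). \<psi> \<in> formulas L (concat (replicate n \<sigma>) @ map fst cs) \<and> set cs \<subseteq> Sigma UNIV N}"

definition inst_holds :: "nat \<times> ('s, 'f, 'r) fm \<times> ('s \<times> 'a) list \<Rightarrow> 'a list list \<Rightarrow> bool" where
  "inst_holds d ws = (case d of (n, \<psi>, cs) \<Rightarrow> holds_at K \<psi> (concat ws @ map snd cs))"

sublocale witness_system "definable_pred L K \<sigma>" A r0 "tuples M' \<sigma>" inst fst inst_holds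
  using A_ind A_sub predicate_system_definable[of L K \<sigma>]
  by (simp add: witness_system_def witness_system_axioms_def indiscernible_iff)

text \<open>A set of cardinality \<open>|X| + |N| + |L|\<close>: infinite, below \<kappa> for small
  \<open>X\<close>, and for \<open>X = A\<close> large enough to bound the number of
  instances.\<close>

definition bound :: "'a list set \<Rightarrow> ('a list + 's \<times> 'a + ('s, 'f, 'r) fm) set" where
  "bound X = X <+> (Sigma UNIV N <+> {\<phi>. wf_fm L \<phi>})"

lemma infinite_\<kappa>: "\<not> finite (Field \<kappa>)"
proof
  assume fin: "finite (Field \<kappa>)"
  let ?B = "Sigma UNIV N <+> {\<phi>. wf_fm L \<phi>}"
  have "|?B| \<le>o |Field \<kappa>|"
    using small_base card_of_Field_ordIso[OF card_order] ordLess_imp_ordLeq ordIso_symmetric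
      ordLeq_ordIso_trans by blast
  then have "finite ?B" using fin card_of_ordLeq_finite by blast
  then show False using infinite_formulas[of L] by simp
qed

lemma bound:
  assumes "|X| <o \<kappa>"
  shows "infinite (bound X)" "|X| \<le>o |bound X|" "|Sigma UNIV N| \<le>o |bound X|"
    "|{\<phi>. wf_fm L \<phi>}| \<le>o |bound X|" "|bound X| <o \<kappa>"
proof -
  show "infinite (bound X)" using infinite_formulas[of L] by (simp add: bound_def)
  show "|X| \<le>o |bound X|" unfolding bound_def by (rule card_of_Plus1)
  have "|Sigma UNIV N <+> {\<phi>. wf_fm L \<phi>}| \<le>o |bound X|" unfolding bound_def by (rule card_of_Plus2)
  then show "|Sigma UNIV N| \<le>o |bound X|" "|{\<phi>. wf_fm L \<phi>}| \<le>o |bound X|"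
    using card_of_Plus1 card_of_Plus2 ordLeq_transitive by blast+
  show "|bound X| <o \<kappa>" unfolding bound_def
    using infinite_\<kappa> card_order assms small_base by (rule card_of_Plus_ordLess_infinite_Field)
qed

lemma inst_card: "|inst| \<le>o |bound A|"
proof -
  note b = bound[OF A_small]
  have "inst \<subseteq> (UNIV :: nat set) \<times> {\<phi>. wf_fm L \<phi>} \<times> lists (Sigma UNIV N)"
    by (auto simp: inst_def formulas_def)
  then have "|inst| \<le>o |(UNIV :: nat set) \<times> {\<phi>. wf_fm L \<phi>} \<times> lists (Sigma UNIV N)|"
    by (rule card_of_mono1)
  also have "|(UNIV :: nat set) \<times> {\<phi>. wf_fm L \<phi>} \<times> lists (Sigma UNIV N)| \<le>o |bound A|"
    using b card_of_lists[OF b(1,3)] infinite_iff_card_of_nat by (intro card_of_Times_bounded) blast+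
  finally show ?thesis .
qed

lemma small_parameters:
  assumes "|X| <o \<kappa>"
  shows "card_fam (\<lambda>s. coords \<sigma> X s \<union> N s) <o \<kappa>"
proof -
  note b = bound[OF assms]
  let ?I = "{..<length \<sigma>}"
  have sub: "Sigma UNIV (\<lambda>s. coords \<sigma> X s \<union> N s)
      \<subseteq> (\<Union>i\<in>?I. (\<lambda>a. (\<sigma> ! i, a ! i)) ` X) \<union> Sigma UNIV N"
    by (auto simp: coords_def)
  have "|\<Union>i\<in>?I. (\<lambda>a. (\<sigma> ! i, a ! i)) ` X| \<le>o |bound X|"
  proof (rule card_of_UNION_ordLeq_infinite[OF b(1)])
    show "|?I| \<le>o |bound X|"
      using b(1) by (intro ordLess_imp_ordLeq finite_ordLess_infinite card_of_Well_order)
        (simp_all add: Field_card_of)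
    show "\<forall>i\<in>?I. |(\<lambda>a. (\<sigma> ! i, a ! i)) ` X| \<le>o |bound X|"
      using b(2) card_of_image ordLeq_transitive by blast
  qed
  then have "|(\<Union>i\<in>?I. (\<lambda>a. (\<sigma> ! i, a ! i)) ` X) \<union> Sigma UNIV N| \<le>o |bound X|"
    using b(1,3)
    by (intro card_of_Un_ordLeq_infinite_Field card_of_Card_order) (simp_all only: Field_card_of simp_thms)
  then have "card_fam (\<lambda>s. coords \<sigma> X s \<union> N s) \<le>o |bound X|"
    unfolding card_fam_def using card_of_mono1[OF sub] ordLeq_transitive by blast
  then show ?thesis using b(5) by (rule ordLeq_ordLess_trans)
qed

text \<open>The parameters include \<open>N\<close>, not only the sequence: the limit tuple thereby
  takes the limit truth value on every instance \<open>\<psi>(x;c)\<close>, which a mere realisation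
  of \<open>q\<close> is not known to do.\<close>

lemma limit_exists:
  assumes X: "X \<subseteq> tuples M' \<sigma>" "|X| <o \<kappa>" and U: "ultrafilter U"
    and ev: "eventually (\<lambda>ts. length ts = n \<and> set ts \<subseteq> X) U"
  shows "\<exists>ss. length ss = n \<and> set ss \<subseteq> tuples M' \<sigma> \<and>
           (\<forall>\<tau> \<phi> c. \<phi> \<in> formulas L (concat (replicate n \<sigma>) @ \<tau>) \<longrightarrow>
              c \<in> tuples (\<lambda>s. coords \<sigma> X s \<union> N s) \<tau> \<longrightarrow>
              (holds_at K \<phi> (concat ss @ c) \<longleftrightarrow> eventually (\<lambda>ts. holds_at K \<phi> (concat ts @ c)) U))"
proof (rule saturated_limit[OF sat M'_sub])
  show "coords \<sigma> X s \<union> N s \<subseteq> univ K s" for s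
  proof -
    have "x \<in> univ K s" if "x \<in> coords \<sigma> X s" for x
    proof -
      obtain a i where a: "a \<in> X" "i < length \<sigma>" "\<sigma> ! i = s" "x = a ! i"
        using \<open>x \<in> coords \<sigma> X s\<close> unfolding coords_def by blast
      then have "a \<in> tuples M' \<sigma>" using X(1) by blast
      then have "x \<in> M' s" using a by (auto simp: tuples_iff)
      then show ?thesis using M'_sub by blast
    qed
    then show ?thesis using N_sub by blast
  qed
  show "card_fam (\<lambda>s. coords \<sigma> X s \<union> N s) <o \<kappa>" using X(2) by (rule small_parameters)
  show "eventually (\<lambda>ts. length ts = n \<and> set ts \<subseteq> tuples M' \<sigma>) U"
    using ev by eventually_elim (use X(1) in blast)
qed (rule U)

lemma inst_params: "d \<in> inst \<Longrightarrow> d = (n, \<psi>, cs) \<Longrightarrow> map snd cs \<in> tuples N (map fst cs)"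
  unfolding inst_def tuples_iff by (fastforce dest: nth_mem)

text \<open>
  A tuple \<open>bs\<close> and a realisation \<open>ss\<close> of the same limit type over \<open>X\<close>, \<open>bs\<close> and \<open>N\<close> that disagree about
  \<open>d\<close> would be a witness for \<open>d\<close>; by maximality there are then such witnesses inside the sequence,
  relative to any finite set, which yields the independence property.
\<close>

lemma limit_determined:
  assumes s: "good s" and max: "\<And>t. good t \<Longrightarrow> s \<subseteq> t \<Longrightarrow> t = s"
    and X_def: "X = Field (ord s)" and X_small: "|X| <o \<kappa>"
    and U: "ultrafilter U" and ev: "eventually (\<lambda>ts. length ts = n \<and> set ts \<subseteq> X) U"
    and bs: "length bs = n" "set bs \<subseteq> tuples M' \<sigma>"
    and lim: "\<And>\<tau> \<phi> c. \<phi> \<in> formulas L (concat (replicate n \<sigma>) @ \<tau>) \<Longrightarrow> c \<in> tuples (coords \<sigma> X) \<tau> \<Longrightarrow>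
      holds_at K \<phi> (concat bs @ c) \<longleftrightarrow> eventually (\<lambda>ts. holds_at K \<phi> (concat ts @ c)) U"
    and d: "d \<in> inst" "fst d = n"
  shows "inst_holds d bs \<longleftrightarrow> eventually (\<lambda>ts. inst_holds d ts) U"
proof (rule ccontr)
  assume contr: "\<not> ?thesis"
  obtain \<psi> cs where d_eq: "d = (n, \<psi>, cs)" using d(2) by (cases d) auto
  define \<tau> where "\<tau> = map fst cs"
  have \<psi>: "\<psi> \<in> formulas L (concat (replicate n \<sigma>) @ \<tau>)" using d(1) by (simp add: d_eq inst_def \<tau>_def)
  have c: "map snd cs \<in> tuples N \<tau>" using inst_params[OF d(1) d_eq] by (simp add: \<tau>_def)
  have X: "X \<subseteq> tuples M' \<sigma>" using goodD(4)[OF s] by (simp add: X_def)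
  have lin: "linear_order_on X (ord s)" and ind: "indisc X (ord s)"
    using goodD(1,2)[OF s] by (simp_all add: X_def)
  interpret b: limit_tuple "definable_pred L K \<sigma>" X "ord s" n U bs
    by (rule limit_tuple_definable[OF X lin ind U ev bs lim])
  have X1: "b.X' \<subseteq> tuples M' \<sigma>" using X bs(2) by (simp add: b.X'_def)
  have "|set bs| <o \<kappa>"
    using infinite_\<kappa> card_order_on_well_order_on[OF card_order]
    by (intro finite_ordLess_infinite card_of_Well_order) (simp_all add: Field_card_of)
  then have X1_small: "|b.X'| <o \<kappa>"
    unfolding b.X'_def by (intro card_of_Un_ordLess_infinite_Field infinite_\<kappa> card_order X_small)
  have ev1: "eventually (\<lambda>ts. length ts = n \<and> set ts \<subseteq> b.X') U"
    using ev by eventually_elim (auto simp: b.X'_def)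
  obtain ss where ss: "length ss = n" "set ss \<subseteq> tuples M' \<sigma>"
    and lim1: "\<And>\<tau> \<phi> c. \<phi> \<in> formulas L (concat (replicate n \<sigma>) @ \<tau>) \<Longrightarrow>
       c \<in> tuples (\<lambda>s. coords \<sigma> b.X' s \<union> N s) \<tau> \<Longrightarrow>
       holds_at K \<phi> (concat ss @ c) \<longleftrightarrow> eventually (\<lambda>ts. holds_at K \<phi> (concat ts @ c)) U"
    using limit_exists[OF X1 X1_small U ev1] by blast
  \<comment> \<open>The second limit is along the same \<open>U\<close>, which still lives on tuples
    of the larger sequence, but is taken over \<open>X\<close> together with \<open>bs\<close>. This
    makes \<open>ss\<close> adjoinable after \<open>bs\<close>.\<close>
  interpret s: limit_tuple "definable_pred L K \<sigma>" b.X' b.r' n U ss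
  proof (rule limit_tuple_definable[OF X1 b.lin' b.ind' U ev1 ss lim1])
    show "c \<in> tuples (\<lambda>s. coords \<sigma> b.X' s \<union> N s) \<tau>" if "c \<in> tuples (coords \<sigma> b.X') \<tau>" for c \<tau>
      using that unfolding tuples_iff by blast
  qed
  have "inst_holds d ss \<longleftrightarrow> eventually (\<lambda>ts. inst_holds d ts) U"
    unfolding inst_holds_def d_eq prod.case
    by (rule lim1[OF \<psi>]) (use c in \<open>auto simp: tuples_iff\<close>)
  then have differ: "inst_holds d bs \<longleftrightarrow> \<not> inst_holds d ss" using contr by simp
  have FR: "Field s.r' = s.X'" using s.lin' by (rule Field_linear_order)
  have X_sub: "X \<subseteq> b.X'" "b.X' \<subseteq> s.X'"
    by (simp add: b.X'_def) (unfold s.X'_def, rule Un_upper1)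
  have FX: "Field s.r' = Field (ord s) \<union> set bs \<union> set ss"
    unfolding FR s.X'_def by (unfold b.X'_def) (simp only: X_def)
  \<comment> \<open>Entries of \<open>bs\<close> in \<open>X\<close> belong to every
    \<open>Fs\<close> large enough, so they are exactly the overlap that has to be
    tolerated.\<close>
  obtain Gs where Gs: "set Gs = set bs \<inter> X" using finite_list[of "set bs \<inter> X"] by auto
  \<comment> \<open>Relative to \<open>X\<close>, the positions of \<open>bs ! i\<close> and of
    \<open>ss ! i\<close> are both the limit along \<open>U\<close> of the position of
    \<open>t ! i\<close>.\<close>
  have nonsep: "\<not> separates s.r' x (bs ! i) (ss ! i)" if "x \<in> X" "i < n" for x i
  proof -
    have x1: "x \<in> b.X'" and y: "bs ! i \<in> b.X'" using that X_sub b.nth_in_X' by auto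
    have mem: "eventually (\<lambda>t. t ! i \<in> X) U"
      using ev by eventually_elim (use that(2) nth_mem in blast)
    have "eventually (\<lambda>t. (x, t ! i) \<in> b.r' \<longleftrightarrow> (x, t ! i) \<in> ord s) U"
      "eventually (\<lambda>t. (t ! i, x) \<in> b.r' \<longleftrightarrow> (t ! i, x) \<in> ord s) U"
      using mem by (eventually_elim, use that(1) b.r'_restrict in simp)+
    then show ?thesis
      using s.order_left[OF x1 that(2)] s.order_right[OF x1 that(2)] b.order_left[OF that] b.order_right[OF that]
        s.r'_restrict[OF x1 y] s.r'_restrict[OF y x1]
      by (simp add: separates_def ultrafilter_iff[OF U])
  qed
  have same: "(bs ! i, bs ! j) \<in> s.r' \<longleftrightarrow> (ss ! i, ss ! j) \<in> s.r'" if "i < n" "j < n" for i j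
  proof -
    have "eventually (\<lambda>t. (t ! i, t ! j) \<in> b.r' \<longleftrightarrow> (t ! i, t ! j) \<in> ord s) U"
      using ev by eventually_elim (use that b.r'_restrict nth_mem in blast)
    then show ?thesis
      using s.order_within[OF that] b.order_within[OF that]
        s.r'_restrict[OF b.nth_in_X'[OF that(1)] b.nth_in_X'[OF that(2)]]
      by (simp add: ultrafilter_iff[OF U])
  qed
  have wits: "\<exists>zs zs'. wit (ord s) Fs Gs d zs zs'" if Fs: "set Fs \<subseteq> Field (ord s)" for Fs
  proof (rule maximal_state_witness[OF s max, of Fs Gs s.r' bs ss d])
    show "set Fs \<union> set Gs \<subseteq> Field (ord s)" using Fs Gs by (auto simp: X_def)
    show "linear_order_on (Field s.r') s.r'" "indisc (Field s.r') s.r'"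
      using s.lin' s.ind' unfolding FR .
    show "ord s \<subseteq> s.r'" using b.r_subset s.r_subset by blast
    show "Field s.r' \<subseteq> tuples M' \<sigma>" using X bs(2) ss(2) unfolding FX X_def[symmetric] by blast
    show "Field s.r' = Field (ord s) \<union> set bs \<union> set ss"
      by (rule FX)
    show "\<forall>x\<in>Field s.r' - Z. \<not> separates s.r' x y y'"
      if "y \<in> Field (ord s)" "y' \<in> Field (ord s)" "finite Z"
        "\<forall>x\<in>Field (ord s) - Z. \<not> separates (ord s) x y y'" for y y' Z
    proof -
      have "\<forall>x\<in>b.X' - Z. \<not> separates b.r' x y y'"
        using that by (intro b.separates_extend) (simp_all add: X_def)
      then show ?thesis
        unfolding FR using that X_sub by (intro s.separates_extend) (auto simp: X_def)
    qed
    \<comment> \<open>An entry of \<open>ss\<close> in \<open>X\<close> does not separate itself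
      from the corresponding entry of \<open>bs\<close>, so the two are equal.\<close>
    have ss_Fs: "set ss \<inter> set Fs \<subseteq> set Gs"
    proof
      fix x assume "x \<in> set ss \<inter> set Fs"
      then have "x \<in> set ss" and x: "x \<in> X" using Fs unfolding X_def by blast+
      then obtain i where i: "i < n" "ss ! i = x" using ss(1) by (auto simp: in_set_conv_nth)
      have "(x, x) \<in> s.r'" using x X_sub by (intro linear_orderD(2)[OF s.lin']) blast
      then have "(x, bs ! i) \<in> s.r'" "(bs ! i, x) \<in> s.r'"
        using nonsep[OF x i(1)] i(2) unfolding separates_def by simp_all
      then have "x = bs ! i" by (rule linear_orderD(4)[OF s.lin'])
      then show "x \<in> set Gs" using Gs x i(1) bs(1) by simp
    qed
    show "wit s.r' Fs Gs d bs ss"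
      unfolding wit_def
    proof (intro conjI)
      show "set Fs \<union> set Gs \<union> set bs \<union> set ss \<subseteq> Field s.r'"
        using Fs Gs unfolding FX X_def[symmetric] by blast
      show "\<forall>i<fst d. \<forall>x\<in>Field s.r' - (set bs \<union> set ss - set Fs). \<not> separates s.r' x (bs ! i) (ss ! i)"
      proof (intro allI impI ballI)
        fix i x assume "i < fst d" and x: "x \<in> Field s.r' - (set bs \<union> set ss - set Fs)"
        \<comment> \<open>An element that is not exempt is either an old one or belongs to
          \<open>Fs\<close>, which lies in \<open>X\<close>; so nonseparation over \<open>X\<close>
          is enough.\<close>
        then have "x \<in> X" using Fs unfolding FX X_def[symmetric] by blast
        then show "\<not> separates s.r' x (bs ! i) (ss ! i)" using \<open>i < fst d\<close> d(2) nonsep by simp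
      qed
      show "\<forall>i<fst d. \<forall>j<fst d. (bs ! i, bs ! j) \<in> s.r' \<longleftrightarrow> (ss ! i, ss ! j) \<in> s.r'"
        using same d(2) by simp
      show "(set bs \<union> set ss) \<inter> set Fs \<subseteq> set Gs" using ss_Fs Fs Gs unfolding X_def by blast
    qed (use d bs ss differ in simp_all)
  qed
  have "set Gs \<subseteq> Field (ord s)" using Gs by (simp add: X_def)
  from alternating_witnesses[OF goodD(1,2)[OF s] this wits] obtain w where
    "\<forall>k b. length (w k b) = fst d \<and> set (w k b) \<subseteq> Field (ord s) \<and> (inst_holds d (w k b) \<longleftrightarrow> b)"
    "\<forall>m p f g. definable_pred L K \<sigma> (m * fst d) p \<longrightarrow>
        p (concat (map (\<lambda>k. w k (f k)) [0..<m])) = p (concat (map (\<lambda>k. w k (g k)) [0..<m]))"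
    by blast
  then have w: "\<And>k b. length (w k b) = n" "\<And>k b. set (w k b) \<subseteq> X"
      "\<And>k b. inst_holds d (w k b) \<longleftrightarrow> b"
    and w_same: "\<And>m p f g. definable_pred L K \<sigma> (m * n) p \<Longrightarrow>
        p (concat (map (\<lambda>k. w k (f k)) [0..<m])) = p (concat (map (\<lambda>k. w k (g k)) [0..<m]))"
    unfolding d(2) X_def by blast+
  have "has_IP K (concat (replicate n \<sigma>)) \<tau> \<psi>"
    unfolding has_IP_def
  proof
    fix m
    let ?a = "\<lambda>i. concat (w i False)"
    have block: "take n (drop (k * n) (concat (map (\<lambda>k. w k (f k)) [0..<m]))) = w k (f k)" if "k < m" for k f
      using concat_block[of "map (\<lambda>k. w k (f k)) [0..<m]" n 1 k] w(1) that by (simp add: take_Suc_conv_app_nth)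
    have "\<exists>c\<in>tuples (univ K) \<tau>. \<forall>k<m. holds_at K \<psi> (?a k @ c) \<longleftrightarrow> k \<in> S" for S
    proof -
      let ?p = "\<lambda>ws. \<exists>c\<in>tuples (univ K) \<tau>. \<forall>k<m.
           holds_at K \<psi> (concat (take n (drop (k * n) ws)) @ c) \<longleftrightarrow> k \<in> S"
      \<comment> \<open>If block \<open>k\<close> is chosen according to whether
        \<open>k \<in> S\<close>, the original parameters of \<open>d\<close> produce the pattern
        \<open>S\<close>. By \<open>w_same\<close>, some other parameters produce it on the constant
        choice \<open>False\<close>, so the tuples \<open>?a\<close> are the same for all
        \<open>S\<close>.\<close>
      have "?p (concat (map (\<lambda>k. w k (k \<in> S)) [0..<m]))"
      proof (intro bexI allI impI)
        show "holds_at K \<psi> (concat (take n (drop (k * n) (concat (map (\<lambda>k. w k (k \<in> S)) [0..<m])))) @ map snd cs)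
            \<longleftrightarrow> k \<in> S" if "k < m" for k
          unfolding block[OF that] using w(3)[of k "k \<in> S"] by (simp add: inst_holds_def d_eq)
        show "map snd cs \<in> tuples (univ K) \<tau>" using c N_sub unfolding tuples_iff by blast
      qed
      then have "?p (concat (map (\<lambda>k. w k False) [0..<m]))"
        using w_same[OF definable_pred_pattern[OF \<psi>, where m = m and K = K and S = S],
          of "\<lambda>k. k \<in> S" "\<lambda>_. False"] by blast
      then obtain c where "c \<in> tuples (univ K) \<tau>" and *: "\<forall>k<m. holds_at K \<psi>
          (concat (take n (drop (k * n) (concat (map (\<lambda>k. w k False) [0..<m])))) @ c) \<longleftrightarrow> k \<in> S" by blast
      moreover have "holds_at K \<psi> (?a k @ c) \<longleftrightarrow> k \<in> S" if "k < m" for k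
        using * that block[OF that, of "\<lambda>_. False"] by auto
      ultimately show ?thesis by blast
    qed
    then obtain c where c: "\<And>S. c S \<in> tuples (univ K) \<tau>"
      "\<And>S k. k < m \<Longrightarrow> holds_at K \<psi> (?a k @ c S) \<longleftrightarrow> k \<in> S" by metis
    moreover have "?a i \<in> tuples (univ K) (concat (replicate n \<sigma>))" for i
    proof -
      have "set (w i False) \<subseteq> tuples (univ K) \<sigma>"
        using w(2)[of i False] X tuples_mono[of M' "univ K" \<sigma>] M'_sub by blast
      then show ?thesis using concat_in_tuples[of "w i False" "univ K" \<sigma>] w(1) by simp
    qed
    ultimately show "\<exists>a b. (\<forall>i<m. a i \<in> tuples (univ K) (concat (replicate n \<sigma>))) \<and>
        (\<forall>S\<subseteq>{..<m}. b S \<in> tuples (univ K) \<tau>) \<and>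
        (\<forall>i<m. \<forall>S\<subseteq>{..<m}. holds_at K \<psi> (a i @ b S) \<longleftrightarrow> i \<in> S)"
      by (intro exI[of _ ?a] exI[of _ c]) simp
  qed
  then show False using no_IP[OF \<psi>] by blast
qed

end

section \<open>From finitely realised types to types over \<open>N\<close>\<close>

text \<open>The solution sets of finite parts of \<open>q\<close> among the lists of
  \<open>n\<close> terms have the finite intersection property, since a finite union of finite parts
  is again a finite part.\<close>

lemma ultrafilter_of_type:
  assumes "finitely_realised K (ntuples n X) q"
  shows "\<exists>U. ultrafilter U \<and> eventually (\<lambda>ts. length ts = n \<and> set ts \<subseteq> X) U \<and>
           (\<forall>\<phi>\<in>q. eventually (\<lambda>ts. holds_at (param_struct K) \<phi> (concat ts)) U)"
proof -
  let ?S = "\<lambda>F. {ts. length ts = n \<and> set ts \<subseteq> X \<and> (\<forall>\<phi>\<in>F. holds_at (param_struct K) \<phi> (concat ts))}"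
  let ?I = "{F. finite F \<and> F \<subseteq> q}"
  have "(INF F\<in>?I. principal (?S F)) \<noteq> bot"
  proof (rule INF_filter_not_bot)
    fix J assume J: "J \<subseteq> ?I" "finite J"
    then have "\<Union>J \<subseteq> q" "finite (\<Union>J)" by auto
    then obtain a where "a \<in> ntuples n X" "realises K a (\<Union>J)"
      using assms unfolding finitely_realised_def by blast
    then obtain ts where ts: "length ts = n" "set ts \<subseteq> X" "realises K (concat ts) (\<Union>J)"
      unfolding ntuples_def by blast
    then have "ts \<in> (\<Inter>F\<in>J. ?S F)" unfolding realises_def by blast
    then show "(INF F\<in>J. principal (?S F)) \<noteq> bot"
      unfolding INF_principal_finite[OF J(2)] principal_eq_bot_iff by blast
  qed
  then obtain U where U: "ultrafilter U" "U \<le> (INF F\<in>?I. principal (?S F))"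
    using ultrafilter_exists by blast
  have S: "eventually (\<lambda>ts. ts \<in> ?S F) U" if "F \<in> ?I" for F
  proof -
    have "U \<le> principal (?S F)" using U(2) INF_lower[OF that] by (rule order_trans)
    then show ?thesis unfolding le_principal .
  qed
  have "eventually (\<lambda>ts. length ts = n \<and> set ts \<subseteq> X) U"
    using S[of "{}"] by simp
  moreover have "eventually (\<lambda>ts. holds_at (param_struct K) \<phi> (concat ts)) U" if "\<phi> \<in> q" for \<phi>
    using S[of "{\<phi>}"] that by (auto elim: eventually_mono)
  ultimately show ?thesis using U(1) by blast
qed

text \<open>As \<open>q\<close> is complete over \<open>B\<close>, it decides every instance with
  parameters in \<open>B\<close>, and both \<open>b\<close> and \<open>U\<close> follow this
  decision.\<close>

lemma limit_of_type:
  assumes q: "complete_type L K B \<rho> q" and U: "ultrafilter U"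
    and len: "eventually (\<lambda>ts. length (concat ts) = length \<rho>) U"
    and ev: "\<And>\<phi>. \<phi> \<in> q \<Longrightarrow> eventually (\<lambda>ts. holds_at (param_struct K) \<phi> (concat ts)) U"
    and b: "length b = length \<rho>" "realises K b q"
    and \<phi>: "\<phi> \<in> formulas L (\<rho> @ \<tau>)" and c: "c \<in> tuples B \<tau>"
  shows "holds_at K \<phi> (b @ c) \<longleftrightarrow> eventually (\<lambda>ts. holds_at K \<phi> (concat ts @ c)) U"
proof -
  obtain \<phi>' where \<phi>': "\<phi>' \<in> formulas (param_language L B) \<rho>"
    "\<And>a. length a = length \<rho> \<Longrightarrow> holds_at (param_struct K) \<phi>' a \<longleftrightarrow> holds_at K \<phi> (a @ c)"
    using param_formula[OF \<phi> c, of K] by blast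
  have "eventually (\<lambda>ts. holds_at (param_struct K) \<phi>' (concat ts) \<longleftrightarrow> holds_at K \<phi> (concat ts @ c)) U"
    using len by eventually_elim (rule \<phi>'(2))
  then have U_iff: "eventually (\<lambda>ts. holds_at (param_struct K) \<phi>' (concat ts)) U \<longleftrightarrow>
      eventually (\<lambda>ts. holds_at K \<phi> (concat ts @ c)) U"
    unfolding ultrafilter_iff[OF U] .
  have "\<phi>' \<in> q \<or> Neg \<phi>' \<in> q" using q \<phi>'(1) unfolding complete_type_def by blast
  then show ?thesis
  proof
    assume "\<phi>' \<in> q"
    then show ?thesis using ev b(2) \<phi>'(2)[OF b(1)] U_iff by (simp add: realises_def)
  next
    assume *: "Neg \<phi>' \<in> q"
    then have "eventually (\<lambda>ts. \<not> holds_at (param_struct K) \<phi>' (concat ts)) U"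
      using ev[OF *] by (simp add: holds_at_def)
    moreover have "\<not> holds_at (param_struct K) \<phi>' b"
      using * b(2) by (fastforce simp: realises_def holds_at_def)
    ultimately show ?thesis
      using \<phi>'(2)[OF b(1)] U_iff by (simp add: ultrafilter_not[OF U])
  qed
qed

lemma (in saturated_pair) determined_types:
  "\<exists>X r. X \<subseteq> tuples M' \<sigma> \<and> |X| <o \<kappa> \<and> indiscernible L K \<sigma> X r \<and> extends_seq X r A r0 \<and>
     (\<forall>n q. complete_type L K (coords \<sigma> X) (concat (replicate n \<sigma>)) q \<longrightarrow>
        finitely_realised K (ntuples n X) q \<longrightarrow>
        (\<forall>b\<in>tuples M' (concat (replicate n \<sigma>)). \<forall>b'\<in>tuples M' (concat (replicate n \<sigma>)).
           realises K b q \<longrightarrow> realises K b' q \<longrightarrow>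
           tp L K N (concat (replicate n \<sigma>)) b = tp L K N (concat (replicate n \<sigma>)) b'))"
proof -
  obtain s where s: "good s" and max: "\<And>t. good t \<Longrightarrow> s \<subseteq> t \<Longrightarrow> t = s"
    using maximal_good_state by blast
  define X where "X = Field (ord s)"
  have X: "X \<subseteq> tuples M' \<sigma>" using goodD(4)[OF s] by (simp add: X_def)
  have small: "|X| <o \<kappa>"
    using good_card[OF s bound(1,2)[OF A_small] inst_card] bound(5)[OF A_small]
    unfolding X_def by (rule ordLeq_ordLess_trans)
  have "indiscernible L K \<sigma> X (ord s)"
    unfolding indiscernible_iff using goodD(1,2)[OF s] X tuples_mono[of M' "univ K" \<sigma>] M'_sub
    by (auto simp: X_def)
  moreover have "extends_seq X (ord s) A r0"
  proof -
    have lin: "linear_order_on (Field (ord s)) (ord s)" by (rule goodD(1)[OF s])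
    have A: "A \<subseteq> X"
      using mono_Field[OF goodD(3)[OF s]] Field_linear_order[OF lin0] by (simp add: X_def)
    have "(x, y) \<in> ord s \<longleftrightarrow> (x, y) \<in> r0" if "x \<in> A" "y \<in> A" for x y
      using lin0 lin goodD(3)[OF s] that by (rule linear_order_subset_iff)
    moreover have "r0 \<subseteq> A \<times> A" using linear_orderD(1)[OF lin0] by auto
    ultimately have "Restr (ord s) A = r0" by blast
    then show ?thesis using A by (simp add: extends_seq_def)
  qed
  moreover have "tp L K N (concat (replicate n \<sigma>)) b = tp L K N (concat (replicate n \<sigma>)) b'"
    if q: "complete_type L K (coords \<sigma> X) (concat (replicate n \<sigma>)) q" "finitely_realised K (ntuples n X) q"
      and b: "b \<in> tuples M' (concat (replicate n \<sigma>))" "realises K b q"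
      and b': "b' \<in> tuples M' (concat (replicate n \<sigma>))" "realises K b' q" for n q b b'
  proof -
    let ?\<rho> = "concat (replicate n \<sigma>)"
    obtain U where U: "ultrafilter U" and ev: "eventually (\<lambda>ts. length ts = n \<and> set ts \<subseteq> X) U"
      and evq: "\<And>\<phi>. \<phi> \<in> q \<Longrightarrow> eventually (\<lambda>ts. holds_at (param_struct K) \<phi> (concat ts)) U"
      using ultrafilter_of_type[OF q(2)] by blast
    have len: "eventually (\<lambda>ts. length (concat ts) = length ?\<rho>) U"
      using ev
    proof eventually_elim
      case (elim ts)
      then have "concat ts \<in> tuples M' ?\<rho>" using concat_in_tuples[of ts M' \<sigma>] X by auto
      then show ?case by (rule length_tuples)
    qed
    \<comment> \<open>\<open>U\<close> was chosen from \<open>q\<close> before \<open>a\<close>, and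
      the right-hand side does not mention \<open>a\<close>; applied to \<open>b\<close> and to
      \<open>b'\<close> this gives the equality of types.\<close>
    have key: "holds_at K \<psi> (a @ map snd cs) \<longleftrightarrow> eventually (\<lambda>ts. inst_holds (n, \<psi>, cs) ts) U"
      if a: "a \<in> tuples M' ?\<rho>" "realises K a q" and d: "(n, \<psi>, cs) \<in> inst" for a \<psi> cs
    proof -
      obtain as where as: "length as = n" "set as \<subseteq> tuples M' \<sigma>" "a = concat as"
        using tuples_concat_cases[OF a(1)] by blast
      have "holds_at K \<phi> (concat as @ c) \<longleftrightarrow> eventually (\<lambda>ts. holds_at K \<phi> (concat ts @ c)) U"
        if "\<phi> \<in> formulas L (?\<rho> @ \<tau>)" "c \<in> tuples (coords \<sigma> X) \<tau>" for \<tau> \<phi> c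
        using limit_of_type[OF q(1) U len evq length_tuples[OF a(1)] a(2) that] as(3) by simp
      from limit_determined[OF s max X_def small U ev as(1,2) this d]
      show ?thesis using as(3) by (simp add: inst_holds_def)
    qed
    have "holds_at (param_struct K) \<phi> b \<longleftrightarrow> holds_at (param_struct K) \<phi> b'"
      if \<phi>: "\<phi> \<in> formulas (param_language L N) ?\<rho>" for \<phi>
    proof -
      obtain cs \<psi> where cs: "set cs \<subseteq> Sigma UNIV N" "\<psi> \<in> formulas L (?\<rho> @ map fst cs)"
        "\<And>a. length a = length ?\<rho> \<Longrightarrow> holds_at (param_struct K) \<phi> a \<longleftrightarrow> holds_at K \<psi> (a @ map snd cs)"
        using unparam_formula[OF \<phi>, of K] by blast
      then have d: "(n, \<psi>, cs) \<in> inst" by (simp add: inst_def)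
      show ?thesis
        unfolding cs(3)[OF length_tuples[OF b(1)]] cs(3)[OF length_tuples[OF b'(1)]]
          key[OF b d] key[OF b' d] ..
    qed
    then show ?thesis unfolding tp_def by blast
  qed
  ultimately show ?thesis using X small by blast
qed

section \<open>Transfer of the theory to \<open>N'\<close>\<close>

lemma translation_pair: "translation L (pair_language L) K (pair_struct K X) Fn Inl UNIV {} 0"
proof
  fix c ts assume "c \<in> funs L" "list_all2 (has_sort (pair_language L)) ts (fun_dom L c)"
  then show "has_sort (pair_language L) (Fn c ts) (fun_cod L c)"
    using has_sort.intros(2)[of c "pair_language L" ts] by (simp add: pair_language_def)
qed (simp_all add: pair_language_def pair_struct_def)

text \<open>The translated sentence has to be the same for all pairs, since it is compared in
  \<open>(N, M)\<close> and in \<open>(N', M')\<close>; hence the structures are quantified after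
  it.\<close>

lemma sentence_pair:
  fixes L :: "('s, 'f, 'r) language"
  assumes \<phi>: "\<phi> \<in> formulas L []"
  shows "\<exists>\<phi>'\<in>formulas (pair_language L) []. \<forall>K' X.
           holds_at (pair_struct (K' :: ('s, 'f, 'r, 'a) struct) X) \<phi>' [] \<longleftrightarrow> holds_at K' \<phi> []"
proof -
  interpret translation L "pair_language L" K' "pair_struct K' X" Fn Inl UNIV "{}" 0
    for K' :: "('s, 'f, 'r, 'a) struct" and X by (rule translation_pair)
  let ?\<phi> = "sub_fm Fn Inl \<phi> 0 Var :: ('s, 'f, 'r + 's) fm"
  have wf: "wf_fm L \<phi>" and fv: "fv \<phi> = {}" using \<phi> by (simp_all add: formulas_def)
  have "wf_fm (pair_language L) ?\<phi>" by (rule wf_sub_fm[OF wf]) (simp add: fv)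
  moreover have "fv ?\<phi> = {}" using fv_sub_fm[OF wf, of 0 Var] by (simp add: fv)
  ultimately have "?\<phi> \<in> formulas (pair_language L) []" by (simp add: formulas_def)
  moreover have "holds_at (pair_struct K' X) ?\<phi> [] \<longleftrightarrow> holds_at K' \<phi> []"
    for K' :: "('s, 'f, 'r, 'a) struct" and X
    unfolding holds_at_def using sat_sub_fm[OF wf, of _ 0 Var K' X] by (simp add: fv)
  ultimately show ?thesis by blast
qed

text \<open>\<open>NIP\<close> speaks about models of \<open>T\<close>, so \<open>N'\<close> must be
  known to be one. Each sentence of \<open>T\<close> passes from \<open>M\<close> to
  \<open>N\<close>, then through the pair language from \<open>(N, M)\<close> to
  \<open>(N', M')\<close>.\<close>

lemma is_model_pair_extension:
  assumes T: "T \<subseteq> formulas L []" and M: "is_model L T M" and MN: "elementary_extension L M N"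
    and NN: "elementary_extension (pair_language L) (pair_struct N X) (pair_struct N' Y)"
  shows "is_model L T N'"
  unfolding is_model_def
proof (intro conjI ballI)
  have "is_structure (pair_language L) (pair_struct N' Y)"
    using NN unfolding elementary_extension_def substructure_def by blast
  then show "is_structure L N'"
    by (simp add: is_structure_def pair_language_def pair_struct_def)
  fix \<phi> assume "\<phi> \<in> T"
  then have \<phi>: "\<phi> \<in> formulas L []" using T by blast
  then obtain \<phi>' where \<phi>': "\<phi>' \<in> formulas (pair_language L) []"
    "\<And>K X. holds_at (pair_struct (K :: ('a, 'b, 'c, 'd) struct) X) \<phi>' [] \<longleftrightarrow> holds_at K \<phi> []"
    using sentence_pair by blast
  have "holds_at M \<phi> []" using M \<open>\<phi> \<in> T\<close> by (simp add: is_model_def)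
  then have "holds_at N \<phi> []"
    using MN \<phi> unfolding elementary_extension_def by (force simp: tuples_def)
  then have "holds_at (pair_struct N X) \<phi>' []" by (simp add: \<phi>'(2))
  then have "holds_at (pair_struct N' Y) \<phi>' []"
    using NN \<phi>'(1) unfolding elementary_extension_def by (force simp: tuples_def)
  then show "holds_at N' \<phi> []" by (simp add: \<phi>'(2))
qed

theorem lemma1p3:
  fixes L :: "('s, 'f, 'r) language"
    and T :: "('s, 'f, 'r) fm set"
    and M N N' :: "('s, 'f, 'r, 'a) struct"
    and M' :: "'s \<Rightarrow> 'a set"
    and \<mu> :: "'m rel" and \<kappa> :: "'k rel"
    and \<sigma> :: "'s list" and A :: "'a list set" and r :: "'a list rel"
  assumes "complete_theory TYPE('a) L T" and "NIP TYPE('a) L T"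
    and "is_model L T M"
    and "elementary_extension L M N"
    and "Card_order \<mu>" and "card_fam (univ M) +c card_lang L <o \<mu>"
    and "saturated \<mu> L N"
    and "\<And>s. M' s \<subseteq> univ N' s"
    and "elementary_extension (pair_language L) (pair_struct N (univ M)) (pair_struct N' M')"
    and "Card_order \<kappa>" and "card_fam (univ N) +c card_lang L <o \<kappa>"
    and "saturated \<kappa> (pair_language L) (pair_struct N' M')"
    and "strongly_homogeneous \<kappa> (pair_language L) (pair_struct N' M')"
    and "A \<subseteq> tuples M' \<sigma>" and "|A| <o \<kappa>" and "nonconstant A"
    and "indiscernible L N' \<sigma> A r"
  shows "\<exists>A' r'. A' \<subseteq> tuples M' \<sigma> \<and> |A'| <o \<kappa> \<and> indiscernible L N' \<sigma> A' r' \<and>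
           extends_seq A' r' A r \<and>
           (\<forall>n q. complete_type L N' (coords \<sigma> A') (concat (replicate n \<sigma>)) q \<longrightarrow>
              finitely_realised N' (ntuples n A') q \<longrightarrow>
              (\<forall>b\<in>tuples M' (concat (replicate n \<sigma>)). \<forall>b'\<in>tuples M' (concat (replicate n \<sigma>)).
                 realises N' b q \<longrightarrow> realises N' b' q \<longrightarrow>
                 tp L N' (univ N) (concat (replicate n \<sigma>)) b
                   = tp L N' (univ N) (concat (replicate n \<sigma>)) b'))"
proof -
  have "T \<subseteq> formulas L []" using assms(1) by (simp add: complete_theory_def)
  from this assms(3,4,9) have model: "is_model L T N'" by (rule is_model_pair_extension)
  have N_sub: "univ N s \<subseteq> univ N' s" for s
    using assms(9) unfolding elementary_extension_def substructure_def pair_univ by blast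
  have "saturated_pair L N' (univ N) M' \<kappa> \<sigma> A r"
  proof
    show "\<not> has_IP N' \<rho> \<tau> \<psi>" if "\<psi> \<in> formulas L (\<rho> @ \<tau>)" for \<rho> \<tau> \<psi>
      using assms(2) model that unfolding NIP_def by blast
    show "|Sigma UNIV (univ N) <+> {\<phi>. wf_fm L \<phi>}| <o \<kappa>"
      using assms(11) by (simp add: csum_def card_fam_def card_lang_def Field_card_of)
  qed (fact assms(12) assms(8) N_sub assms(10) assms(14) assms(15) assms(17))+
  then show ?thesis by (rule saturated_pair.determined_types)
qed

end
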